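(* Let $S>0$ and let $\alpha,\alpha'\in[0,\pi)$ with $\alpha'\neq\alpha$. For real-valued $q\in L^2[-S,S]$, a real $2\times2$ matrix $M$ with $\det M=1$ and $\beta\in(0,\pi]$, consider the problem $-y''+qy=\lambda y$ on $[-S,S]$ with transfer condition $(y(0^+),y'(0^+))^T=M(y(0^-),y'(0^-))^T$ and boundary conditions $y(-S)\cos\alpha-y'(-S)\sin\alpha=0$, $y(S)\cos\beta-y'(S)\sin\beta=0$. Let $\lambda_0<\lambda_1<\lambda_2<\dots$ be its eigenvalues, and let $\mu_0<\mu_1<\mu_2<\dots$ be the eigenvalues of the same problem with $\alpha$ replaced by $\alpha'$. Then the Titchmarsh-Weyl $m$-function $m_{\alpha,\beta}$ (defined in the context) is uniquely determined by $(\lambda_n)$, $(\mu_n)$, $\alpha$ and $\alpha'$. That is: if $(q,M,\beta)$ and $(\tilde q,\tilde M,\tilde\beta)$ are two such triples, with the same $S,\alpha,\alpha'$, for which $\lambda_n=\tilde\lambda_n$ and $\mu_n=\tilde\mu_n$ for all $n\ge 0$, then $m_{\alpha,\beta}=\tilde m_{\alpha,\tilde\beta}$ as meromorphic functions on $\mathbb{C}$.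
   Context: A solution of $-y''+qy=\lambda y$ on $[-S,S]$ with the transfer condition is a function such that $y,y'$ are absolutely continuous on each of $[-S,0)$ and $(0,S]$ (with one-sided limits at $0$), satisfying the differential equation a.e. and $(y(0^+),y'(0^+))^T=M(y(0^-),y'(0^-))^T$. Let $v_\beta(x,\lambda)$ be the solution (obeying the transfer condition) with $v_\beta(S,\lambda)=\sin\beta$, $v_\beta'(S,\lambda)=\cos\beta$. Put $$\Delta_{\alpha,\beta}(\lambda)=v_\beta'(-S,\lambda)\sin\alpha-v_\beta(-S,\lambda)\cos\alpha ,$$ an entire function whose zeros are the eigenvalues of the boundary value problem. The Titchmarsh-Weyl $m$-function is $$m_{\alpha,\beta}(\lambda)=\frac{v_\beta(-S,\lambda)\sin\alpha+v_\beta'(-S,\lambda)\cos\alpha}{\Delta_{\alpha,\beta}(\lambda)} .$$ Tildes denote the corresponding objects for $(\tilde q,\tilde M,\tilde\beta)$. *)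

theory Defs
  imports "HOL-Analysis.Analysis"
begin

definition abs_continuous_on :: "real set \<Rightarrow> (real \<Rightarrow> 'a::real_normed_vector) \<Rightarrow> bool" where
  "abs_continuous_on I f \<longleftrightarrow>
     (\<forall>\<epsilon>>0. \<exists>\<delta>>0. \<forall>D :: (real \<times> real) set.
        finite D \<longrightarrow>
        (\<forall>(a, b)\<in>D. a \<le> b \<and> {a..b} \<subseteq> I) \<longrightarrow>
        pairwise (\<lambda>(a, b) (c, d). {a<..<b} \<inter> {c<..<d} = {}) D \<longrightarrow>
        (\<Sum>(a, b)\<in>D. b - a) < \<delta> \<longrightarrow>
        (\<Sum>(a, b)\<in>D. norm (f b - f a)) < \<epsilon>)"

definition real_L2_on :: "real set \<Rightarrow> (real \<Rightarrow> real) \<Rightarrow> bool" where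
  "real_L2_on I q \<longleftrightarrow>
     set_borel_measurable lebesgue I q \<and> set_integrable lebesgue I (\<lambda>x. (q x)\<^sup>2)"

text \<open>
  Functions on \<open>[-S, 0) \<union> (0, S]\<close> are total functions on the reals whose values at \<open>0\<close> and
  outside \<open>[-S, S]\<close> are irrelevant. The derivative is taken on each of the two pieces
  separately, hence one-sided at \<open>-S\<close> and \<open>S\<close>.
\<close>
definition piece_deriv :: "real \<Rightarrow> (real \<Rightarrow> complex) \<Rightarrow> real \<Rightarrow> complex" where
  "piece_deriv S y x =
     vector_derivative y (at x within (if x < 0 then {-S..<0} else {0<..S}))"

definition is_solution ::
  "real \<Rightarrow> (real \<Rightarrow> real) \<Rightarrow> real^2^2 \<Rightarrow> complex \<Rightarrow> (real \<Rightarrow> complex) \<Rightarrow> bool" where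
  "is_solution S q M z y \<longleftrightarrow>
     (\<forall>I\<in>{{-S..<0}, {0<..S}}.
        (\<forall>x\<in>I. y differentiable (at x within I)) \<and>
        abs_continuous_on I y \<and> abs_continuous_on I (piece_deriv S y)) \<and>
     (AE x in lebesgue. x \<in> {-S..S} - {0} \<longrightarrow>
        (\<exists>y2. (piece_deriv S y has_vector_derivative y2) (at x) \<and>
              - y2 + of_real (q x) * y x = z * y x)) \<and>
     (\<exists>y_minus y'_minus y_plus y'_plus.
        (y \<longlongrightarrow> y_minus) (at_left 0) \<and> (piece_deriv S y \<longlongrightarrow> y'_minus) (at_left 0) \<and>
        (y \<longlongrightarrow> y_plus) (at_right 0) \<and> (piece_deriv S y \<longlongrightarrow> y'_plus) (at_right 0) \<and>
        vector [y_plus, y'_plus] =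
          map_matrix complex_of_real M *v (vector [y_minus, y'_minus] :: complex^2))"

text \<open>
  The problem \<open>-y'' + q y = z y\<close> with transfer matrix \<open>M\<close> at \<open>0\<close> and boundary angles
  \<open>\<alpha>\<close> at \<open>-S\<close> and \<open>\<beta>\<close> at \<open>S\<close>; the eigenvalue parameter ranges over the complex numbers.
\<close>
definition is_eigenvalue ::
  "real \<Rightarrow> (real \<Rightarrow> real) \<Rightarrow> real^2^2 \<Rightarrow> real \<Rightarrow> real \<Rightarrow> complex \<Rightarrow> bool" where
  "is_eigenvalue S q M \<alpha> \<beta> z \<longleftrightarrow>
     (\<exists>y. is_solution S q M z y \<and>
          (\<exists>x\<in>{-S..S} - {0}. y x \<noteq> 0) \<and>
          y (-S) * cos \<alpha> - piece_deriv S y (-S) * sin \<alpha> = 0 \<and>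
          y S * cos \<beta> - piece_deriv S y S * sin \<beta> = 0)"

definition is_eigenvalue_sequence ::
  "real \<Rightarrow> (real \<Rightarrow> real) \<Rightarrow> real^2^2 \<Rightarrow> real \<Rightarrow> real \<Rightarrow> (nat \<Rightarrow> real) \<Rightarrow> bool" where
  "is_eigenvalue_sequence S q M \<alpha> \<beta> ev \<longleftrightarrow>
     strict_mono ev \<and> range (\<lambda>n. complex_of_real (ev n)) = {z. is_eigenvalue S q M \<alpha> \<beta> z}"

text \<open>
  This solution is unique as a function on \<open>[-S, S] - {0}\<close>. The choice operator only affects the
  irrelevant values at other points.
\<close>
definition v_sol ::
  "real \<Rightarrow> (real \<Rightarrow> real) \<Rightarrow> real^2^2 \<Rightarrow> real \<Rightarrow> complex \<Rightarrow> real \<Rightarrow> complex" where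
  "v_sol S q M \<beta> z =
     (SOME y. is_solution S q M z y \<and> y S = sin \<beta> \<and> piece_deriv S y S = cos \<beta>)"

definition char_fun ::
  "real \<Rightarrow> (real \<Rightarrow> real) \<Rightarrow> real^2^2 \<Rightarrow> real \<Rightarrow> real \<Rightarrow> complex \<Rightarrow> complex" where
  "char_fun S q M \<alpha> \<beta> z =
     piece_deriv S (v_sol S q M \<beta> z) (-S) * sin \<alpha> - v_sol S q M \<beta> z (-S) * cos \<alpha>"

text \<open>
  At a zero of the denominator the numerator does not vanish (otherwise the solution and its
  derivative would both vanish at \<open>-S\<close>), so the value there, \<open>0\<close> by the convention for
  division, marks exactly the poles. Consequently two such functions are equal as
  meromorphic functions if and only if they are equal as total functions.
\<close>
definition m_fun ::
  "real \<Rightarrow> (real \<Rightarrow> real) \<Rightarrow> real^2^2 \<Rightarrow> real \<Rightarrow> real \<Rightarrow> complex \<Rightarrow> complex" where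
  "m_fun S q M \<alpha> \<beta> z =
     (v_sol S q M \<beta> z (-S) * sin \<alpha> + piece_deriv S (v_sol S q M \<beta> z) (-S) * cos \<alpha>)
       / char_fun S q M \<alpha> \<beta> z"

end

theory Submission
  imports Defs "HOL-Complex_Analysis.Complex_Analysis"
begin

text \<open>
  Write \<open>u = v\<^sub>\<beta>(-S, z)\<close>, \<open>w = v\<^sub>\<beta>'(-S, z)\<close> and \<open>\<Delta>\<^sub>\<alpha> = w sin \<alpha> - u cos \<alpha>\<close>. Since \<open>m\<^sub>\<alpha>\<close> is an affine function of
  \<open>R = \<Delta>\<^sub>\<alpha>\<^sub>' / \<Delta>\<^sub>\<alpha>\<close> with coefficients depending on \<open>\<alpha>, \<alpha>'\<close> only, it suffices to recover \<open>R\<close> from its zeros and poles.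
  Lagrange's identity gives \<open>Im (w cnj u) = Im z \<integral> |v\<^sub>\<beta>|\<^sup>2\<close> (the jump preserves \<open>Im (v' cnj v)\<close> because
  \<open>det M = 1\<close>), so \<open>R\<close> maps each half plane into a half plane; in particular its zeros and poles are simple.
  If \<open>R\<close> and \<open>R~\<close> have the same zeros and poles, then \<open>R / R~\<close> extends to a zero-free entire function \<open>exp g\<close>
  that avoids the negative reals off the real line. Hence \<open>Im g\<close> is bounded and \<open>g\<close> is constant by Liouville's
  theorem; no growth estimate or Hadamard factorization is needed. The constant is \<open>1\<close> because \<open>w / u\<close>
  behaves like \<open>-sqrt (-z)\<close> along the imaginary axis, whatever \<open>q\<close>, \<open>M\<close> and \<open>\<beta>\<close> are.
\<close>

section \<open>Functions with a sign on the half planes\<close>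

text \<open>An eigenvalue sequence lists values without multiplicities, so the orders of the zeros
  are not part of the data; simplicity has to come out of the half-plane property. The same property
  keeps the quotient off the negative reals: \<open>R\<close> and \<open>R~\<close> send a nonreal z
  into one common half plane. What then remains free is a single constant, which is why a crude
  asymptotic relation along one ray is enough. It is available without following the solution
  through the jump: the right part of the interval enters only through the sign of
  \<open>Im (v' cnj v)\<close> at 0. The main labour is regularity. Solutions are specified by
  absolute continuity and an equation almost everywhere, and \<open>v_sol\<close> is a choice, so
  nothing is known about it until a solution has been constructed. Both directions pass through an
  integral form of the equation: reading a solution as an integral needs the fundamental theorem for
  absolutely continuous functions, while building one needs almost everywhere differentiability of
  indefinite integrals.\<close>

lemma upper_half_plane_map_simple_zero:
  fixes f :: "complex \<Rightarrow> complex" and a :: real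
  assumes hol: "f holomorphic_on ball (of_real a) r" and "r > 0"
    and zero: "f (of_real a) = 0"
    and pos: "\<And>z. z \<in> ball (of_real a) r \<Longrightarrow> Im z > 0 \<Longrightarrow> Im (f z) > 0"
  shows "deriv f (of_real a) \<noteq> 0"
proof
  assume d0: "deriv f (of_real a) = 0"
  define A where "A = complex_of_real a"
  have "A + \<i> * (r/2) \<in> ball A r"
    using \<open>r > 0\<close> by (simp add: dist_norm norm_mult)
  moreover have "Im (A + \<i> * (r/2)) > 0" using \<open>r > 0\<close> by (simp add: A_def)
  ultimately have im: "A + \<i> * (r/2) \<in> ball A r" "f (A + \<i> * (r/2)) \<noteq> 0"
    using pos[of "A + \<i> * (r/2)"] by (auto simp: A_def)
  have nc: "\<not> f constant_on ball A r"
    using im zero \<open>r > 0\<close> unfolding constant_on_def A_def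
    by (metis centre_in_ball)
  obtain g s n where n: "0 < n" and s: "0 < s" "ball A s \<subseteq> ball A r" and g: "g holomorphic_on ball A s"
    and fg: "\<And>w. w \<in> ball A s \<Longrightarrow> f w = (w - A)^n * g w" and gnz: "\<And>w. w \<in> ball A s \<Longrightarrow> g w \<noteq> 0"
    using holomorphic_factor_zero_nonconstant[of f "ball A r" A] hol \<open>r > 0\<close> zero nc
    unfolding A_def by (metis centre_in_ball connected_ball open_ball)
  have dg: "(g has_field_derivative deriv g A) (at A)"
    using g s holomorphic_derivI[of g "ball A s" A] by simp
  have n2: "n \<ge> 2"
  proof (rule ccontr)
    assume "\<not> n \<ge> 2"
    then have n1: "n = 1" using n by simp
    have "((\<lambda>w. (w - A) * g w) has_field_derivative g A) (at A)"
      by (rule derivative_eq_intros dg refl | simp)+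
    then have "(f has_field_derivative g A) (at A)"
      by (rule has_field_derivative_transform_within_open[of _ _ _ "ball A s"]) (use s fg n1 in auto)
    then show False using d0 gnz[of A] s DERIV_imp_deriv unfolding A_def by fastforce
  qed
  \<comment> \<open>Along the ray of angle \<theta> the factor \<open>t^n\<close> is positive, so
    the sign of \<open>Im f\<close> passes to \<open>cis (n * \<theta>) * g\<close>; the limit at 0
    keeps only the weak inequality.\<close>
  have key: "Im (cis (n * \<theta>) * g A) \<ge> 0" if th: "0 < \<theta>" "\<theta> < pi" for \<theta> :: real
  proof -
    have lim: "((\<lambda>t. Im (cis (n * \<theta>) * g (A + of_real t * cis \<theta>))) \<longlongrightarrow> Im (cis (n * \<theta>) * g (A + of_real 0 * cis \<theta>))) (at_right 0)"
    proof -
      have "isCont g A" using dg DERIV_isCont by blast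
      then have c: "isCont g (A + of_real 0 * cis \<theta>)" by simp
      have "((\<lambda>t. A + of_real t * cis \<theta>) \<longlongrightarrow> A + of_real 0 * cis \<theta>) (at_right 0)"
        by (intro tendsto_intros)
      from isCont_tendsto_compose[OF c this]
      show ?thesis by (intro tendsto_intros)
    qed
    have "\<forall>\<^sub>F t in at_right (0::real). t < s" using s eventually_at_right_field by blast
    moreover have "\<forall>\<^sub>F t in at_right (0::real). t > 0" by (simp add: eventually_at_right_less)
    ultimately have "\<forall>\<^sub>F t in at_right 0. 0 \<le> Im (cis (n * \<theta>) * g (A + of_real t * cis \<theta>))"
    proof eventually_elim
      case (elim t)
      define w where "w = A + of_real t * cis \<theta>"
      have w: "w \<in> ball A s" using elim by (simp add: w_def dist_norm norm_mult)
      have "Im w > 0" using elim th by (simp add: w_def A_def sin_gt_zero)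
      then have "Im (f w) > 0" using pos w s unfolding A_def by blast
      also have "f w = of_real (t^n) * (cis (n * \<theta>) * g w)"
        using fg[OF w] Complex.DeMoivre[of \<theta> n] by (simp add: w_def power_mult_distrib)
      also have "Im \<dots> = t^n * Im (cis (n * \<theta>) * g w)" by simp
      finally show ?case unfolding w_def using elim by (simp add: zero_less_mult_iff)
    qed
    from tendsto_lowerbound[OF lim this] show ?thesis by simp
  qed
  \<comment> \<open>Since \<open>n \<ge> 2\<close>, the angles \<open>\<theta>\<close> and \<open>\<theta> + pi/n\<close> are both admissible for small \<open>\<theta>\<close> and give opposite values.\<close>
  have real: "Im (cis \<phi> * g A) = 0" if "0 < \<phi>" "\<phi> < pi" for \<phi>
  proof -
    have n0: "real n \<ge> 2" using n2 by simp
    have t1: "0 < \<phi>/n" "\<phi>/n < pi" using that n0 by (auto simp: field_simps intro: less_le_trans)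
    have t2: "0 < (\<phi>+pi)/n" "(\<phi>+pi)/n < pi"
    proof -
      show "0 < (\<phi>+pi)/n" using that n0 by auto
      have "\<phi> + pi < pi * 2" using that by simp
      also have "\<dots> \<le> pi * n" using n0 by (intro mult_left_mono) auto
      finally show "(\<phi>+pi)/n < pi" using n0 by (simp add: field_simps)
    qed
    have "Im (cis \<phi> * g A) \<ge> 0" using key[OF t1] n0 by simp
    moreover have "Im (cis (\<phi> + pi) * g A) \<ge> 0" using key[OF t2] n0 by simp
    moreover have "cis (\<phi> + pi) = - cis \<phi>" by (simp add: complex_eq_iff)
    ultimately show ?thesis by simp
  qed
  \<comment> \<open>The directions pi/2 and pi/4 are linearly independent over the reals, so both
    parts of \<open>g A\<close> vanish, contrary to the choice of \<open>g\<close>.\<close>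
  have "Re (g A) = 0" using real[of "pi/2"] by simp
  moreover have "Im (g A) = 0" using real[of "pi/4"] \<open>Re (g A) = 0\<close> pi_gt_zero
    by (simp add: cos_45)
  ultimately show False using gnz[of A] s by (simp add: complex_eq_iff)
qed

text \<open>At a common simple zero a both functions can be divided by z - a. The divided functions
  are holomorphic and nonzero there, so their quotient extends f / g with the nonzero value
  \<open>deriv f a / deriv g a\<close>.\<close>

lemma entire_quotient_simple_zeros:
  fixes f g :: "complex \<Rightarrow> complex"
  assumes f: "f holomorphic_on UNIV" and g: "g holomorphic_on UNIV"
    and zeros: "\<And>z. f z = 0 \<longleftrightarrow> g z = 0"
    and simple: "\<And>z. f z = 0 \<Longrightarrow> deriv f z \<noteq> 0" "\<And>z. g z = 0 \<Longrightarrow> deriv g z \<noteq> 0"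
  obtains \<phi> where "\<phi> holomorphic_on UNIV" "\<And>z. \<phi> z \<noteq> 0" "\<And>z. f z = \<phi> z * g z"
proof -
  define \<phi> where "\<phi> z = (if g z = 0 then deriv f z / deriv g z else f z / g z)" for z
  have "\<phi> field_differentiable at a" for a
  proof (cases "g a = 0")
    case True
    define F where "F z = (if z = a then deriv f a else (f z - f a) / (z - a))" for z
    define G where "G z = (if z = a then deriv g a else (g z - g a) / (z - a))" for z
    have F: "F holomorphic_on UNIV" unfolding F_def by (rule pole_lemma) (use f in auto)
    have G: "G holomorphic_on UNIV" unfolding G_def by (rule pole_lemma) (use g in auto)
    have nz: "G a \<noteq> 0" using simple True by (simp add: G_def)
    have op: "open {z. G z \<noteq> 0}"
      using holomorphic_on_imp_continuous_on[OF G] open_Collect_neq[of G "\<lambda>_. 0"] by simp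
    have "(\<lambda>z. F z / G z) holomorphic_on {z. G z \<noteq> 0}"
      by (intro holomorphic_intros holomorphic_on_subset[OF F] holomorphic_on_subset[OF G]) auto
    moreover have "F z / G z = \<phi> z" if "z \<in> {z. G z \<noteq> 0}" for z
      using that True zeros by (cases "z = a") (auto simp: F_def G_def \<phi>_def)
    ultimately have "\<phi> holomorphic_on {z. G z \<noteq> 0}" by (metis (no_types, lifting) holomorphic_cong)
    then show ?thesis using op nz by (simp add: holomorphic_on_open field_differentiable_def)
  next
    case False
    have op: "open {z. g z \<noteq> 0}"
      using holomorphic_on_imp_continuous_on[OF g] open_Collect_neq[of g "\<lambda>_. 0"] by simp
    have "(\<lambda>z. f z / g z) holomorphic_on {z. g z \<noteq> 0}"
      by (intro holomorphic_intros holomorphic_on_subset[OF f] holomorphic_on_subset[OF g]) auto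
    moreover have "f z / g z = \<phi> z" if "z \<in> {z. g z \<noteq> 0}" for z
      using that by (auto simp: \<phi>_def)
    ultimately have "\<phi> holomorphic_on {z. g z \<noteq> 0}" by (metis (no_types, lifting) holomorphic_cong)
    then show ?thesis using op False by (simp add: holomorphic_on_open field_differentiable_def)
  qed
  then have "\<phi> holomorphic_on UNIV" by (simp add: holomorphic_on_def)
  moreover have "\<phi> z \<noteq> 0" for z using simple zeros by (auto simp: \<phi>_def)
  moreover have "f z = \<phi> z * g z" for z using zeros by (auto simp: \<phi>_def)
  ultimately show ?thesis using that by blast
qed

text \<open>A logarithm \<open>g\<close> exists because the plane is contractible. On a connected
  set where \<open>exp g\<close> is never negative, \<open>Im g\<close> omits all odd multiples of
  pi and so stays in one strip of width 2 pi. The two half planes may use different strips;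
  boundedness is all that Liouville's theorem asks for.\<close>

lemma zero_free_entire_constant:
  fixes h :: "complex \<Rightarrow> complex"
  assumes h: "h holomorphic_on UNIV" "\<And>z. h z \<noteq> 0"
    and neg: "\<And>z. Im z \<noteq> 0 \<Longrightarrow> h z \<notin> \<real>\<^sub>\<le>\<^sub>0"
  obtains c where "c \<noteq> 0" "\<And>z. h z = c"
proof -
  obtain g where g: "g holomorphic_on UNIV" "\<And>z. h z = exp (g z)"
    using contractible_imp_holomorphic_log[of h UNIV] h by auto
  have contg: "continuous_on A g" for A
    using g holomorphic_on_imp_continuous_on continuous_on_subset by blast
  have width: "\<exists>B. \<forall>z\<in>H. \<bar>Im (g z)\<bar> \<le> B"
    if H: "connected H" "\<And>z. z \<in> H \<Longrightarrow> Im z \<noteq> 0" "w \<in> H" for H w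
  proof -
    have con: "connected ((\<lambda>z. Im (g z)) ` H)"
      by (intro connected_continuous_image continuous_intros contg H)
    have omit: "Im (g z) \<noteq> pi + 2 * pi * of_int k" if "z \<in> H" for z k
    proof
      assume "Im (g z) = pi + 2 * pi * of_int k"
      then have "h z = of_real (- exp (Re (g z)))"
        using cis_multiple_2pi[of "of_int k"]
        by (simp add: g exp_eq_polar cis_mult[symmetric] algebra_simps)
      then show False using neg[OF H(2)[OF that]] by (simp del: of_real_minus)
    qed
    define k where "k = \<lfloor>(Im (g w) - pi) / (2*pi)\<rfloor>"
    have lo: "pi + 2*pi * of_int k \<le> Im (g w)" and hi: "Im (g w) \<le> pi + 2*pi * of_int (k+1)"
    proof -
      have "of_int k \<le> (Im (g w) - pi) / (2*pi)" "(Im (g w) - pi) / (2*pi) \<le> of_int k + 1"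
        unfolding k_def by linarith+
      then show "pi + 2*pi * of_int k \<le> Im (g w)" "Im (g w) \<le> pi + 2*pi * of_int (k+1)"
        using pi_gt_zero by (simp_all add: field_simps)
    qed
    have "pi + 2*pi * of_int k \<le> Im (g z) \<and> Im (g z) \<le> pi + 2*pi * of_int (k+1)" if z: "z \<in> H" for z
    proof (rule ccontr)
      assume "\<not> ?thesis"
      then consider "Im (g z) \<le> pi + 2*pi * of_int k" | "pi + 2*pi * of_int (k+1) \<le> Im (g z)" by linarith
      then have "\<exists>j. pi + 2*pi * of_int j \<in> (\<lambda>z. Im (g z)) ` H"
      proof cases
        case 1
        then show ?thesis using connectedD_interval[OF con, of "Im (g z)" "Im (g w)"] z H(3) lo by blast
      next
        case 2
        then show ?thesis using connectedD_interval[OF con, of "Im (g w)" "Im (g z)"] z H(3) hi by blast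
      qed
      then show False using omit by (metis (no_types, lifting) imageE)
    qed
    then have "\<forall>z\<in>H. \<bar>Im (g z)\<bar> \<le> \<bar>pi + 2*pi * of_int k\<bar> + \<bar>pi + 2*pi * of_int (k+1)\<bar>"
      by (smt (verit))
    then show ?thesis by blast
  qed
  obtain B1 where B1: "\<And>z. Im z > 0 \<Longrightarrow> \<bar>Im (g z)\<bar> \<le> B1"
    using width[of "{z. Im z > 0}" \<i>] convex_connected[OF convex_halfspace_Im_gt[of 0]] by auto
  obtain B2 where B2: "\<And>z. Im z < 0 \<Longrightarrow> \<bar>Im (g z)\<bar> \<le> B2"
    using width[of "{z. Im z < 0}" "-\<i>"] convex_connected[OF convex_halfspace_Im_lt[of 0]] by auto
  define B where "B = max B1 B2"
  have B: "\<bar>Im (g z)\<bar> \<le> B" for z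
  proof -
    \<comment> \<open>A small vertical move upwards leads from any point to one off the real axis,
      so the bounds on the open half planes extend to the real axis by continuity.\<close>
    have lim: "((\<lambda>t. \<bar>Im (g (z + of_real t * \<i>))\<bar>) \<longlongrightarrow> \<bar>Im (g (z + of_real 0 * \<i>))\<bar>) (at_right 0)"
    proof -
      have c: "isCont g (z + of_real 0 * \<i>)" using contg[of UNIV] continuous_on_eq_continuous_at by blast
      have "((\<lambda>t. z + of_real t * \<i>) \<longlongrightarrow> z + of_real 0 * \<i>) (at_right 0)" by (intro tendsto_intros)
      from isCont_tendsto_compose[OF c this] show ?thesis by (intro tendsto_intros)
    qed
    have "\<forall>\<^sub>F t in at_right 0. \<bar>Im (g (z + of_real t * \<i>))\<bar> \<le> B"
    proof (cases "Im z \<ge> 0")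
      case True
      have "\<forall>\<^sub>F t in at_right (0::real). t > 0" by (simp add: eventually_at_right_less)
      then show ?thesis
      proof eventually_elim
        case (elim t)
        then have "\<bar>Im (g (z + of_real t * \<i>))\<bar> \<le> B1" using True by (intro B1) simp
        then show ?case by (simp add: B_def)
      qed
    next
      case False
      then have "\<forall>\<^sub>F t in at_right (0::real). t < - Im z" using eventually_at_right_real[of 0 "- Im z"]
        by (auto elim: eventually_mono)
      then show ?thesis
      proof eventually_elim
        case (elim t)
        then have "\<bar>Im (g (z + of_real t * \<i>))\<bar> \<le> B2" by (intro B2) simp
        then show ?case by (simp add: B_def)
      qed
    qed
    from tendsto_upperbound[OF lim this] show ?thesis by simp
  qed
  have "bounded (range (\<lambda>z. exp (\<i> * g z)))"
  proof (rule boundedI)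
    fix x assume "x \<in> range (\<lambda>z. exp (\<i> * g z))"
    then obtain z where "x = exp (\<i> * g z)" by blast
    then show "norm x \<le> exp B" using B[of z] by simp
  qed
  moreover have hexp: "(\<lambda>z. exp (\<i> * g z)) holomorphic_on UNIV" by (intro holomorphic_intros g)
  ultimately have "(\<lambda>z. exp (\<i> * g z)) constant_on UNIV" using Liouville_theorem by blast
  then obtain d where d: "\<And>z. exp (\<i> * g z) = d" unfolding constant_on_def by blast
  \<comment> \<open>Constancy of \<open>exp (\<i> * g)\<close> fixes \<open>g\<close> only up to
    multiples of 2 pi; differentiating removes the ambiguity.\<close>
  have "deriv g z = 0" for z
  proof -
    have gd: "(g has_field_derivative deriv g z) (at z)"
      using g holomorphic_derivI[of g UNIV z] by simp
    have "((\<lambda>z. exp (\<i> * g z)) has_field_derivative exp (\<i> * g z) * (\<i> * deriv g z)) (at z)"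
      by (rule derivative_eq_intros gd refl | simp)+
    moreover have "((\<lambda>z. exp (\<i> * g z)) has_field_derivative 0) (at z)"
      using d by simp
    ultimately show ?thesis using DERIV_unique by fastforce
  qed
  then have "(g has_field_derivative 0) (at z)" for z
    using g holomorphic_derivI[of g UNIV z] by (metis UNIV_I open_UNIV)
  then obtain e where "\<And>z. g z = e"
    using has_field_derivative_zero_constant[of UNIV g] by auto
  then have "h z = exp e" for z using g by simp
  then show ?thesis using that[of "exp e"] by simp
qed

text \<open>The sign of \<sigma> records the half plane into which \<open>f2 / f1\<close> and
  \<open>g2 / g1\<close> send the upper one; both pairs share it. The conclusion is cross-multiplied
  so that it makes sense at the common zeros too.\<close>

lemma herglotz_pair_ratio:
  fixes f1 f2 g1 g2 :: "complex \<Rightarrow> complex"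
  assumes hol: "f1 holomorphic_on UNIV" "f2 holomorphic_on UNIV" "g1 holomorphic_on UNIV" "g2 holomorphic_on UNIV"
    and sg: "\<And>z. Im z \<noteq> 0 \<Longrightarrow> \<sigma> * Im z * Im (f2 z * cnj (f1 z)) > 0"
      "\<And>z. Im z \<noteq> 0 \<Longrightarrow> \<sigma> * Im z * Im (g2 z * cnj (g1 z)) > 0"
    and nf: "\<And>z. f1 z \<noteq> 0 \<or> f2 z \<noteq> 0" and ng: "\<And>z. g1 z \<noteq> 0 \<or> g2 z \<noteq> 0"
    and z1: "\<And>z. f1 z = 0 \<longleftrightarrow> g1 z = 0" and z2: "\<And>z. f2 z = 0 \<longleftrightarrow> g2 z = 0"
  obtains c where "c \<noteq> 0" "\<And>z. f2 z * g1 z = c * (f1 z * g2 z)"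
proof -
  \<comment> \<open>Stated for a generic pair: exchanging its members only reverses the sign of
    \<tau>, so this covers all four functions.\<close>
  have simple: "deriv k1 z \<noteq> 0"
    if k: "k1 holomorphic_on UNIV" "k2 holomorphic_on UNIV"
      and s: "\<And>z. Im z \<noteq> 0 \<Longrightarrow> \<tau> * Im z * Im (k2 z * cnj (k1 z)) > 0"
      and n: "\<And>z. k1 z \<noteq> 0 \<or> k2 z \<noteq> 0" and z0: "k1 z = 0"
    for k1 k2 :: "complex \<Rightarrow> complex" and \<tau> :: real and z
  proof -
    have "Im z = 0" using s[of z] z0 by auto
    then obtain a where a: "z = of_real a" using complex_is_Real_iff Reals_cases by metis
    have "continuous_on UNIV k2" using k holomorphic_on_imp_continuous_on by blast
    then have op: "open {w. k2 w \<noteq> 0}" using open_Collect_neq[of k2 "\<lambda>_. 0"] by simp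
    have zin: "z \<in> {w. k2 w \<noteq> 0}" using n z0 by auto
    obtain r where r: "r > 0" "ball z r \<subseteq> {w. k2 w \<noteq> 0}" using op zin openE by blast
    \<comment> \<open>The sign condition makes the zero real. Near it, \<open>k1 / k2\<close> times
      -\<tau> is holomorphic and maps points of the upper half plane into the upper half plane, so
      its zero, and with it that of \<open>k1\<close>, is simple.\<close>
    define F where "F w = of_real (-\<tau>) * (k1 w / k2 w)" for w
    have Fh: "F holomorphic_on ball z r" unfolding F_def
      by (intro holomorphic_intros holomorphic_on_subset[OF k(1)] holomorphic_on_subset[OF k(2)]) (use r in auto)
    have "Im (F w) > 0" if w: "w \<in> ball z r" "Im w > 0" for w
    proof -
      have k2: "k2 w \<noteq> 0" using w r by auto
      have "k1 w / k2 w = of_real (1 / (norm (k2 w))^2) * (k1 w * cnj (k2 w))"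
        using k2 complex_norm_square[of "k2 w"] by (simp add: field_simps)
      then have "F w = of_real (- \<tau> / (norm (k2 w))^2) * (k1 w * cnj (k2 w))"
        by (simp add: F_def)
      then have "Im (F w) = (- \<tau> / (norm (k2 w))^2) * Im (k1 w * cnj (k2 w))"
        by (simp only: times_complex.simps Im_complex_of_real Re_complex_of_real)
      also have "Im (k1 w * cnj (k2 w)) = - Im (k2 w * cnj (k1 w))" by simp
      finally have "Im (F w) * (norm (k2 w))^2 = \<tau> * Im (k2 w * cnj (k1 w))"
        using k2 by (simp add: field_simps)
      then have e: "Im (F w) * Im w * (norm (k2 w))^2 = \<tau> * Im w * Im (k2 w * cnj (k1 w))"
        by (metis mult.assoc mult.commute)
      have "0 < Im (F w) * Im w * (norm (k2 w))^2" unfolding e using s[of w] w by simp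
      then show ?thesis using w k2 by (simp add: zero_less_mult_iff)
    qed
    then have dF: "deriv F z \<noteq> 0"
      using upper_half_plane_map_simple_zero[of F a r] Fh r z0 a by (simp add: F_def)
    show ?thesis
    proof
      assume d: "deriv k1 z = 0"
      have d1: "(k1 has_field_derivative 0) (at z)" using holomorphic_derivI[OF k(1), of z] d by simp
      have d2: "(k2 has_field_derivative deriv k2 z) (at z)" using holomorphic_derivI[OF k(2), of z] by simp
      have "(F has_field_derivative 0) (at z)" unfolding F_def
        by (rule derivative_eq_intros d1 d2 refl | use zin z0 in simp)+
      then show False using dF DERIV_imp_deriv by blast
    qed
  qed
  have sg': "Im z \<noteq> 0 \<Longrightarrow> (-\<sigma>) * Im z * Im (f1 z * cnj (f2 z)) > 0"
       "Im z \<noteq> 0 \<Longrightarrow> (-\<sigma>) * Im z * Im (g1 z * cnj (g2 z)) > 0" for z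
    using sg[of z] by (simp_all add: algebra_simps)
  have sf1: "\<And>z. f1 z = 0 \<Longrightarrow> deriv f1 z \<noteq> 0" by (rule simple[OF hol(1,2) sg(1) nf])
  have sg1: "\<And>z. g1 z = 0 \<Longrightarrow> deriv g1 z \<noteq> 0" by (rule simple[OF hol(3,4) sg(2) ng])
  have sf2: "\<And>z. f2 z = 0 \<Longrightarrow> deriv f2 z \<noteq> 0" by (rule simple[OF hol(2,1) sg'(1)]) (use nf in auto)
  have sg2: "\<And>z. g2 z = 0 \<Longrightarrow> deriv g2 z \<noteq> 0" by (rule simple[OF hol(4,3) sg'(2)]) (use ng in auto)
  obtain p where p: "p holomorphic_on UNIV" "\<And>z. p z \<noteq> 0" "\<And>z. f1 z = p z * g1 z"
    using entire_quotient_simple_zeros[OF hol(1,3) z1 sf1 sg1] by blast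
  obtain q where q: "q holomorphic_on UNIV" "\<And>z. q z \<noteq> 0" "\<And>z. f2 z = q z * g2 z"
    using entire_quotient_simple_zeros[OF hol(2,4) z2 sf2 sg2] by blast
  \<comment> \<open>If \<open>q z\<close> were a nonpositive multiple \<open>t\<close> of
    \<open>p z\<close>, the Hermitian products of the two pairs would differ by the factor
    \<open>t\<close> times |p z|^2, contradicting their common strict sign.\<close>
  have "q z / p z \<notin> \<real>\<^sub>\<le>\<^sub>0" if "Im z \<noteq> 0" for z
  proof
    assume "q z / p z \<in> \<real>\<^sub>\<le>\<^sub>0"
    then obtain t where t: "t \<le> 0" "q z = of_real t * p z"
      using p(2)[of z] by (auto elim!: nonpos_Reals_cases simp: field_simps)
    have "f2 z * cnj (f1 z) = of_real (t * (norm (p z))^2) * (g2 z * cnj (g1 z))"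
      using complex_norm_square[of "p z"] by (simp add: p q t)
    then have "Im (f2 z * cnj (f1 z)) = t * (norm (p z))^2 * Im (g2 z * cnj (g1 z))"
      by (metis Im_complex_of_real Re_complex_of_real times_complex.simps(2) mult_zero_left add_0_right)
    then have "\<sigma> * Im z * Im (f2 z * cnj (f1 z)) = t * ((norm (p z))^2 * (\<sigma> * Im z * Im (g2 z * cnj (g1 z))))"
      by simp
    also have "\<dots> \<le> 0" using t sg(2)[OF that]
      by (intro mult_nonpos_nonneg[OF t(1)] mult_nonneg_nonneg[OF zero_le_power2]) (rule less_imp_le)
    finally show False using sg(1)[OF that] by simp
  qed
  moreover have "(\<lambda>z. q z / p z) holomorphic_on UNIV" using p q by (intro holomorphic_intros) auto
  ultimately obtain c where c: "c \<noteq> 0" "\<And>z. q z / p z = c"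
    using zero_free_entire_constant[of "\<lambda>z. q z / p z"] p q by auto
  have "q z = c * p z" for z using c(2)[of z] p(2)[of z] by (simp add: field_simps)
  then have "f2 z * g1 z = c * (f1 z * g2 z)" for z by (simp add: p(3) q(3))
  then show ?thesis using that c by blast
qed

section \<open>Absolute continuity and indefinite integrals\<close>

abbreviation disjoint_intervals :: "(real \<times> real) set \<Rightarrow> bool" where
  "disjoint_intervals D \<equiv> pairwise (\<lambda>(a, b) (c, d). {a<..<b} \<inter> {c<..<d} = {}) D"

text \<open>At each point at most one of the integrands restricted to the open intervals is nonzero,
  so their sum stays below \<open>g\<close>; shared end points do not affect the integrals.\<close>

lemma sum_integral_disjoint_intervals_le:
  fixes g :: "real \<Rightarrow> real"
  assumes D: "finite D" "\<And>u v. (u, v) \<in> D \<Longrightarrow> u \<le> v \<and> {u..v} \<subseteq> {a..b}" "disjoint_intervals D"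
    and g: "g integrable_on {a..b}" "\<And>x. x \<in> {a..b} \<Longrightarrow> g x \<ge> 0"
  shows "(\<Sum>(u, v)\<in>D. integral {u..v} g) \<le> integral {a..b} g"
proof -
  define k where "k d x = (if x \<in> {fst d<..<snd d} then g x else 0)" for d :: "real \<times> real" and x
  have k: "(k d has_integral integral {fst d..snd d} g) {a..b}" if "d \<in> D" for d
  proof -
    have sub: "{fst d..snd d} \<subseteq> {a..b}" using D(2)[of "fst d" "snd d"] that by simp
    then have "g integrable_on {fst d..snd d}" using g(1) integrable_on_subinterval by blast
    then have "(g has_integral integral {fst d..snd d} g) {fst d<..<snd d}"
      using has_integral_Icc_iff_Ioo by blast
    moreover have "{fst d<..<snd d} \<subseteq> {a..b}" using sub greaterThanLessThan_subseteq_atLeastAtMost_iff by fastforce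
    ultimately show ?thesis
      unfolding k_def using has_integral_restrict[of "{fst d<..<snd d}" "{a..b}" g] by blast
  qed
  have "((\<lambda>x. \<Sum>d\<in>D. k d x) has_integral (\<Sum>d\<in>D. integral {fst d..snd d} g)) {a..b}"
    by (intro has_integral_sum D k)
  moreover have "(\<Sum>d\<in>D. k d x) \<le> g x" if x: "x \<in> {a..b}" for x
  proof (cases "\<exists>d\<in>D. x \<in> {fst d<..<snd d}")
    case True
    then obtain d where d: "d \<in> D" "x \<in> {fst d<..<snd d}" by blast
    have "k e x = 0" if "e \<in> D - {d}" for e
    proof -
      have "{fst d<..<snd d} \<inter> {fst e<..<snd e} = {}"
        using pairwiseD[OF D(3), of d e] that d by (auto simp: case_prod_beta)
      then show ?thesis using d unfolding k_def by auto
    qed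
    then have "(\<Sum>e\<in>D. k e x) = k d x" using D(1) d(1) by (simp add: sum.remove)
    then show ?thesis using g(2) x by (simp add: k_def)
  next
    case False
    then have "(\<Sum>d\<in>D. k d x) = 0" by (intro sum.neutral) (auto simp: k_def)
    then show ?thesis using g(2) x by simp
  qed
  ultimately have "(\<Sum>d\<in>D. integral {fst d..snd d} g) \<le> integral {a..b} g"
    using has_integral_le integrable_integral[OF g(1)] by blast
  then show ?thesis by (simp add: case_prod_beta)
qed

lemma negligible_open_cover:
  fixes N :: "'a::euclidean_space set"
  assumes "negligible N" "e > 0"
  obtains U where "open U" "N \<subseteq> U" "U \<in> lmeasurable" "measure lebesgue U < e"
proof -
  have N: "N \<in> lmeasurable" "measure lebesgue N = 0"
    using assms negligible_iff_measure by blast+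
  then obtain T where T: "open T" "N \<subseteq> T" "T - N \<in> lmeasurable" "emeasure lebesgue (T - N) < ennreal e"
    using sets_lebesgue_outer_open[of N e] assms(2) fmeasurableD by blast
  have TN: "T = (T - N) \<union> N" using T(2) by blast
  have "T \<in> lmeasurable" using TN N(1) T(3) fmeasurable.Un by metis
  moreover have "measure lebesgue T \<le> measure lebesgue (T - N) + measure lebesgue N"
    by (subst TN, rule measure_Un_le) (use T N fmeasurableD in auto)
  moreover have "measure lebesgue (T - N) < e"
    using T(3,4) assms(2) by (simp add: emeasure_eq_measure2 ennreal_less_iff)
  ultimately show ?thesis using that[of T] T N(2) by simp
qed

text \<open>A Henstock--Kurzweil argument: the gauge follows the derivative off the exceptional null set, and on
  the null set absolute continuity controls the increments over a cover of small measure.\<close>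
lemma abs_continuous_has_integral:
  fixes f r :: "real \<Rightarrow> complex"
  assumes ac: "abs_continuous_on I f" and ab: "a \<le> b" "{a..b} \<subseteq> I" and N: "negligible N"
    and der: "\<And>x. x \<in> {a..b} - N \<Longrightarrow> (f has_vector_derivative r x) (at x within {a..b})"
  shows "(r has_integral f b - f a) {a..b}"
proof -
  \<comment> \<open>Resetting \<open>r\<close> to 0 on \<open>N\<close>, where its values are
    uncontrolled, removes the tags in \<open>N\<close> from the Riemann sum.\<close>
  define r' where "r' x = (if x \<in> N then 0 else r x)" for x
  have "(r' has_integral f b - f a) (cbox a b)"
    unfolding has_integral
  proof (intro allI impI)
    fix e :: real assume e: "e > 0"
    \<comment> \<open>Half of \<open>e\<close> is spent on tags off \<open>N\<close>, the other half
      on increments over intervals tagged in \<open>N\<close>. The summand 1 keeps the denominator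
      positive when \<open>a = b\<close>.\<close>
    define e1 where "e1 = e / (2 * (b - a + 1))"
    have e1: "e1 > 0" using e ab by (simp add: e1_def)
    obtain \<delta> where \<delta>: "\<delta> > 0"
      and ac': "\<And>D. finite D \<Longrightarrow> (\<forall>(u, v)\<in>D. u \<le> v \<and> {u..v} \<subseteq> I) \<Longrightarrow> disjoint_intervals D
            \<Longrightarrow> (\<Sum>(u, v)\<in>D. v - u) < \<delta> \<Longrightarrow> (\<Sum>(u, v)\<in>D. norm (f v - f u)) < e / 2"
    proof -
      have "e / 2 > 0" using e by simp
      from ac[unfolded abs_continuous_on_def, rule_format, OF this]
      obtain \<delta> where "\<delta> > 0" "\<forall>D. finite D \<longrightarrow> (\<forall>(u, v)\<in>D. u \<le> v \<and> {u..v} \<subseteq> I) \<longrightarrow>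
        disjoint_intervals D \<longrightarrow> (\<Sum>(u, v)\<in>D. v - u) < \<delta> \<longrightarrow> (\<Sum>(u, v)\<in>D. norm (f v - f u)) < e / 2"
        by (elim exE conjE)
      then show thesis by (intro that) (assumption, blast)
    qed
    obtain U where U: "open U" "N \<subseteq> U" "U \<in> lmeasurable" "measure lebesgue U < \<delta>"
      using negligible_open_cover[OF N \<delta>] by blast
    have "\<exists>d>0. x \<in> {a..b} - N \<longrightarrow> (\<forall>y\<in>{a..b}. \<bar>y - x\<bar> < d \<longrightarrow> norm (f y - f x - (y - x) *\<^sub>R r x) \<le> e1 * \<bar>y - x\<bar>)" for x
    proof (cases "x \<in> {a..b} - N")
      case True
      then show ?thesis using der[OF True] e1 unfolding has_vector_derivative_def has_derivative_within_alt
        by (auto simp: real_norm_def)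
    qed (auto intro: exI[of _ 1])
    then obtain d where d: "\<And>x. d x > 0"
      and dd: "\<And>x y. x \<in> {a..b} - N \<Longrightarrow> y \<in> {a..b} \<Longrightarrow> \<bar>y - x\<bar> < d x \<Longrightarrow> norm (f y - f x - (y - x) *\<^sub>R r x) \<le> e1 * \<bar>y - x\<bar>"
      by metis
    define \<gamma> where "\<gamma> x = (if x \<in> N then U else ball x (d x))" for x
    have gauge: "gauge \<gamma>" using U d by (auto simp: \<gamma>_def gauge_def)
    have small: "norm ((\<Sum>(x, K)\<in>T. measure lborel K *\<^sub>R r' x) - (f b - f a)) < e"
      if T: "T tagged_division_of cbox a b" "\<gamma> fine T" for T
    proof -
      note T' = tagged_division_ofD[OF T(1)]
      have K: "\<exists>u v. K = {u..v} \<and> u \<le> x \<and> x \<le> v \<and> a \<le> u \<and> v \<le> b \<and> {u..v} \<subseteq> \<gamma> x" if xK: "(x, K) \<in> T" for x K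
      proof -
        obtain u v where "K = {u..v}" using T'(4)[OF xK] by (auto simp: cbox_interval)
        moreover have "x \<in> K" "K \<subseteq> {a..b}" using T'(2,3)[OF xK] by (auto simp: cbox_interval)
        moreover have "K \<subseteq> \<gamma> x" using T(2) xK unfolding fine_def by blast
        ultimately show ?thesis by auto
      qed
      \<comment> \<open>\<open>P\<close> collects the pairs tagged in the null set, \<open>D\<close>
        the end points of their intervals, and \<open>h\<close> is the error allowed for each
        pair.\<close>
      define P where "P = {(x, K)\<in>T. x \<in> N}"
      define D where "D = (\<lambda>(x, K). (Inf K, Sup K)) ` P"
      define h where "h = (\<lambda>(x, K). if x \<in> N then norm (f (Sup K) - f (Inf K)) else e1 * measure lborel K)"
      have finP: "finite P" using T'(1) unfolding P_def by (rule rev_finite_subset) auto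
      have finD: "finite D" using finP by (simp add: D_def)
      have Dpair: "u \<le> v \<and> {u..v} \<subseteq> {a..b} \<and> {u..v} \<subseteq> U \<and> (\<exists>x. (x, {u..v}) \<in> T)" if uv: "(u, v) \<in> D" for u v
      proof -
        obtain x K where xK: "(x, K) \<in> T" "x \<in> N" "u = Inf K" "v = Sup K"
          using uv unfolding D_def P_def by auto
        obtain c d where "K = {c..d}" "c \<le> x" "x \<le> d" "a \<le> c" "d \<le> b" "{c..d} \<subseteq> \<gamma> x" using K[OF xK(1)] by blast
        then show ?thesis using xK by (auto simp: \<gamma>_def)
      qed
      have disj: "disjoint_intervals D"
      proof (rule pairwiseI)
        fix p1 p2 assume p: "p1 \<in> D" "p2 \<in> D" "p1 \<noteq> p2"
        obtain u v c d where uv: "p1 = (u, v)" "p2 = (c, d)" by fastforce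
        obtain x where x: "(x, {u..v}) \<in> T" "u \<le> v" using Dpair p uv by blast
        obtain y where y: "(y, {c..d}) \<in> T" "c \<le> d" using Dpair p uv by blast
        have "{u..v} \<noteq> {c..d}" using x y p uv by auto
        then show "(\<lambda>(a, b) (c, d). {a<..<b} \<inter> {c<..<d} = {}) p1 p2"
          using T'(5)[OF x(1) y(1)] uv by simp
      qed
      \<comment> \<open>The intervals of \<open>D\<close> do not overlap and lie in the cover
        \<open>U\<close>, so integrating the indicator of \<open>U\<close> bounds their total length
        by its measure.\<close>
      have "(\<Sum>(u, v)\<in>D. v - u) < \<delta>"
      proof -
        define g where "g = (indicator U :: real \<Rightarrow> real)"
        have Uint: "(\<lambda>x. 1::real) integrable_on U \<inter> {a..b}"
          using U(3) by (metis fmeasurable_Int_fmeasurable fmeasurableD inf_commute lmeasurable_cbox cbox_interval lmeasurable_iff_integrable_on)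
        have gi: "g integrable_on {a..b}"
          using Uint integrable_restrict_Int[of U "\<lambda>x. 1::real" "{a..b}"]
          unfolding g_def indicator_def of_bool_def by simp
        have "(\<Sum>(u, v)\<in>D. v - u) = (\<Sum>(u, v)\<in>D. integral {u..v} g)"
        proof (rule sum.cong[OF refl], clarify)
          fix u v assume uv: "(u, v) \<in> D"
          have "integral {u..v} g = integral {u..v} (\<lambda>x. 1::real)"
            by (rule integral_cong) (use Dpair[OF uv] in \<open>auto simp: g_def\<close>)
          then show "v - u = integral {u..v} g" using Dpair[OF uv] by simp
        qed
        also have "\<dots> \<le> integral {a..b} g"
          by (rule sum_integral_disjoint_intervals_le) (use finD Dpair disj gi in \<open>auto simp: g_def\<close>)
        also have "\<dots> \<le> integral UNIV g"
        proof (rule integral_subset_le)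
          show "g integrable_on UNIV" using U(3) unfolding g_def
            using lmeasurable_iff_has_integral has_integral_integrable by blast
        qed (use gi in \<open>auto simp: g_def\<close>)
        also have "\<dots> = measure lebesgue U" using lmeasure_integral_UNIV[OF U(3)] by (simp add: g_def)
        finally show ?thesis using U(4) by simp
      qed
      then have "(\<Sum>(u, v)\<in>D. norm (f v - f u)) < e / 2"
        using ac'[OF finD _ disj] Dpair ab(2) by blast
      \<comment> \<open>Two tagged pairs can share their end points only if the interval is
        degenerate, and then its increment is 0, so the reindexing loses nothing.\<close>
      moreover have "(\<Sum>(u, v)\<in>D. norm (f v - f u)) = (\<Sum>(x, K)\<in>P. norm (f (Sup K) - f (Inf K)))"
      proof -
        have "(\<Sum>z\<in>D. norm (f (snd z) - f (fst z))) = (\<Sum>z\<in>P. norm (f (Sup (snd z)) - f (Inf (snd z))))"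
          unfolding D_def
        proof (subst sum.reindex_nontrivial[OF finP])
          fix p1 p2 assume p: "p1 \<in> P" "p2 \<in> P" "p1 \<noteq> p2"
            and eq: "(\<lambda>(x, K). (Inf K, Sup K)) p1 = (\<lambda>(x, K). (Inf K, Sup K)) p2"
          obtain x K where xK: "p1 = (x, K)" by fastforce
          obtain y L where yL: "p2 = (y, L)" by fastforce
          have T12: "(x, K) \<in> T" "(y, L) \<in> T" using p xK yL by (auto simp: P_def)
          obtain u v where uv: "K = {u..v}" "u \<le> v" using K[OF T12(1)] by force
          obtain c d where cd: "L = {c..d}" "c \<le> d" using K[OF T12(2)] by force
          have "K = L" using eq xK yL uv cd by auto
          then have "interior K = {}" using T'(5)[OF T12] p xK yL by simp
          then have "u = v" using uv by auto
          then show "norm (f (snd ((\<lambda>(x, K). (Inf K, Sup K)) p1)) - f (fst ((\<lambda>(x, K). (Inf K, Sup K)) p1))) = 0"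
            using xK uv by simp
        qed (auto simp: case_prod_beta)
        then show ?thesis by (simp add: case_prod_beta)
      qed
      ultimately have part1: "(\<Sum>(x, K)\<in>P. norm (f (Sup K) - f (Inf K))) < e / 2" by simp
      have hsum: "(\<Sum>z\<in>T. h z) \<le> (\<Sum>(x, K)\<in>P. norm (f (Sup K) - f (Inf K))) + e1 * (b - a)"
      proof -
        have PT: "P \<subseteq> T" by (auto simp: P_def)
        have "(\<Sum>z\<in>T. h z) = (\<Sum>z\<in>P. h z) + (\<Sum>z\<in>T - P. h z)"
          using sum.subset_diff[OF PT T'(1), of h] by simp
        also have "(\<Sum>z\<in>P. h z) = (\<Sum>(x, K)\<in>P. norm (f (Sup K) - f (Inf K)))"
          by (rule sum.cong) (auto simp: P_def h_def)
        also have "(\<Sum>z\<in>T - P. h z) = (\<Sum>z\<in>T - P. e1 * measure lborel (snd z))"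
          by (rule sum.cong) (auto simp: P_def h_def split: if_splits)
        also have "\<dots> \<le> (\<Sum>z\<in>T. e1 * measure lborel (snd z))"
          by (rule sum_mono2) (use T'(1) e1 in auto)
        also have "\<dots> = e1 * (\<Sum>(x, K)\<in>T. measure lborel K)" by (simp add: sum_distrib_left case_prod_beta)
        also have "\<dots> = e1 * (b - a)" using additive_content_tagged_division[OF T(1)] ab by simp
        finally show ?thesis by simp
      qed
      have e1b: "e1 * (b - a) \<le> e / 2" using e ab by (simp add: e1_def field_simps)
      have "(\<Sum>(x, K)\<in>T. measure lborel K *\<^sub>R r' x) - (f b - f a)
          = (\<Sum>z\<in>T. measure lborel (snd z) *\<^sub>R r' (fst z) - (f (Sup (snd z)) - f (Inf (snd z))))"
        using additive_tagged_division_1[OF ab(1), of T f] T(1)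
        by (simp add: sum_subtractf case_prod_beta cbox_interval)
      also have "norm \<dots> \<le> (\<Sum>z\<in>T. h z)"
      proof (rule sum_norm_le)
        fix z assume z: "z \<in> T"
        obtain x K where xK: "z = (x, K)" by fastforce
        obtain u v where uv: "K = {u..v}" "u \<le> x" "x \<le> v" "a \<le> u" "v \<le> b" "{u..v} \<subseteq> \<gamma> x"
          using K z xK by blast
        show "norm (measure lborel (snd z) *\<^sub>R r' (fst z) - (f (Sup (snd z)) - f (Inf (snd z)))) \<le> h z"
        proof (cases "x \<in> N")
          case True
          then show ?thesis using xK by (simp add: h_def r'_def norm_minus_commute)
        next
          case False
          have x: "x \<in> {a..b} - N" using False uv by auto
          have sub: "{u..v} \<subseteq> ball x (d x)" using uv False by (simp add: \<gamma>_def)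
          have "u \<in> {u..v}" "v \<in> {u..v}" using uv by auto
          then have "u \<in> ball x (d x)" "v \<in> ball x (d x)" using sub by blast+
          then have close: "\<bar>u - x\<bar> < d x" "\<bar>v - x\<bar> < d x" by (auto simp: dist_real_def)
          have A: "norm (f u - f x - (u - x) *\<^sub>R r x) \<le> e1 * (x - u)"
            using dd[OF x, of u] close uv by auto
          have B: "norm (f v - f x - (v - x) *\<^sub>R r x) \<le> e1 * (v - x)"
            using dd[OF x, of v] close uv by auto
          have "(v - u) *\<^sub>R r x - (f v - f u) = (f u - f x - (u - x) *\<^sub>R r x) - (f v - f x - (v - x) *\<^sub>R r x)"
            by (simp add: algebra_simps)
          also have "norm \<dots> \<le> e1 * (x - u) + e1 * (v - x)" using A B norm_triangle_le_diff by (smt (verit))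
          also have "\<dots> = e1 * (v - u)" by (simp add: algebra_simps)
          finally show ?thesis using xK uv False by (simp add: h_def r'_def)
        qed
      qed
      also have "\<dots> < e" using hsum part1 e1b by linarith
      finally show ?thesis .
    qed
    show "\<exists>\<gamma>. gauge \<gamma> \<and> (\<forall>\<D>. \<D> tagged_division_of cbox a b \<and> \<gamma> fine \<D> \<longrightarrow>
          norm ((\<Sum>(x, k)\<in>\<D>. measure lborel k *\<^sub>R r' x) - (f b - f a)) < e)" 
      by (intro exI[of _ \<gamma>] conjI allI impI gauge) (elim conjE, rule small)
  qed
  then have "(r' has_integral f b - f a) {a..b}" by (simp add: cbox_interval)
  then show ?thesis by (rule has_integral_spike[OF N, rotated]) (simp add: r'_def)
qed

text \<open>Henstock's lemma bounds the total length of disjoint intervals on which the mean of \<open>f\<close> is far from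
  its value at a tag; Vitali's theorem extracts such a family covering almost all of the bad set.\<close>
lemma indefinite_integral_has_vector_derivative_ae:
  fixes f :: "real \<Rightarrow> complex"
  assumes f: "f integrable_on {a..b}"
  obtains N where "negligible N"
    "\<And>x. x \<in> {a<..<b} - N \<Longrightarrow> ((\<lambda>x. integral {a..x} f) has_vector_derivative f x) (at x)"
proof -
  \<comment> \<open>The thresholds 1 / (n + 1) tend to 0, so an interior point at which the
    derivative fails to exist with value \<open>f x\<close> lies in some \<open>E n\<close>.\<close>
  define bad where "bad n x u v \<longleftrightarrow> u \<le> x \<and> x \<le> v \<and> u < v \<and> {u..v} \<subseteq> {a..b} \<and>
      norm ((v - u) *\<^sub>R f x - integral {u..v} f) > (v - u) / real (Suc n)" for n x u v
  define E where "E n = {x\<in>{a<..<b}. \<forall>d>0. \<exists>u v. bad n x u v \<and> v - u < d}" for n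
  have negE: "negligible (E n)" for n
    unfolding negligible_outer_le
  proof (intro allI impI)
    fix e :: real assume "e > 0"
    \<comment> \<open>Division by \<open>Suc n\<close> cancels the factor in \<open>bad\<close>:
      Henstock's bound on the errors becomes the bound \<open>e\<close> on the total length.\<close>
    define e1 where "e1 = e / real (Suc n)"
    have e1: "e1 > 0" using \<open>e > 0\<close> by (simp add: e1_def)
    have "f integrable_on cbox a b" using f by (simp add: cbox_interval)
    from Henstock_lemma[OF this e1] obtain \<gamma> where \<gamma>: "gauge \<gamma>"
      and hl: "\<And>p. p tagged_partial_division_of cbox a b \<Longrightarrow> \<gamma> fine p \<Longrightarrow>
        (\<Sum>(x, k)\<in>p. norm (measure lborel k *\<^sub>R f x - integral k f)) < e1" by blast
    define K where "K = {(x, u, v). bad n x u v \<and> {u..v} \<subseteq> \<gamma> x}"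
    \<comment> \<open>Centre and radius recast the intervals as balls for Vitali's theorem. The tag
      stays in the index, so that a selected family can be read as a tagged partial
      division.\<close>
    define c where "c = (\<lambda>(x::real, u::real, v::real). (u + v) / 2)"
    define r where "r = (\<lambda>(x::real, u::real, v::real). (v - u) / 2)"
    have cb: "cball (c i) (r i) = {fst (snd i)..snd (snd i)}" for i
      by (cases i) (auto simp: c_def r_def cball_eq_atLeastAtMost field_simps)
    have rpos: "0 < r i" if "i \<in> K" for i
      using that by (auto simp: K_def bad_def r_def)
    have cover: "\<exists>i. i \<in> K \<and> x \<in> cball (c i) (r i) \<and> r i < d" if x: "x \<in> E n" and d: "0 < d" for x d
    proof -
      have "open (\<gamma> x)" "x \<in> \<gamma> x" using \<gamma> by (auto simp: gauge_def)
      then obtain s where s: "s > 0" "ball x s \<subseteq> \<gamma> x" using openE by blast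
      have "min s d > 0" using s d by simp
      then obtain u v where uv: "bad n x u v" "v - u < min s d" using x unfolding E_def by blast
      have "{u..v} \<subseteq> ball x s" using uv by (auto simp: bad_def dist_real_def)
      then have "(x, u, v) \<in> K" using uv s by (auto simp: K_def)
      moreover have "x \<in> cball (c (x, u, v)) (r (x, u, v))" unfolding cb using uv by (simp add: bad_def)
      moreover have "r (x, u, v) < d" using uv d by (simp add: r_def bad_def)
      ultimately show ?thesis by blast
    qed
    obtain C where C: "countable C" "C \<subseteq> K"
      "pairwise (\<lambda>i j. disjnt (cball (c i) (r i)) (cball (c j) (r j))) C"
      "negligible (E n - (\<Union>i\<in>C. cball (c i) (r i)))"
      using Vitali_covering_theorem_cballs[of K r "E n" c] rpos cover by blast
    \<comment> \<open>The bound is uniform over finite subfamilies, hence survives in the countable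
      union.\<close>
    have bound: "measure lebesgue (\<Union>i\<in>F. cball (c i) (r i)) \<le> e" if F: "F \<subseteq> C" "finite F" for F
    proof -
      define p where "p = (\<lambda>(x, u, v). (x, {u..v})) ` F"
      have FK: "bad n (fst i) (fst (snd i)) (snd (snd i)) \<and> {fst (snd i)..snd (snd i)} \<subseteq> \<gamma> (fst i)" if "i \<in> F" for i
        using that F(1) C(2) by (force simp: K_def)
      have disj: "{fst (snd i)..snd (snd i)} \<inter> {fst (snd j)..snd (snd j)} = {}" if "i \<in> F" "j \<in> F" "i \<noteq> j" for i j
        using pairwiseD[OF C(3), of i j] that F(1) unfolding cb disjnt_def by blast
      have "p tagged_partial_division_of cbox a b"
        unfolding tagged_partial_division_of_def
      proof (intro conjI allI impI)
        show "finite p" using F by (simp add: p_def)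
        fix x L assume "(x, L) \<in> p"
        then obtain u v where uv: "(x, u, v) \<in> F" "L = {u..v}" by (auto simp: p_def)
        have "bad n x u v" using FK[OF uv(1)] by simp
        then show "x \<in> L" "L \<subseteq> cbox a b" using uv by (simp_all add: bad_def)
        show "\<exists>a b. L = cbox a b" using uv cbox_interval by metis
      next
        fix x L y M assume h: "(x, L) \<in> p \<and> (y, M) \<in> p \<and> (x, L) \<noteq> (y, M)"
        then obtain u v u' v' where uv: "(x, u, v) \<in> F" "L = {u..v}" "(y, u', v') \<in> F" "M = {u'..v'}"
          by (auto simp: p_def)
        then have "(x, u, v) \<noteq> (y, u', v')" using h by auto
        then have "L \<inter> M = {}" using disj[OF uv(1,3)] uv by simp
        then show "interior L \<inter> interior M = {}" using interior_subset by blast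
      qed
      moreover have "\<gamma> fine p" using FK by (force simp: p_def fine_def)
      ultimately have "(\<Sum>(x, k)\<in>p. norm (measure lborel k *\<^sub>R f x - integral k f)) < e1" by (rule hl)
      moreover have "(\<Sum>(x, k)\<in>p. norm (measure lborel k *\<^sub>R f x - integral k f))
          = (\<Sum>(x, u, v)\<in>F. norm ((v - u) *\<^sub>R f x - integral {u..v} f))"
      proof -
        have inj: "inj_on (\<lambda>(x, u, v). (x, {u..v})) F"
        proof (rule inj_onI)
          fix i j assume ij: "i \<in> F" "j \<in> F" "(\<lambda>(x, u, v). (x, {u..v})) i = (\<lambda>(x, u, v). (x, {u..v})) j"
          then have "{fst (snd i)..snd (snd i)} = {fst (snd j)..snd (snd j)}" by (auto simp: case_prod_beta)
          then show "i = j" using disj[OF ij(1,2)] FK[OF ij(1)] by (force simp: bad_def)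
        qed
        show ?thesis unfolding p_def sum.reindex[OF inj]
          by (rule sum.cong) (use FK in \<open>force simp: bad_def case_prod_beta\<close>)+
      qed
      moreover have "(\<Sum>(x, u, v)\<in>F. (v - u) / real (Suc n)) \<le> (\<Sum>(x, u, v)\<in>F. norm ((v - u) *\<^sub>R f x - integral {u..v} f))"
        by (rule sum_mono) (use FK in \<open>force simp: bad_def case_prod_beta\<close>)
      moreover have "(\<Sum>(x, u, v)\<in>F. (v - u) / real (Suc n)) = (\<Sum>(x, u, v)\<in>F. v - u) / real (Suc n)"
        by (simp add: sum_divide_distrib case_prod_beta)
      ultimately have "(\<Sum>(x, u, v)\<in>F. v - u) / real (Suc n) < e1" by linarith
      then have sumlt: "(\<Sum>(x, u, v)\<in>F. v - u) < e" by (simp add: e1_def divide_less_cancel del: of_nat_Suc)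
      have "measure lebesgue (\<Union>i\<in>F. cball (c i) (r i)) \<le> (\<Sum>i\<in>F. measure lebesgue (cball (c i) (r i)))"
        by (rule measure_UNION_le) (use F in auto)
      also have "\<dots> = (\<Sum>(x, u, v)\<in>F. v - u)"
        unfolding cb by (rule sum.cong) (use FK in \<open>force simp: bad_def case_prod_beta\<close>)+
      finally show ?thesis using sumlt by simp
    qed
    define U where "U = (\<Union>i\<in>C. cball (c i) (r i))"
    have U: "U \<in> lmeasurable" "measure lebesgue U \<le> e"
      unfolding U_def
      by (rule fmeasurable_UN_bound[OF C(1) _ bound] measure_UN_bound[OF C(1) _ bound]; simp)+
    have N: "E n - U \<in> lmeasurable" "measure lebesgue (E n - U) = 0"
      using C(4) negligible_iff_measure unfolding U_def by blast+
    have "E n \<subseteq> U \<union> (E n - U)" by blast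
    moreover have "U \<union> (E n - U) \<in> lmeasurable" using U N fmeasurable.Un by blast
    moreover have "measure lebesgue (U \<union> (E n - U)) \<le> e"
      using measure_Un_le[of U lebesgue "E n - U"] U N fmeasurableD by fastforce
    ultimately show "\<exists>T. E n \<subseteq> T \<and> T \<in> lmeasurable \<and> measure lebesgue T \<le> e" by blast
  qed
  define N where "N = (\<Union>n. E n)"
  have "negligible N" unfolding N_def using negE by (intro negligible_countable_Union) auto
  moreover have "((\<lambda>x. integral {a..x} f) has_vector_derivative f x) (at x)" if x: "x \<in> {a<..<b} - N" for x
    unfolding has_vector_derivative_def has_derivative_within_alt
  proof (intro conjI allI impI)
    show "bounded_linear (\<lambda>h. h *\<^sub>R f x)" by (rule bounded_linear_scaleR_left)
    fix e :: real assume "e > 0"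
    then obtain n where n: "inverse (real (Suc n)) < e" using reals_Archimedean by blast
    have "x \<notin> E n" using x by (simp add: N_def)
    then have "\<not> (\<forall>d>0. \<exists>u v. bad n x u v \<and> v - u < d)"
      using x by (simp add: E_def)
    then have "\<exists>d>0. \<forall>u v. v - u < d \<longrightarrow> \<not> bad n x u v"
      by (simp add: not_ex) blast
    then obtain d where d: "d > 0" "\<And>u v. v - u < d \<Longrightarrow> \<not> bad n x u v" by blast
    define d' where "d' = Min {d, x - a, b - x}"
    have d': "d' > 0" "d' \<le> d" "d' \<le> x - a" "d' \<le> b - x" using d x by (auto simp: d'_def)
    have *: "norm ((v - u) *\<^sub>R f x - integral {u..v} f) \<le> e * (v - u)"
      if "u \<le> x" "x \<le> v" "u < v" "v - u < d'" for u v
    proof -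
      have "\<not> bad n x u v" using d(2) that d' by simp
      then have "norm ((v - u) *\<^sub>R f x - integral {u..v} f) \<le> (v - u) / real (Suc n)"
        using that d' unfolding bad_def by auto
      also have "\<dots> = inverse (real (Suc n)) * (v - u)" by (simp add: divide_inverse)
      also have "\<dots> \<le> e * (v - u)" using n that by (intro mult_right_mono) auto
      finally show ?thesis .
    qed
    have comb: "integral {a..v} f - integral {a..u} f = integral {u..v} f" if "a \<le> u" "u \<le> v" "v \<le> b" for u v
      using Henstock_Kurzweil_Integration.integral_combine[of a u v f] that
        integrable_on_subinterval[OF f, of a v] by (simp add: algebra_simps)
    show "\<exists>d>0. \<forall>y\<in>UNIV. norm (y - x) < d \<longrightarrow>
        norm (integral {a..y} f - integral {a..x} f - (y - x) *\<^sub>R f x) \<le> e * norm (y - x)"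
    proof (intro exI[of _ d'] conjI ballI impI)
      fix y assume y: "norm (y - x) < d'"
      consider "y = x" | "y < x" | "x < y" by linarith
      then show "norm (integral {a..y} f - integral {a..x} f - (y - x) *\<^sub>R f x) \<le> e * norm (y - x)"
      proof cases
        case 2
        have "integral {a..y} f - integral {a..x} f - (y - x) *\<^sub>R f x = (x - y) *\<^sub>R f x - integral {y..x} f"
          using comb[of y x] 2 y d' x by (simp add: algebra_simps)
        then show ?thesis using *[of y x] 2 y by simp
      next
        case 3
        have "integral {a..y} f - integral {a..x} f - (y - x) *\<^sub>R f x = - ((y - x) *\<^sub>R f x - integral {x..y} f)"
          using comb[of x y] 3 y d' x by (simp add: algebra_simps)
        moreover have "y - x < d'" using y 3 by simp
        then have "norm ((y - x) *\<^sub>R f x - integral {x..y} f) \<le> e * (y - x)"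
          using 3 by (intro *) linarith+
        ultimately show ?thesis using 3 by (simp only: norm_minus_cancel real_norm_def abs_of_pos diff_gt_0_iff_gt)
      qed simp
    qed (use d' in auto)
  qed
  ultimately show ?thesis using that by blast
qed

text \<open>Prescribing every increment encodes an indefinite integral without a base point or a
  constant of integration, and the condition is linear in the pair of functions.\<close>

definition primitive_on :: "real \<Rightarrow> real \<Rightarrow> (real \<Rightarrow> complex) \<Rightarrow> (real \<Rightarrow> complex) \<Rightarrow> bool" where
  "primitive_on a b r p \<longleftrightarrow> (\<forall>x y. a \<le> x \<longrightarrow> x \<le> y \<longrightarrow> y \<le> b \<longrightarrow> (r has_integral p y - p x) {x..y})"

lemma primitive_onD: "primitive_on a b r p \<Longrightarrow> a \<le> x \<Longrightarrow> x \<le> y \<Longrightarrow> y \<le> b \<Longrightarrow> (r has_integral p y - p x) {x..y}"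
  by (simp add: primitive_on_def)

text \<open>Normalized at the right end, because the data of the problem are prescribed at
  \<open>S\<close> and carried leftwards.\<close>

lemma primitive_on_integral:
  assumes "r integrable_on {a..b}"
  shows "primitive_on a b r (\<lambda>x. c - integral {x..b} r)"
  unfolding primitive_on_def
proof (intro allI impI)
  fix x y assume xy: "a \<le> x" "x \<le> y" "y \<le> b"
  have "r integrable_on {x..b}" "r integrable_on {x..y}" using assms xy integrable_on_subinterval by (metis atLeastatMost_subset_iff order_refl order_trans)+
  then show "(r has_integral c - integral {y..b} r - (c - integral {x..b} r)) {x..y}"
    using Henstock_Kurzweil_Integration.integral_combine[of x y b r] xy by (simp add: algebra_simps has_integral_iff)
qed

lemma primitive_on_integral_left:
  assumes "r integrable_on {a..b}"
  shows "primitive_on a b r (\<lambda>x. integral {a..x} r)"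
  unfolding primitive_on_def
proof (intro allI impI)
  fix x y assume xy: "a \<le> x" "x \<le> y" "y \<le> b"
  have "r integrable_on {a..y}" "r integrable_on {x..y}" using assms xy integrable_on_subinterval by (metis atLeastatMost_subset_iff order_refl order_trans)+
  then show "(r has_integral integral {a..y} r - integral {a..x} r) {x..y}"
    using Henstock_Kurzweil_Integration.integral_combine[of a x y r] xy by (simp add: algebra_simps has_integral_iff)
qed

lemma primitive_on_continuous:
  assumes p: "primitive_on a b r p"
  shows "continuous_on {a..b} p"
proof (cases "a \<le> b")
  case True
  have r: "r integrable_on {a..b}" using primitive_onD[OF p, of a b] True by auto
  have "continuous_on {a..b} (\<lambda>x. p a + integral {a..x} r)"
    by (intro continuous_intros indefinite_integral_continuous_1 r)
  moreover have "p a + integral {a..x} r = p x" if "x \<in> {a..b}" for x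
    using primitive_onD[OF p, of a x] that by (simp add: integral_unique)
  ultimately show ?thesis by (metis (no_types, lifting) continuous_on_eq)
qed simp

lemma primitive_on_has_vector_derivative:
  assumes p: "primitive_on a b r p" and r: "continuous_on {a..b} r" and x: "x \<in> {a..b}"
  shows "(p has_vector_derivative r x) (at x within {a..b})"
proof -
  have "((\<lambda>x. p a + integral {a..x} r) has_vector_derivative r x) (at x within {a..b})"
    using integral_has_vector_derivative[OF r x] by (auto intro!: derivative_eq_intros)
  moreover have "p a + integral {a..y} r = p y" if "y \<in> {a..b}" for y
    using primitive_onD[OF p, of a y] that by (simp add: integral_unique)
  ultimately show ?thesis using x by (metis (no_types, lifting) has_vector_derivative_transform)
qed

lemma primitive_on_ae_derivative:
  assumes p: "primitive_on a b r p" and ab: "a \<le> b"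
  obtains N where "negligible N" "\<And>x. x \<in> {a<..<b} - N \<Longrightarrow> (p has_vector_derivative r x) (at x)"
proof -
  have r: "r integrable_on {a..b}" using primitive_onD[OF p, of a b] ab by auto
  obtain N where N: "negligible N" "\<And>x. x \<in> {a<..<b} - N \<Longrightarrow> ((\<lambda>x. integral {a..x} r) has_vector_derivative r x) (at x)"
    using indefinite_integral_has_vector_derivative_ae[OF r] by blast
  have "(p has_vector_derivative r x) (at x)" if x: "x \<in> {a<..<b} - N" for x
  proof -
    have "((\<lambda>x. p a + integral {a..x} r) has_vector_derivative r x) (at x)"
      using N(2)[OF x] by (auto intro!: derivative_eq_intros)
    moreover have "p a + integral {a..y} r = p y" if "y \<in> {a<..<b}" for y
      using primitive_onD[OF p, of a y] that by (simp add: integral_unique)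
    ultimately show ?thesis using x
      by (metis (no_types, lifting) Diff_iff has_vector_derivative_transform_within_open open_greaterThanLessThan)
  qed
  then show ?thesis using that N(1) by blast
qed

lemma primitive_on_cong:
  assumes "\<And>x. x \<in> {a..b} \<Longrightarrow> r x = r' x" "\<And>x. x \<in> {a..b} \<Longrightarrow> p x = p' x"
    and p: "primitive_on a b r p"
  shows "primitive_on a b r' p'"
  unfolding primitive_on_def
proof (intro allI impI)
  fix x y assume xy: "a \<le> x" "x \<le> y" "y \<le> b"
  have "(r has_integral p' y - p' x) {x..y}" using primitive_onD[OF p xy] assms(2) xy by simp
  then show "(r' has_integral p' y - p' x) {x..y}"
    by (rule has_integral_eq[rotated]) (use assms(1) xy in auto)
qed

text \<open>AM--GM: \<open>|r| \<le> l + |r|\<^sup>2 / l\<close>, with \<open>l\<close> large, makes the increments of a primitive of a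
  square-integrable function small over short families of intervals.\<close>
lemma primitive_on_abs_continuous:
  assumes p: "primitive_on a b r p" and I: "I \<subseteq> {a..b}"
    and g: "g integrable_on {a..b}" "\<And>x. x \<in> {a..b} \<Longrightarrow> (norm (r x))\<^sup>2 \<le> g x"
  shows "abs_continuous_on I p"
  unfolding abs_continuous_on_def
proof (intro allI impI)
  fix e :: real assume e: "e > 0"
  \<comment> \<open>With this \<open>l\<close> the integral of \<open>g\<close> divided by
    \<open>l\<close> is below \<open>e / 2\<close>, and total lengths below
    \<open>e / (2 * l)\<close> account for the other half. The summand 1 covers a vanishing
    integral.\<close>
  define l where "l = 2 * (integral {a..b} g + 1) / e"
  have g0: "g x \<ge> 0" if "x \<in> {a..b}" for x using g(2)[OF that] by (meson order_trans zero_le_power2)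
  have G0: "integral {a..b} g \<ge> 0" using g0 by (intro integral_nonneg g) auto
  then have l: "l > 0" using e by (simp add: l_def)
  show "\<exists>\<delta>>0. \<forall>D. finite D \<longrightarrow> (\<forall>(a, b)\<in>D. a \<le> b \<and> {a..b} \<subseteq> I) \<longrightarrow>
      disjoint_intervals D \<longrightarrow> (\<Sum>(a, b)\<in>D. b - a) < \<delta> \<longrightarrow> (\<Sum>(a, b)\<in>D. norm (p b - p a)) < e"
  proof (intro exI[of _ "e / (2 * l)"] conjI allI impI)
    show "0 < e / (2 * l)" using e l by simp
    fix D :: "(real \<times> real) set" assume D: "finite D" "\<forall>(a, b)\<in>D. a \<le> b \<and> {a..b} \<subseteq> I"
      "disjoint_intervals D" "(\<Sum>(a, b)\<in>D. b - a) < e / (2 * l)"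
    have Dab: "u \<le> v \<and> {u..v} \<subseteq> {a..b}" if "(u, v) \<in> D" for u v using D(2) that I by blast
    have step: "norm (p v - p u) \<le> l * (v - u) + integral {u..v} g / l" if uv: "(u, v) \<in> D" for u v
    proof -
      have uv': "a \<le> u" "u \<le> v" "v \<le> b" using Dab[OF uv] by auto
      have gi: "g integrable_on {u..v}" using g(1) Dab[OF uv] integrable_on_subinterval by blast
      have hi: "(\<lambda>x. l + g x / l) integrable_on {u..v}" using gi by (intro integrable_add integrable_on_divide) auto
      have "norm (integral {u..v} r) \<le> integral {u..v} (\<lambda>x. l + g x / l)"
      proof (rule integral_norm_bound_integral[OF _ hi])
        show "r integrable_on {u..v}" using primitive_onD[OF p uv'] by blast
        fix x assume x: "x \<in> {u..v}"
        have "norm (r x) * l \<le> l\<^sup>2 + (norm (r x))\<^sup>2"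
          using sum_squares_bound[of "norm (r x)" l] mult_nonneg_nonneg[OF norm_ge_zero[of "r x"] less_imp_le[OF l]]
          by linarith
        also have "\<dots> \<le> l\<^sup>2 + g x" using g(2)[of x] x uv' by auto
        finally show "norm (r x) \<le> l + g x / l" using l by (simp add: field_simps power2_eq_square)
      qed
      also have "\<dots> = l * (v - u) + integral {u..v} g / l"
        using uv' gi by (subst integral_add) (auto intro!: integrable_on_divide)
      finally show ?thesis using primitive_onD[OF p uv'] by (simp add: integral_unique)
    qed
    have "(\<Sum>(u, v)\<in>D. norm (p v - p u)) \<le> (\<Sum>(u, v)\<in>D. l * (v - u) + integral {u..v} g / l)"
      by (rule sum_mono) (use step in auto)
    also have "\<dots> = l * (\<Sum>(u, v)\<in>D. v - u) + (\<Sum>(u, v)\<in>D. integral {u..v} g) / l"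
      by (simp add: sum.distrib sum_distrib_left sum_divide_distrib case_prod_beta)
    also have "\<dots> \<le> l * (\<Sum>(u, v)\<in>D. v - u) + integral {a..b} g / l"
      using sum_integral_disjoint_intervals_le[OF D(1) Dab D(3) g(1) g0] l by (simp add: divide_right_mono)
    also have "\<dots> < e / 2 + e / 2"
    proof (rule add_strict_mono)
      show "l * (\<Sum>(u, v)\<in>D. v - u) < e / 2" using D(4) l by (simp add: field_simps)
      show "integral {a..b} g / l < e / 2" using G0 e by (simp add: l_def field_simps)
    qed
    finally show "(\<Sum>(a, b)\<in>D. norm (p b - p a)) < e" by simp
  qed
qed

section \<open>Integration by parts and Green's identity\<close>

lemma absolutely_integrable_times_continuous:
  fixes r g :: "real \<Rightarrow> complex"
  assumes r: "r absolutely_integrable_on {a..b}" and g: "continuous_on {a..b} g"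
  shows "(\<lambda>x. r x * g x) absolutely_integrable_on {a..b}"
proof -
  have bil: "bilinear ((*) :: complex \<Rightarrow> complex \<Rightarrow> complex)"
    using bounded_bilinear_mult bilinear_conv_bounded_bilinear by blast
  have meas: "g \<in> borel_measurable (lebesgue_on {a..b})"
    by (rule continuous_imp_measurable_on_sets_lebesgue[OF g]) simp
  have bdd: "bounded (g ` {a..b})"
    by (rule compact_imp_bounded[OF compact_continuous_image[OF g compact_Icc]])
  have S: "{a..b} \<in> sets lebesgue" by simp
  have "(\<lambda>x. g x * r x) absolutely_integrable_on {a..b}"
    by (rule absolutely_integrable_bounded_measurable_product[OF bil meas S bdd r])
  then show ?thesis by (simp add: mult.commute)
qed

text \<open>The difference of both sides, as a function of the upper end point, has increments
  \<open>O((v - u) \<integral>\<^sub>u\<^sup>v |r|)\<close>, hence derivative zero everywhere, although \<open>r\<close> need not be continuous.\<close>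
lemma primitive_on_times_C1:
  fixes p r g g' :: "real \<Rightarrow> complex"
  assumes ab: "a \<le> b" and p: "primitive_on a b r p" and r: "r absolutely_integrable_on {a..b}"
    and g: "\<And>x. x \<in> {a..b} \<Longrightarrow> (g has_vector_derivative g' x) (at x within {a..b})"
    and g': "continuous_on {a..b} g'"
  shows "((\<lambda>x. r x * g x + p x * g' x) has_integral (p b * g b - p a * g a)) {a..b}"
proof -
  have cg: "continuous_on {a..b} g" using g has_vector_derivative_continuous continuous_on_eq_continuous_within by blast
  have cp: "continuous_on {a..b} p" by (rule primitive_on_continuous[OF p])
  have nr: "(\<lambda>x. norm (r x)) integrable_on {a..b}" using r absolutely_integrable_on_def by blast
  obtain G where G: "\<And>x. x \<in> {a..b} \<Longrightarrow> norm (g' x) \<le> G" "G \<ge> 0"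
    using compact_imp_bounded[OF compact_continuous_image[OF g' compact_Icc]] bounded_pos
    by (metis (no_types, lifting) image_eqI order_less_imp_le)
  have rg: "(\<lambda>x. r x * g x) integrable_on {a..b}"
    using absolutely_integrable_times_continuous[OF r cg] set_lebesgue_integral_eq_integral(1) by blast
  have pg: "(\<lambda>x. p x * g' x) integrable_on {a..b}"
    by (intro integrable_continuous_real continuous_intros cp g')
  define k where "k x = r x * g x + p x * g' x" for x
  have k: "k integrable_on {a..b}" unfolding k_def by (intro integrable_add rg pg)
  have sub: "f integrable_on {u..v}" if "f integrable_on {a..b}" "a \<le> u" "v \<le> b" for f :: "real \<Rightarrow> 'e::banach" and u v
    using integrable_on_subinterval[OF that(1), of u v] that by auto
  \<comment> \<open>\<open>H\<close> accumulates |r| and so controls the increments of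
    \<open>p\<close>; its continuity replaces continuity of \<open>r\<close>.\<close>
  define H where "H x = integral {a..x} (\<lambda>x. norm (r x))" for x
  have H: "H v - H u = integral {u..v} (\<lambda>x. norm (r x))" if "a \<le> u" "u \<le> v" "v \<le> b" for u v
    using Henstock_Kurzweil_Integration.integral_combine[OF that(1,2) sub[OF nr order_refl that(3)]]
    unfolding H_def by linarith
  have cH: "continuous_on {a..b} H" unfolding H_def by (rule indefinite_integral_continuous_1[OF nr])
  have Hmono: "H u \<le> H v" if "a \<le> u" "u \<le> v" "v \<le> b" for u v
    using H[OF that] integral_nonneg[OF sub[OF nr that(1,3)]] by simp
  have dp: "norm (p v - p u) \<le> H v - H u" if "a \<le> u" "u \<le> v" "v \<le> b" for u v
  proof -
    have "norm (integral {u..v} r) \<le> integral {u..v} (\<lambda>x. norm (r x))"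
      by (rule integral_norm_bound_integral[OF has_integral_integrable[OF primitive_onD[OF p that]] sub[OF nr that(1,3)]])
        simp
    then show ?thesis using integral_unique[OF primitive_onD[OF p that]] H[OF that] by simp
  qed
  have dg: "norm (g v - g u) \<le> G * (v - u)" if "a \<le> u" "u \<le> v" "v \<le> b" for u v
  proof -
    have "(g' has_integral g v - g u) {u..v}"
      by (rule fundamental_theorem_of_calculus[OF that(2)])
        (rule has_vector_derivative_within_subset[OF g], use that in auto)
    then have "norm (g v - g u) \<le> G * measure lborel {u..v}"
    proof (rule has_integral_bound_real[OF G(2) finite.emptyI])
      fix x assume "x \<in> {u..v} - {}"
      then show "norm (g' x) \<le> G" using that by (intro G(1)) auto
    qed
    then show ?thesis using that(2) by simp
  qed
  define D where "D x = p x * g x - integral {a..x} k" for x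
  have inc: "norm (D v - D u) \<le> 2 * G * (v - u) * (H v - H u)" if uv: "a \<le> u" "u \<le> v" "v \<le> b" for u v
  proof -
    have I1: "(r has_integral p v - p u) {u..v}" by (rule primitive_onD[OF p uv])
    have I2: "(g' has_integral g v - g u) {u..v}"
      by (rule fundamental_theorem_of_calculus[OF uv(2)])
        (rule has_vector_derivative_within_subset[OF g], use uv in auto)
    have I3: "(k has_integral integral {a..v} k - integral {a..u} k) {u..v}"
      using primitive_onD[OF primitive_on_integral_left[OF k] uv] .
    \<comment> \<open>Freezing \<open>g\<close> at the right end and \<open>p\<close> at the left
      end makes the first two terms integrate exactly to the increment of the product
      \<open>p g\<close>. Compared with \<open>k\<close>, only second-order terms remain.\<close>
    have "((\<lambda>x. r x * g v + p u * g' x - k x) has_integral (p v - p u) * g v + p u * (g v - g u) - (integral {a..v} k - integral {a..u} k)) {u..v}"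
      by (intro has_integral_diff has_integral_add has_integral_mult_left has_integral_mult_right I1 I2 I3)
    then have I: "((\<lambda>x. r x * g v + p u * g' x - k x) has_integral D v - D u) {u..v}"
      by (simp add: D_def algebra_simps)
    define h where "h x = norm (r x) * (G * (v - u)) + (H v - H u) * G" for x
    have hI: "(h has_integral (H v - H u) * (G * (v - u)) + (v - u) * ((H v - H u) * G)) {u..v}"
    proof -
      have "((\<lambda>x. norm (r x)) has_integral H v - H u) {u..v}"
        using integrable_integral[OF sub[OF nr uv(1,3)]] H[OF uv] by simp
      moreover have "((\<lambda>x. (H v - H u) * G) has_integral (v - u) * ((H v - H u) * G)) {u..v}"
        using has_integral_const_real[of "(H v - H u) * G" u v] uv by simp
      ultimately show ?thesis unfolding h_def by (intro has_integral_add has_integral_mult_left)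
    qed
    have "norm (D v - D u) \<le> (H v - H u) * (G * (v - u)) + (v - u) * ((H v - H u) * G)"
    proof -
      have "norm (integral {u..v} (\<lambda>x. r x * g v + p u * g' x - k x)) \<le> integral {u..v} h"
      proof (rule integral_norm_bound_integral[OF has_integral_integrable[OF I] has_integral_integrable[OF hI]])
        fix x assume x: "x \<in> {u..v}"
        then have x': "a \<le> x" "x \<le> b" "u \<le> x" "x \<le> v" using uv by auto
        have "r x * g v + p u * g' x - k x = r x * (g v - g x) - (p x - p u) * g' x"
          by (simp add: k_def algebra_simps)
        also have "norm \<dots> \<le> norm (r x) * norm (g v - g x) + norm (p x - p u) * norm (g' x)"
          using norm_triangle_ineq4 by (metis norm_mult)
        also have "\<dots> \<le> norm (r x) * (G * (v - u)) + (H v - H u) * G"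
        proof (intro add_mono mult_mono)
          have "G * (v - x) \<le> G * (v - u)" using G(2) x' by (intro mult_left_mono) auto
          then show "norm (g v - g x) \<le> G * (v - u)" using dg[of x v] x' uv by linarith
          show "norm (p x - p u) \<le> H v - H u" using dp[of u x] Hmono[of x v] x' uv by linarith
          show "norm (g' x) \<le> G" using G x' by simp
          show "0 \<le> H v - H u" using Hmono[OF uv] by simp
        qed auto
        finally show "norm (r x * g v + p u * g' x - k x) \<le> h x" by (simp add: h_def)
      qed
      then show ?thesis using integral_unique[OF I] integral_unique[OF hI] by simp
    qed
    then show ?thesis by (simp add: algebra_simps)
  qed
  have "(D has_derivative (\<lambda>h. 0)) (at x within {a..b})" if x: "x \<in> {a..b}" for x
    unfolding has_derivative_within_alt
  proof (intro conjI allI impI)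
    fix e :: real assume e: "e > 0"
    define e1 where "e1 = e / (2 * G + 1)"
    have e1: "e1 > 0" using e G by (simp add: e1_def)
    obtain d where d: "d > 0" "\<And>y. y \<in> {a..b} \<Longrightarrow> dist y x < d \<Longrightarrow> dist (H y) (H x) < e1"
      using cH x e1 unfolding continuous_on_iff by metis
    have "norm (D y - D x) \<le> e * norm (y - x)" if y: "y \<in> {a..b}" "norm (y - x) < d" for y
    proof -
      have "norm (D y - D x) \<le> 2 * G * \<bar>y - x\<bar> * \<bar>H y - H x\<bar>"
      proof (cases "x \<le> y")
        case True
        then show ?thesis using inc[of x y] Hmono[of x y] x y by simp
      next
        case False
        then show ?thesis using inc[of y x] Hmono[of y x] x y by (simp add: norm_minus_commute abs_minus_commute)
      qed
      also have "\<dots> \<le> 2 * G * \<bar>y - x\<bar> * e1"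
        using d(2)[of y] y G by (intro mult_left_mono) (auto simp: dist_real_def)
      also have "\<dots> = (2 * G * e1) * \<bar>y - x\<bar>" by simp
      also have "\<dots> \<le> e * \<bar>y - x\<bar>"
      proof (rule mult_right_mono)
        show "2 * G * e1 \<le> e" using e G by (simp add: e1_def field_simps)
      qed simp
      finally show ?thesis by simp
    qed
    then show "\<exists>d>0. \<forall>y\<in>{a..b}. norm (y - x) < d \<longrightarrow> norm (D y - D x - 0) \<le> e * norm (y - x)"
      using d(1) by auto
  qed simp
  then obtain c where "\<And>x. x \<in> {a..b} \<Longrightarrow> D x = c"
    using has_derivative_zero_constant[of "{a..b}" D] by auto
  then have "D b = D a" using ab by simp
  then have "integral {a..b} k = p b * g b - p a * g a" by (simp add: D_def algebra_simps)
  then show ?thesis using k by (simp add: k_def[abs_def] has_integral_iff)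
qed

text \<open>Integrating \<open>p g\<close> and \<open>h y\<close> by parts, with \<open>g\<close>
  and then \<open>y\<close> as the continuously differentiable factor, produces the same mixed term
  \<open>p h\<close>, which cancels in the difference.\<close>

lemma green_identity:
  fixes y p r g h s :: "real \<Rightarrow> complex"
  assumes ab: "a \<le> b" and y: "primitive_on a b p y" and p: "primitive_on a b r p" and r: "r absolutely_integrable_on {a..b}"
    and g: "primitive_on a b h g" and h: "primitive_on a b s h" and s: "s absolutely_integrable_on {a..b}"
  shows "((\<lambda>x. r x * g x - y x * s x) has_integral ((p b * g b - y b * h b) - (p a * g a - y a * h a))) {a..b}"
proof -
  have cp: "continuous_on {a..b} p" and ch: "continuous_on {a..b} h"
    by (rule primitive_on_continuous[OF p], rule primitive_on_continuous[OF h])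
  have "((\<lambda>x. r x * g x + p x * h x) has_integral (p b * g b - p a * g a)) {a..b}"
    by (rule primitive_on_times_C1[OF ab p r primitive_on_has_vector_derivative[OF g ch] ch])
  moreover have "((\<lambda>x. s x * y x + h x * p x) has_integral (h b * y b - h a * y a)) {a..b}"
    by (rule primitive_on_times_C1[OF ab h s primitive_on_has_vector_derivative[OF y cp] cp])
  ultimately have "((\<lambda>x. (r x * g x + p x * h x) - (s x * y x + h x * p x)) has_integral
      ((p b * g b - p a * g a) - (h b * y b - h a * y a))) {a..b}"
    by (rule has_integral_diff)
  then show ?thesis by (simp add: algebra_simps)
qed

section \<open>Initial value problems in integral form\<close>

text \<open>The system y' = p, p' = w y + f in integral form. The source \<open>f\<close> is carried
  along because differences of solutions for two spectral parameters, and their derivative in the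
  parameter, solve inhomogeneous equations with the same \<open>w\<close>.\<close>

definition sl_solution ::
  "real \<Rightarrow> real \<Rightarrow> (real \<Rightarrow> complex) \<Rightarrow> (real \<Rightarrow> complex) \<Rightarrow> (real \<Rightarrow> complex) \<Rightarrow> (real \<Rightarrow> complex) \<Rightarrow> bool" where
  "sl_solution a b w f y p \<longleftrightarrow> primitive_on a b p y \<and> primitive_on a b (\<lambda>x. w x * y x + f x) p"

lemma primitive_on_diff:
  "primitive_on a b r p \<Longrightarrow> primitive_on a b s g \<Longrightarrow> primitive_on a b (\<lambda>x. r x - s x) (\<lambda>x. p x - g x)"
  unfolding primitive_on_def
proof (intro allI impI)
  fix x y
  assume h: "\<forall>x y. a \<le> x \<longrightarrow> x \<le> y \<longrightarrow> y \<le> b \<longrightarrow> (r has_integral p y - p x) {x..y}"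
    "\<forall>x y. a \<le> x \<longrightarrow> x \<le> y \<longrightarrow> y \<le> b \<longrightarrow> (s has_integral g y - g x) {x..y}"
    and xy: "a \<le> x" "x \<le> y" "y \<le> b"
  have "((\<lambda>x. r x - s x) has_integral (p y - p x) - (g y - g x)) {x..y}"
    using h xy by (intro has_integral_diff) blast+
  then show "((\<lambda>x. r x - s x) has_integral p y - g y - (p x - g x)) {x..y}" by (simp add: algebra_simps)
qed

lemma primitive_on_cmult:
  "primitive_on a b r p \<Longrightarrow> primitive_on a b (\<lambda>x. c * r x) (\<lambda>x. c * p x)"
  unfolding primitive_on_def
proof (intro allI impI)
  fix x y
  assume h: "\<forall>x y. a \<le> x \<longrightarrow> x \<le> y \<longrightarrow> y \<le> b \<longrightarrow> (r has_integral p y - p x) {x..y}"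
    and xy: "a \<le> x" "x \<le> y" "y \<le> b"
  have "((\<lambda>x. c * r x) has_integral c * (p y - p x)) {x..y}"
    using h xy by (intro has_integral_mult_right) blast
  then show "((\<lambda>x. c * r x) has_integral c * p y - c * p x) {x..y}" by (simp add: algebra_simps)
qed

lemma sl_solution_cmult:
  assumes "sl_solution a b w f y p"
  shows "sl_solution a b w (\<lambda>x. c * f x) (\<lambda>x. c * y x) (\<lambda>x. c * p x)"
proof -
  have "primitive_on a b (\<lambda>x. c * (w x * y x + f x)) (\<lambda>x. c * p x)"
    using assms primitive_on_cmult by (simp add: sl_solution_def)
  moreover have "(\<lambda>x. c * (w x * y x + f x)) = (\<lambda>x. w x * (c * y x) + c * f x)"
    by (simp add: algebra_simps)
  ultimately show ?thesis using assms primitive_on_cmult by (simp add: sl_solution_def)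
qed

lemma sl_solution_diff:
  assumes "sl_solution a b w f y p" "sl_solution a b w g u v"
  shows "sl_solution a b w (\<lambda>x. f x - g x) (\<lambda>x. y x - u x) (\<lambda>x. p x - v x)"
proof -
  have "primitive_on a b (\<lambda>x. (w x * y x + f x) - (w x * u x + g x)) (\<lambda>x. p x - v x)"
    using assms by (intro primitive_on_diff) (simp_all add: sl_solution_def)
  moreover have "(\<lambda>x. (w x * y x + f x) - (w x * u x + g x)) = (\<lambda>x. w x * (y x - u x) + (f x - g x))"
    by (simp add: algebra_simps)
  ultimately show ?thesis using assms primitive_on_diff by (simp add: sl_solution_def)
qed

section \<open>Volterra estimates, existence and uniqueness\<close>

lemma has_integral_exp_weight:
  fixes k :: real
  assumes "k > 0" "x \<le> b"
  shows "((\<lambda>t. exp (k * (b - t))) has_integral (exp (k * (b - x)) - 1) / k) {x..b}"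
proof -
  have "((\<lambda>t. - exp (k * (b - t)) / k) has_vector_derivative exp (k * (b - t))) (at t within {x..b})" for t
    using assms(1) by (auto intro!: derivative_eq_intros simp flip: has_real_derivative_iff_has_vector_derivative)
  from fundamental_theorem_of_calculus[OF assms(2) this]
  have "((\<lambda>t. exp (k * (b - t))) has_integral (- exp (k * (b - b)) / k - - exp (k * (b - x)) / k)) {x..b}" .
  then show ?thesis by (simp add: diff_divide_distrib)
qed

text \<open>In the norm with weight \<open>exp (-k (b - x))\<close> the Volterra operator \<open>y \<mapsto> u\<close> has norm at most \<open>1/2\<close>.\<close>
lemma volterra_weighted_bound:
  fixes w f y u p :: "real \<Rightarrow> complex"
  assumes w: "w absolutely_integrable_on {a..b}" and W: "integral {a..b} (\<lambda>x. norm (w x)) = W"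
    and k: "k = 2 * W + 1"
    and u: "primitive_on a b p u" and p: "primitive_on a b (\<lambda>x. w x * y x + f x) p"
    and y: "\<And>x. x \<in> {a..b} \<Longrightarrow> norm (y x) \<le> N * exp (k * (b - x))"
    and f: "\<And>x. x \<in> {a..b} \<Longrightarrow> norm (f x) \<le> \<phi>" and N: "N \<ge> 0" and \<phi>: "\<phi> \<ge> 0" and x: "x \<in> {a..b}"
  shows "norm (p x) \<le> norm (p b) + \<phi> * (b - a) + N * W * exp (k * (b - x))" (is ?p)
    and "norm (u x) \<le> norm (u b) + (b - a) * (norm (p b) + \<phi> * (b - a)) + N / 2 * exp (k * (b - x))" (is ?u)
proof -
  have nw: "(\<lambda>x. norm (w x)) integrable_on {a..b}" using w absolutely_integrable_on_def by blast
  have W0: "W \<ge> 0" unfolding W[symmetric] by (rule integral_nonneg[OF nw]) simp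
  have k0: "k > 0" using k W0 by simp
  have pb: "norm (p x) \<le> norm (p b) + \<phi> * (b - a) + N * W * exp (k * (b - x))" if x: "x \<in> {a..b}" for x
  proof -
    have xb: "a \<le> x" "x \<le> b" "b \<le> b" using x by auto
    have nwx: "(\<lambda>x. norm (w x)) integrable_on {x..b}"
      by (rule integrable_on_subinterval[OF nw]) (use xb in auto)
    have I: "((\<lambda>x. w x * y x + f x) has_integral p b - p x) {x..b}" by (rule primitive_onD[OF p xb])
    define h where "h t = norm (w t) * (N * exp (k * (b - x))) + \<phi>" for t
    have hI: "(h has_integral integral {x..b} (\<lambda>x. norm (w x)) * (N * exp (k * (b - x))) + (b - x) * \<phi>) {x..b}"
    proof -
      have "((\<lambda>t. \<phi>) has_integral (b - x) * \<phi>) {x..b}" using has_integral_const_real[of \<phi> x b] xb by simp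
      then show ?thesis unfolding h_def
        by (intro has_integral_add has_integral_mult_left integrable_integral nwx)
    qed
    have "norm (integral {x..b} (\<lambda>x. w x * y x + f x)) \<le> integral {x..b} h"
    proof (rule integral_norm_bound_integral[OF has_integral_integrable[OF I] has_integral_integrable[OF hI]])
      fix t assume t: "t \<in> {x..b}"
      then have t': "t \<in> {a..b}" using xb by auto
      have "norm (w t * y t + f t) \<le> norm (w t) * norm (y t) + norm (f t)"
        using norm_triangle_ineq[of "w t * y t" "f t"] by (simp add: norm_mult)
      also have "\<dots> \<le> norm (w t) * (N * exp (k * (b - x))) + \<phi>"
      proof (intro add_mono mult_left_mono f[OF t'])
        have "exp (k * (b - t)) \<le> exp (k * (b - x))" using t k0 by simp
        then have "N * exp (k * (b - t)) \<le> N * exp (k * (b - x))" using N by (rule mult_left_mono)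
        then show "norm (y t) \<le> N * exp (k * (b - x))" using y[OF t'] by linarith
      qed simp
      finally show "norm (w t * y t + f t) \<le> h t" by (simp add: h_def)
    qed
    then have "norm (p b - p x) \<le> integral {x..b} (\<lambda>x. norm (w x)) * (N * exp (k * (b - x))) + (b - x) * \<phi>"
      using integral_unique[OF I] integral_unique[OF hI] by simp
    also have "\<dots> \<le> W * (N * exp (k * (b - x))) + (b - a) * \<phi>"
    proof (intro add_mono mult_right_mono \<phi>)
      show "integral {x..b} (\<lambda>x. norm (w x)) \<le> W" unfolding W[symmetric]
        by (rule integral_subset_le[OF _ nwx nw]) (use xb in auto)
    qed (use N xb in auto)
    finally have "norm (p b - p x) \<le> W * (N * exp (k * (b - x))) + (b - a) * \<phi>" .
    moreover have "norm (p x) \<le> norm (p b) + norm (p b - p x)" by norm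
    ultimately show ?thesis by (simp add: algebra_simps)
  qed
  show ?p by (rule pb[OF x])
  define A where "A = norm (p b) + \<phi> * (b - a)"
  have A0: "A \<ge> 0" using x \<phi> by (simp add: A_def)
  have xb: "a \<le> x" "x \<le> b" "b \<le> b" using x by auto
  have I: "(p has_integral u b - u x) {x..b}" by (rule primitive_onD[OF u xb])
  define h where "h t = A + N * W * exp (k * (b - t))" for t
  have hI: "(h has_integral (b - x) * A + N * W * ((exp (k * (b - x)) - 1) / k)) {x..b}"
  proof -
    have "((\<lambda>t. A) has_integral (b - x) * A) {x..b}" using has_integral_const_real[of A x b] xb by simp
    then show ?thesis unfolding h_def
      by (intro has_integral_add has_integral_mult_right has_integral_exp_weight k0 xb)
  qed
  have "norm (integral {x..b} p) \<le> integral {x..b} h"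
    by (rule integral_norm_bound_integral[OF has_integral_integrable[OF I] has_integral_integrable[OF hI]])
      (use pb xb in \<open>auto simp: h_def A_def\<close>)
  then have "norm (u b - u x) \<le> (b - x) * A + N * W * ((exp (k * (b - x)) - 1) / k)"
    using integral_unique[OF I] integral_unique[OF hI] by simp
  also have "\<dots> \<le> (b - a) * A + N / 2 * exp (k * (b - x))"
  proof (rule add_mono)
    show "(b - x) * A \<le> (b - a) * A" using xb A0 by (intro mult_right_mono) auto
    \<comment> \<open>Integrating the exponential weight gains the factor 1 / k, and
      \<open>k = 2 * W + 1\<close> makes its product with \<open>W\<close> at most 1/2.\<close>
    have "W / k \<le> 1 / 2" using k k0 W0 by (simp add: field_simps)
    then have "W / k * (exp (k * (b - x)) - 1) \<le> 1 / 2 * exp (k * (b - x))"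
      using k0 xb by (intro mult_mono) auto
    then have "N * (W / k * (exp (k * (b - x)) - 1)) \<le> N * (1 / 2 * exp (k * (b - x)))"
      using N by (rule mult_left_mono)
    then show "N * W * ((exp (k * (b - x)) - 1) / k) \<le> N / 2 * exp (k * (b - x))" by simp
  qed
  finally have "norm (u b - u x) \<le> (b - a) * A + N / 2 * exp (k * (b - x))" .
  moreover have "norm (u x) \<le> norm (u b) + norm (u b - u x)" by norm
  ultimately show ?u by (simp add: A_def)
qed

text \<open>It depends only on \<open>w\<close> and the interval, hence serves all sources and
  initial data. The exponential undoes the weight, the factor 2 comes from absorbing half of the
  weighted maximum, and \<open>1 + W\<close> covers \<open>y\<close> and \<open>p\<close>
  together.\<close>

definition volterra_constant :: "real \<Rightarrow> real \<Rightarrow> (real \<Rightarrow> complex) \<Rightarrow> real" where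
  "volterra_constant a b w = (let W = integral {a..b} (\<lambda>x. norm (w x)); L = b - a in
     (1 + L) + 2 * (1 + L + L * L) * exp ((2 * W + 1) * L) * (1 + W))"

text \<open>Let D be the size of the data. By the contraction estimate the weighted maximum N of |y|
  satisfies N <= A D + N / 2, so it is at most 2 A D; inserting this into the estimate for
  \<open>p\<close> bounds the second component.\<close>

lemma sl_solution_bound:
  assumes ab: "a \<le> b" and w: "w absolutely_integrable_on {a..b}"
  shows "volterra_constant a b w \<ge> 0"
    and "sl_solution a b w f y p \<Longrightarrow> (\<And>x. x \<in> {a..b} \<Longrightarrow> norm (f x) \<le> \<phi>) \<Longrightarrow> \<phi> \<ge> 0 \<Longrightarrow> x \<in> {a..b} \<Longrightarrow>
       norm (y x) \<le> volterra_constant a b w * (norm (y b) + norm (p b) + \<phi>) \<and>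
       norm (p x) \<le> volterra_constant a b w * (norm (y b) + norm (p b) + \<phi>)"
proof -
  define W where "W = integral {a..b} (\<lambda>x. norm (w x))"
  define k where "k = 2 * W + 1"
  define L where "L = b - a"
  define E where "E = exp (k * L)"
  have W0: "W \<ge> 0" unfolding W_def using w absolutely_integrable_on_def by (intro integral_nonneg) auto
  have L0: "L \<ge> 0" using ab by (simp add: L_def)
  have k0: "k > 0" using W0 by (simp add: k_def)
  have E1: "E \<ge> 1" using k0 L0 by (simp add: E_def)
  define A where "A = 1 + L + L * L"
  have A1: "A \<ge> 1" "A \<ge> 0" using L0 by (auto simp: A_def)
  define K where "K = (1 + L) + 2 * A * E * (1 + W)"
  have KK: "volterra_constant a b w = K"
    by (simp add: volterra_constant_def Let_def K_def A_def E_def k_def W_def L_def)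
  show "volterra_constant a b w \<ge> 0" unfolding KK using L0 A1 E1 W0 by (simp add: K_def)
  assume sol: "sl_solution a b w f y p" and f: "\<And>x. x \<in> {a..b} \<Longrightarrow> norm (f x) \<le> \<phi>"
    and \<phi>: "\<phi> \<ge> 0" and x: "x \<in> {a..b}"
  define D where "D = norm (y b) + norm (p b) + \<phi>"
  have D0: "D \<ge> 0" using \<phi> by (simp add: D_def)
  have u: "primitive_on a b p y" and p: "primitive_on a b (\<lambda>x. w x * y x + f x) p"
    using sol by (auto simp: sl_solution_def)
  have cy: "continuous_on {a..b} y" by (rule primitive_on_continuous[OF u])
  have "continuous_on {a..b} (\<lambda>x. exp (- k * (b - x)) * norm (y x))" by (intro continuous_intros cy)
  then obtain x0 where x0: "x0 \<in> {a..b}"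
    "\<And>x. x \<in> {a..b} \<Longrightarrow> exp (- k * (b - x)) * norm (y x) \<le> exp (- k * (b - x0)) * norm (y x0)"
    using continuous_attains_sup[of "{a..b}" "\<lambda>x. exp (- k * (b - x)) * norm (y x)"] ab by auto
  have ee: "exp (k * s) * exp (- k * s) = 1" for s by (simp flip: exp_add)
  define N where "N = exp (- k * (b - x0)) * norm (y x0)"
  have N0: "N \<ge> 0" by (simp add: N_def)
  have yN: "norm (y t) \<le> N * exp (k * (b - t))" if "t \<in> {a..b}" for t
  proof -
    have "norm (y t) = exp (k * (b - t)) * (exp (- k * (b - t)) * norm (y t))"
      using ee[of "b - t"] by (metis mult.assoc mult_1)
    also have "\<dots> \<le> exp (k * (b - t)) * N"
      unfolding N_def by (intro mult_left_mono x0(2)[OF that]) simp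
    finally show ?thesis by (simp only: mult.commute)
  qed
  have B1: "norm (p x) \<le> norm (p b) + \<phi> * (b - a) + N * W * exp (k * (b - x))" if "x \<in> {a..b}" for x
    by (rule volterra_weighted_bound(1)[OF w W_def[symmetric] k_def u p yN f N0 \<phi> that])
  have B2: "norm (y x) \<le> norm (y b) + (b - a) * (norm (p b) + \<phi> * (b - a)) + N / 2 * exp (k * (b - x))"
    if "x \<in> {a..b}" for x
    by (rule volterra_weighted_bound(2)[OF w W_def[symmetric] k_def u p yN f N0 \<phi> that])
  have "norm (y x0) \<le> norm (y b) + L * (norm (p b) + \<phi> * L) + N / 2 * exp (k * (b - x0))"
    using B2[OF x0(1)] by (simp add: L_def)
  also have "norm (y b) + L * (norm (p b) + \<phi> * L) \<le> A * D"
  proof -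
    have "norm (y b) \<le> D" "norm (p b) \<le> D" "\<phi> \<le> D" using \<phi> by (auto simp: D_def)
    then have "L * (norm (p b) + \<phi> * L) \<le> L * (D + D * L)"
      using L0 by (intro mult_left_mono add_mono mult_right_mono) auto
    then show ?thesis using \<open>norm (y b) \<le> D\<close> by (simp add: A_def algebra_simps)
  qed
  finally have "N \<le> exp (- k * (b - x0)) * (A * D + N / 2 * exp (k * (b - x0)))"
    by (simp add: N_def)
  also have "\<dots> = exp (- k * (b - x0)) * (A * D) + N / 2 * (exp (k * (b - x0)) * exp (- k * (b - x0)))"
    by (simp only: distrib_left mult_ac)
  also have "\<dots> = exp (- k * (b - x0)) * (A * D) + N / 2" by (simp only: ee mult_1_right)
  also have "exp (- k * (b - x0)) * (A * D) \<le> 1 * (A * D)"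
  proof (rule mult_right_mono)
    have "- k * (b - x0) \<le> 0" using k0 x0(1) by (intro mult_nonpos_nonneg) auto
    then show "exp (- k * (b - x0)) \<le> 1" by simp
  qed (use A1 D0 in auto)
  finally have N2: "N \<le> 2 * (A * D)" by simp
  have Ex: "exp (k * (b - x)) \<le> E" using k0 x by (simp add: E_def L_def)
  have NE: "N * exp (k * (b - x)) \<le> 2 * (A * D) * E"
    using N2 Ex N0 A1 D0 by (intro mult_mono) auto
  have y1: "norm (y x) \<le> 2 * A * E * D" using yN[OF x] NE by (simp add: mult_ac)
  have LD: "norm (p b) + \<phi> * L \<le> (1 + L) * D"
  proof -
    have "\<phi> * L \<le> D * L" using L0 by (intro mult_right_mono) (auto simp: D_def)
    moreover have "norm (p b) \<le> D" using \<phi> by (simp add: D_def)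
    ultimately show ?thesis by (simp add: algebra_simps)
  qed
  have "N * W * exp (k * (b - x)) \<le> W * (2 * (A * D) * E)"
    using mult_left_mono[OF NE W0] by (simp add: mult_ac)
  then have p1: "norm (p x) \<le> (1 + L) * D + W * (2 * A * E * D)"
    using B1[OF x] LD by (simp add: L_def mult_ac)
  have T0: "0 \<le> 2 * A * E * D" "0 \<le> (1 + L) * D" using A1 E1 D0 L0 by auto
  then have T1: "0 \<le> W * (2 * A * E * D)" using W0 by simp
  have KD: "K * D = (1 + L) * D + 2 * A * E * D + W * (2 * A * E * D)" by (simp add: K_def algebra_simps)
  show "norm (y x) \<le> volterra_constant a b w * (norm (y b) + norm (p b) + \<phi>) \<and>
      norm (p x) \<le> volterra_constant a b w * (norm (y b) + norm (p b) + \<phi>)"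
    unfolding KK D_def[symmetric] KD using y1 p1 T0 T1 by linarith
qed

text \<open>A Banach fixed point in the bounded continuous functions. The unknown is the solution
  divided by the exponential weight, so that the plain supremum distance is the weighted
  one.\<close>

lemma sl_solution_exists:
  fixes w f :: "real \<Rightarrow> complex"
  assumes ab: "a \<le> b" and w: "w absolutely_integrable_on {a..b}" and f: "continuous_on {a..b} f"
  obtains y p where "sl_solution a b w f y p" "y b = y0" "p b = p0"
proof -
  define W where "W = integral {a..b} (\<lambda>x. norm (w x))"
  define k where "k = 2 * W + 1"
  have W0: "W \<ge> 0" unfolding W_def using w absolutely_integrable_on_def by (intro integral_nonneg) auto
  have k0: "k > 0" using W0 by (simp add: k_def)
  \<comment> \<open>Clamping to \<open>{a..b}\<close> extends functions to the whole line, on which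
    the space of bounded continuous functions lives.\<close>
  define c where "c t = max a (min b t)" for t :: real
  have c: "c t \<in> {a..b}" for t using ab by (simp add: c_def)
  have c_id: "c t = t" if "t \<in> {a..b}" for t using that by (simp add: c_def)
  have contc: "continuous_on UNIV c" unfolding c_def by (intro continuous_intros)
  define y where "y v t = exp (k * (b - t)) *\<^sub>R apply_bcontfun v t" for v :: "real \<Rightarrow>\<^sub>C complex" and t
  define P where "P v x = p0 - integral {x..b} (\<lambda>t. w t * y v t + f t)" for v x
  define T where "T v x = y0 - integral {x..b} (P v)" for v x
  define \<Phi> where "\<Phi> v = Bcontfun (\<lambda>t. exp (- k * (b - c t)) *\<^sub>R T v (c t))" for v
  have conty: "continuous_on {a..b} (y v)" for v unfolding y_def by (intro continuous_intros) simp
  have intr: "(\<lambda>t. w t * y v t + f t) integrable_on {a..b}" for v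
    using absolutely_integrable_times_continuous[OF w conty] set_lebesgue_integral_eq_integral(1) integrable_continuous_real[OF f]
    by (intro integrable_add) blast+
  have P: "primitive_on a b (\<lambda>t. w t * y v t + f t) (P v)" for v
    unfolding P_def by (rule primitive_on_integral[OF intr])
  have T: "primitive_on a b (P v) (T v)" for v
    unfolding T_def by (rule primitive_on_integral[OF integrable_continuous_real[OF primitive_on_continuous[OF P]]])
  have apply\<Phi>: "apply_bcontfun (\<Phi> v) = (\<lambda>t. exp (- k * (b - c t)) *\<^sub>R T v (c t))" for v
  proof -
    have cont: "continuous_on {a..b} (\<lambda>t. exp (- k * (b - t)) *\<^sub>R T v t)"
      by (intro continuous_intros primitive_on_continuous[OF T])
    have "continuous_on UNIV ((\<lambda>t. exp (- k * (b - t)) *\<^sub>R T v t) \<circ> c)"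
      by (rule continuous_on_compose[OF contc continuous_on_subset[OF cont]]) (use c in auto)
    moreover have "bounded ((\<lambda>t. exp (- k * (b - t)) *\<^sub>R T v t) ` {a..b})"
      by (rule compact_imp_bounded[OF compact_continuous_image[OF cont compact_Icc]])
    then have "bounded (range ((\<lambda>t. exp (- k * (b - t)) *\<^sub>R T v t) \<circ> c))"
      by (rule bounded_subset) (use c in auto)
    ultimately show ?thesis unfolding \<Phi>_def
      by (subst Bcontfun_inverse) (simp_all add: bcontfun_def comp_def)
  qed
  have "dist (\<Phi> u) (\<Phi> v) \<le> 1 / 2 * dist u v" for u v
  proof (rule dist_bound)
    fix t
    define x where "x = c t"
    have x: "x \<in> {a..b}" using c by (simp add: x_def)
    have d: "norm (y u s - y v s) \<le> dist u v * exp (k * (b - s))" for s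
      using dist_bounded[of u s v] by (simp add: y_def dist_norm mult.commute flip: scaleR_diff_right)
    have "primitive_on a b (\<lambda>t. (w t * y u t + f t) - (w t * y v t + f t)) (\<lambda>x. P u x - P v x)"
      by (intro primitive_on_diff P)
    then have PP: "primitive_on a b (\<lambda>t. w t * (y u t - y v t) + 0) (\<lambda>x. P u x - P v x)"
      by (simp add: algebra_simps)
    have ends: "T u b = y0" "T v b = y0" "P u b = p0" "P v b = p0" by (simp_all add: T_def P_def)
    have "norm (T u x - T v x) \<le> norm (T u b - T v b) + (b - a) * (norm (P u b - P v b) + 0 * (b - a)) + dist u v / 2 * exp (k * (b - x))"
      by (rule volterra_weighted_bound(2)[OF w W_def[symmetric] k_def primitive_on_diff[OF T T] PP d]) (use x in simp_all)
    then have "norm (T u x - T v x) \<le> dist u v / 2 * exp (k * (b - x))" by (simp add: ends)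
    then have "exp (- k * (b - x)) * norm (T u x - T v x) \<le> exp (- k * (b - x)) * (dist u v / 2 * exp (k * (b - x)))"
      by (intro mult_left_mono) auto
    also have "\<dots> = dist u v / 2 * (exp (- k * (b - x)) * exp (k * (b - x)))" by (simp only: mult_ac)
    also have "exp (- k * (b - x)) * exp (k * (b - x)) = 1" by (simp flip: exp_add)
    finally show "dist (apply_bcontfun (\<Phi> u) t) (apply_bcontfun (\<Phi> v) t) \<le> 1 / 2 * dist u v"
      by (simp add: apply\<Phi> dist_norm x_def flip: scaleR_diff_right)
  qed
  then obtain v where v: "\<Phi> v = v" using banach_fix_type[of "1/2" \<Phi>] by auto
  have yT: "T v t = y v t" if "t \<in> {a..b}" for t
  proof -
    have "apply_bcontfun v t = exp (- k * (b - t)) *\<^sub>R T v t"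
      using apply\<Phi>[of v] c_id[OF that] unfolding v by simp
    then have "y v t = (exp (k * (b - t)) * exp (- k * (b - t))) *\<^sub>R T v t" by (simp add: y_def)
    also have "exp (k * (b - t)) * exp (- k * (b - t)) = 1" by (simp flip: exp_add)
    finally show ?thesis by simp
  qed
  have "primitive_on a b (\<lambda>t. w t * T v t + f t) (P v)"
    by (rule primitive_on_cong[OF _ refl P[of v]]) (simp add: yT)
  then have "sl_solution a b w f (T v) (P v)" using T by (simp add: sl_solution_def)
  moreover have "T v b = y0" "P v b = p0" by (simp_all add: T_def P_def)
  ultimately show ?thesis using that by blast
qed

lemma sl_solution_unique:
  assumes ab: "a \<le> b" and w: "w absolutely_integrable_on {a..b}"
    and s: "sl_solution a b w f y p" "sl_solution a b w f u v" and eq: "y b = u b" "p b = v b" and x: "x \<in> {a..b}"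
  shows "y x = u x" "p x = v x"
proof -
  have d: "sl_solution a b w (\<lambda>x. f x - f x) (\<lambda>x. y x - u x) (\<lambda>x. p x - v x)"
    by (rule sl_solution_diff[OF s])
  have "norm (y x - u x) \<le> volterra_constant a b w * (norm (y b - u b) + norm (p b - v b) + 0) \<and>
      norm (p x - v x) \<le> volterra_constant a b w * (norm (y b - u b) + norm (p b - v b) + 0)"
    by (rule sl_solution_bound(2)[OF ab w d _ _ x]) simp_all
  then show "y x = u x" "p x = v x" using eq by auto
qed

text \<open>The change of spectral parameter becomes a source term, so the coefficient stays fixed
  at \<open>z0\<close> and one a priori constant serves all \<open>z\<close>.\<close>

lemma sl_solution_shift:
  assumes "sl_solution a b (\<lambda>x. q x - z) (\<lambda>x. 0) y p"
  shows "sl_solution a b (\<lambda>x. q x - z0) (\<lambda>x. (z0 - z) * y x) y p"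
proof -
  have "(\<lambda>x. (q x - z) * y x + 0) = (\<lambda>x. (q x - z0) * y x + (z0 - z) * y x)"
    by (simp add: algebra_simps)
  then show ?thesis using assms by (simp add: sl_solution_def)
qed

text \<open>The derivative with respect to \<open>z\<close> solves the variational equation, whose source term is \<open>-Y z0\<close>.\<close>
lemma sl_solution_has_field_derivative:
  fixes q :: "real \<Rightarrow> complex" and Y P :: "complex \<Rightarrow> real \<Rightarrow> complex"
  assumes ab: "a \<le> b" and q: "q absolutely_integrable_on {a..b}"
    and sol: "\<And>z. sl_solution a b (\<lambda>x. q x - z) (\<lambda>x. 0) (Y z) (P z)"
    and dY: "((\<lambda>z. Y z b) has_field_derivative A) (at z0)" and dP: "((\<lambda>z. P z b) has_field_derivative B) (at z0)"
  obtains y' p' where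
    "\<And>x. x \<in> {a..b} \<Longrightarrow> ((\<lambda>z. Y z x) has_field_derivative y' x) (at z0)"
    "\<And>x. x \<in> {a..b} \<Longrightarrow> ((\<lambda>z. P z x) has_field_derivative p' x) (at z0)"
proof -
  define w where "w x = q x - z0" for x
  have w: "w absolutely_integrable_on {a..b}"
    unfolding w_def by (intro set_integral_diff q absolutely_integrable_continuous_real continuous_intros)
  have contY: "continuous_on {a..b} (Y z)" for z
    using sol primitive_on_continuous unfolding sl_solution_def by blast
  define K where "K = volterra_constant a b w"
  note K0 = sl_solution_bound(1)[OF ab w, folded K_def] and K = sl_solution_bound(2)[OF ab w, folded K_def]
  have sol0: "sl_solution a b w (\<lambda>x. 0) (Y z0) (P z0)" using sol[of z0] by (simp add: w_def[abs_def])
  have solw: "sl_solution a b w (\<lambda>x. (z0 - z) * Y z x) (Y z) (P z)" for z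
    using sl_solution_shift[OF sol] by (simp add: w_def[abs_def])
  obtain N where N: "\<And>x. x \<in> {a..b} \<Longrightarrow> norm (Y z0 x) \<le> N" "N \<ge> 0"
    using compact_imp_bounded[OF compact_continuous_image[OF contY[of z0] compact_Icc]] bounded_pos
    by (metis (no_types, lifting) image_eqI order_less_imp_le)
  have "continuous_on {a..b} (\<lambda>x. - Y z0 x)" by (intro continuous_intros contY)
  then obtain y' p' where sol': "sl_solution a b w (\<lambda>x. - Y z0 x) y' p'" and yb: "y' b = A" and pb: "p' b = B"
    using sl_solution_exists[OF ab w] by metis
  define \<delta> where "\<delta> z = norm (Y z b - Y z0 b) + norm (P z b - P z0 b)" for z
  define M where "M z = 2 * K * (\<delta> z + norm (z - z0) * N)" for z
  have M0: "M z \<ge> 0" for z using K0 N(2) by (simp add: M_def \<delta>_def)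
  \<comment> \<open>The source itself contains \<open>Y z\<close>. For |z - z0| K <= 1/2 the maximum
    of the difference can be absorbed, which accounts for the factor 2 in \<open>M\<close>.\<close>
  have D: "norm (Y z x - Y z0 x) \<le> M z" if z: "norm (z - z0) * K \<le> 1 / 2" and x: "x \<in> {a..b}" for z x
  proof -
    have "continuous_on {a..b} (\<lambda>x. norm (Y z x - Y z0 x))" by (intro continuous_intros contY)
    then obtain x0 where x0: "x0 \<in> {a..b}" "\<And>x. x \<in> {a..b} \<Longrightarrow> norm (Y z x - Y z0 x) \<le> norm (Y z x0 - Y z0 x0)"
      using continuous_attains_sup[of "{a..b}" "\<lambda>x. norm (Y z x - Y z0 x)"] ab by auto
    define m where "m = norm (Y z x0 - Y z0 x0)"
    have m0: "m \<ge> 0" by (simp add: m_def)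
    have src: "norm ((z0 - z) * Y z x - 0) \<le> norm (z - z0) * (m + N)" if x: "x \<in> {a..b}" for x
    proof -
      have "norm (Y z x) \<le> norm (Y z x - Y z0 x) + norm (Y z0 x)" by norm
      also have "\<dots> \<le> m + N" using x0(2)[OF x] N(1)[OF x] by (simp add: m_def)
      finally have "norm (z - z0) * norm (Y z x) \<le> norm (z - z0) * (m + N)" by (intro mult_left_mono) auto
      then show ?thesis by (simp add: norm_mult norm_minus_commute)
    qed
    have "m \<le> K * (norm (Y z b - Y z0 b) + norm (P z b - P z0 b) + norm (z - z0) * (m + N))"
      unfolding m_def using K[OF sl_solution_diff[OF solw sol0] src _ x0(1)] m0 N(2) by (simp add: m_def)
    also have "\<dots> = K * (\<delta> z + norm (z - z0) * N) + (norm (z - z0) * K) * m"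
      by (simp add: \<delta>_def algebra_simps)
    also have "(norm (z - z0) * K) * m \<le> 1 / 2 * m" using z m0 by (intro mult_right_mono) auto
    finally have "m \<le> M z" by (simp add: M_def)
    then show ?thesis using x0(2)[OF x] by (simp add: m_def)
  qed
  \<comment> \<open>The difference quotient minus the candidate derivative solves the equation at
    \<open>z0\<close> with source \<open>-(Y z - Y z0)\<close>, of size at most \<open>M z\<close>;
    \<open>G\<close> is the resulting a priori bound.\<close>
  define G where "G z = K * (norm ((Y z b - Y z0 b) / (z - z0) - A) + norm ((P z b - P z0 b) / (z - z0) - B) + M z)" for z
  have est: "norm ((Y z x - Y z0 x) / (z - z0) - y' x) \<le> G z \<and> norm ((P z x - P z0 x) / (z - z0) - p' x) \<le> G z"
    if z: "norm (z - z0) * K \<le> 1 / 2" "z \<noteq> z0" and x: "x \<in> {a..b}" for z x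
  proof -
    have h: "z - z0 \<noteq> 0" using z by simp
    have s1: "sl_solution a b w (\<lambda>x. inverse (z - z0) * ((z0 - z) * Y z x - 0) - (- Y z0 x))
       (\<lambda>x. inverse (z - z0) * (Y z x - Y z0 x) - y' x) (\<lambda>x. inverse (z - z0) * (P z x - P z0 x) - p' x)"
      by (rule sl_solution_diff[OF sl_solution_cmult[OF sl_solution_diff[OF solw sol0]] sol'])
    have src: "norm (inverse (z - z0) * ((z0 - z) * Y z x - 0) - (- Y z0 x)) \<le> M z" if x: "x \<in> {a..b}" for x
    proof -
      have "inverse (z - z0) * (z0 - z) = - 1" using h by (simp add: field_simps)
      then have "inverse (z - z0) * ((z0 - z) * Y z x - 0) - (- Y z0 x) = - (Y z x - Y z0 x)"
        by (metis (no_types, opaque_lifting) add.commute diff_0_right diff_minus_eq_add minus_diff_eq mult.assoc mult_minus1 uminus_add_conv_diff)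
      then show ?thesis using D[OF z(1) x] by (simp only: norm_minus_cancel)
    qed
    show ?thesis
      using K[OF s1 src M0 x] by (simp add: G_def yb pb divide_inverse mult.commute)
  qed
  have limG: "(G \<longlongrightarrow> 0) (at z0)"
  proof -
    have 1: "((\<lambda>z. (Y z b - Y z0 b) / (z - z0)) \<longlongrightarrow> A) (at z0)" "((\<lambda>z. (P z b - P z0 b) / (z - z0)) \<longlongrightarrow> B) (at z0)"
      using dY dP by (simp_all add: has_field_derivative_iff)
    have 2: "((\<lambda>z. Y z b) \<longlongrightarrow> Y z0 b) (at z0)" "((\<lambda>z. P z b) \<longlongrightarrow> P z0 b) (at z0)"
      using DERIV_isCont[OF dY] DERIV_isCont[OF dP] by (simp_all add: isCont_def)
    have "(G \<longlongrightarrow> K * (norm (A - A) + norm (B - B) + 2 * K * ((norm (Y z0 b - Y z0 b) + norm (P z0 b - P z0 b)) + norm (z0 - z0) * N))) (at z0)"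
      unfolding G_def M_def \<delta>_def by (intro tendsto_intros 1 2)
    then show ?thesis by simp
  qed
  have near: "\<forall>\<^sub>F z in at z0. norm (z - z0) * K \<le> 1 / 2 \<and> z \<noteq> z0"
  proof -
    have "((\<lambda>z. norm (z - z0) * K) \<longlongrightarrow> norm (z0 - z0) * K) (at z0)" by (intro tendsto_intros)
    then have "\<forall>\<^sub>F z in at z0. norm (z - z0) * K < 1 / 2" by (intro order_tendstoD) auto
    moreover have "\<forall>\<^sub>F z in at z0. z \<noteq> z0" by (simp add: eventually_at_filter)
    ultimately show ?thesis by eventually_elim auto
  qed
  have "((\<lambda>z. Y z x) has_field_derivative y' x) (at z0)" "((\<lambda>z. P z x) has_field_derivative p' x) (at z0)" if x: "x \<in> {a..b}" for x
  proof -
    have "((\<lambda>z. (Y z x - Y z0 x) / (z - z0) - y' x) \<longlongrightarrow> 0) (at z0)"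
      by (rule Lim_null_comparison[OF _ limG]) (use near in eventually_elim, use est x in blast)
    then show "((\<lambda>z. Y z x) has_field_derivative y' x) (at z0)"
      unfolding has_field_derivative_iff by (simp add: LIM_zero_iff)
    have "((\<lambda>z. (P z x - P z0 x) / (z - z0) - p' x) \<longlongrightarrow> 0) (at z0)"
      by (rule Lim_null_comparison[OF _ limG]) (use near in eventually_elim, use est x in blast)
    then show "((\<lambda>z. P z x) has_field_derivative p' x) (at z0)"
      unfolding has_field_derivative_iff by (simp add: LIM_zero_iff)
  qed
  then show ?thesis using that by blast
qed

text \<open>The data at \<open>b\<close> may depend on \<open>z\<close>, since on the left piece
  they are produced at 0 by the solution on the right piece.\<close>

lemma sl_solution_holomorphic:
  fixes q :: "real \<Rightarrow> complex" and Y P :: "complex \<Rightarrow> real \<Rightarrow> complex"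
  assumes ab: "a \<le> b" and q: "q absolutely_integrable_on {a..b}"
    and sol: "\<And>z. sl_solution a b (\<lambda>x. q x - z) (\<lambda>x. 0) (Y z) (P z)"
    and hol: "(\<lambda>z. Y z b) holomorphic_on UNIV" "(\<lambda>z. P z b) holomorphic_on UNIV" and x: "x \<in> {a..b}"
  shows "(\<lambda>z. Y z x) holomorphic_on UNIV" "(\<lambda>z. P z x) holomorphic_on UNIV"
proof -
  have "\<exists>A B. ((\<lambda>z. Y z x) has_field_derivative A) (at z0) \<and> ((\<lambda>z. P z x) has_field_derivative B) (at z0)" for z0
    using sl_solution_has_field_derivative[OF ab q sol holomorphic_derivI[OF hol(1) open_UNIV UNIV_I] holomorphic_derivI[OF hol(2) open_UNIV UNIV_I]] x
    by metis
  then show "(\<lambda>z. Y z x) holomorphic_on UNIV" "(\<lambda>z. P z x) holomorphic_on UNIV"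
    by (metis holomorphic_on_open open_UNIV)+
qed

text \<open>Two parameters are kept for the sake of two applications: equal ones make the Wronskian
  constant, conjugate ones give the identity for imaginary parts.\<close>

lemma sl_solution_lagrange:
  assumes ab: "a \<le> b" and q: "q absolutely_integrable_on {a..b}"
    and y: "sl_solution a b (\<lambda>x. q x - z) (\<lambda>x. 0) y p" and u: "sl_solution a b (\<lambda>x. q x - \<zeta>) (\<lambda>x. 0) u v"
  shows "((\<lambda>x. (\<zeta> - z) * (y x * u x)) has_integral ((p b * u b - y b * v b) - (p a * u a - y a * v a))) {a..b}"
proof -
  have py: "primitive_on a b p y" "primitive_on a b (\<lambda>x. (q x - z) * y x) p" using y by (auto simp: sl_solution_def)
  have pu: "primitive_on a b v u" "primitive_on a b (\<lambda>x. (q x - \<zeta>) * u x) v" using u by (auto simp: sl_solution_def)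
  have cy: "continuous_on {a..b} y" and cu: "continuous_on {a..b} u" using primitive_on_continuous py pu by blast+
  have w: "(\<lambda>x. q x - c) absolutely_integrable_on {a..b}" for c
    by (intro set_integral_diff q absolutely_integrable_continuous_real continuous_intros)
  have "((\<lambda>x. ((q x - z) * y x) * u x - y x * ((q x - \<zeta>) * u x)) has_integral ((p b * u b - y b * v b) - (p a * u a - y a * v a))) {a..b}"
    by (rule green_identity[OF ab py absolutely_integrable_times_continuous[OF w cy] pu absolutely_integrable_times_continuous[OF w cu]])
  then show ?thesis by (simp add: algebra_simps)
qed

lemma primitive_on_cnj:
  assumes "primitive_on a b r p"
  shows "primitive_on a b (\<lambda>x. cnj (r x)) (\<lambda>x. cnj (p x))"
  unfolding primitive_on_def
proof (intro allI impI)
  fix x y assume "a \<le> x" "x \<le> y" "y \<le> b"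
  from has_integral_linear[OF primitive_onD[OF assms this] bounded_linear_cnj]
  show "((\<lambda>x. cnj (r x)) has_integral cnj (p y) - cnj (p x)) {x..y}" by (simp add: o_def)
qed

lemma sl_solution_cnj:
  assumes "sl_solution a b (\<lambda>x. of_real (q x) - z) (\<lambda>x. 0) y p"
  shows "sl_solution a b (\<lambda>x. of_real (q x) - cnj z) (\<lambda>x. 0) (\<lambda>x. cnj (y x)) (\<lambda>x. cnj (p x))"
  using assms primitive_on_cnj[of a b p y] primitive_on_cnj[of a b _ p] by (fastforce simp: sl_solution_def)

text \<open>As \<open>q\<close> is real, the conjugate of a solution solves the equation with
  \<open>cnj z\<close>; Lagrange's identity for this pair has only imaginary parts in its boundary
  terms.\<close>

lemma sl_solution_Im:
  assumes ab: "a \<le> b" and q: "(\<lambda>x. complex_of_real (q x)) absolutely_integrable_on {a..b}"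
    and y: "sl_solution a b (\<lambda>x. of_real (q x) - z) (\<lambda>x. 0) y p"
  shows "Im (p a * cnj (y a)) = Im (p b * cnj (y b)) + Im z * integral {a..b} (\<lambda>x. (norm (y x))\<^sup>2)"
proof -
  have I: "((\<lambda>x. (cnj z - z) * (y x * cnj (y x))) has_integral ((p b * cnj (y b) - y b * cnj (p b)) - (p a * cnj (y a) - y a * cnj (p a)))) {a..b}"
    by (rule sl_solution_lagrange[OF ab q y sl_solution_cnj[OF y]])
  have cy: "continuous_on {a..b} y" using y primitive_on_continuous unfolding sl_solution_def by blast
  have ni: "(\<lambda>x. (norm (y x))\<^sup>2) integrable_on {a..b}" by (intro integrable_continuous_real continuous_intros cy)
  have J: "((\<lambda>x. Im ((cnj z - z) * (y x * cnj (y x)))) has_integral Im ((p b * cnj (y b) - y b * cnj (p b)) - (p a * cnj (y a) - y a * cnj (p a)))) {a..b}"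
    using has_integral_linear[OF I bounded_linear_Im] by (simp add: o_def)
  have e1: "Im ((cnj z - z) * (y x * cnj (y x))) = - 2 * Im z * (norm (y x))\<^sup>2" for x
    by (simp add: complex_norm_square[symmetric] del: of_real_power)
  have e2: "Im ((p b * cnj (y b) - y b * cnj (p b)) - (p a * cnj (y a) - y a * cnj (p a)))
      = 2 * Im (p b * cnj (y b)) - 2 * Im (p a * cnj (y a))" by simp
  have "((\<lambda>x. - 2 * Im z * (norm (y x))\<^sup>2) has_integral (2 * Im (p b * cnj (y b)) - 2 * Im (p a * cnj (y a)))) {a..b}"
    using J by (simp only: e1 e2)
  moreover have "((\<lambda>x. - 2 * Im z * (norm (y x))\<^sup>2) has_integral (- 2 * Im z * integral {a..b} (\<lambda>x. (norm (y x))\<^sup>2))) {a..b}"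
    by (intro has_integral_mult_right integrable_integral ni)
  ultimately have "2 * Im (p b * cnj (y b)) - 2 * Im (p a * cnj (y a)) = - 2 * Im z * integral {a..b} (\<lambda>x. (norm (y x))\<^sup>2)"
    by (rule has_integral_unique)
  then show ?thesis by linarith
qed

section \<open>Solutions with a transfer condition\<close>

lemma abs_continuous_on_imp_continuous_on:
  fixes f :: "real \<Rightarrow> complex"
  assumes ac: "abs_continuous_on I f" and I: "is_interval I"
  shows "continuous_on I f"
  unfolding continuous_on_iff
proof (intro ballI allI impI)
  fix x e :: real assume x: "x \<in> I" and e: "e > 0"
  from ac[unfolded abs_continuous_on_def, rule_format, OF e]
  obtain d where d: "d > 0" and D: "\<forall>D. finite D \<longrightarrow> (\<forall>(u, v)\<in>D. u \<le> v \<and> {u..v} \<subseteq> I) \<longrightarrow>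
        disjoint_intervals D \<longrightarrow> (\<Sum>(u, v)\<in>D. v - u) < d \<longrightarrow> (\<Sum>(u, v)\<in>D. norm (f v - f u)) < e"
    by (elim exE conjE)
  have ord: "norm (f v - f u) < e" if "u \<in> I" "v \<in> I" "u \<le> v" "v - u < d" for u v
  proof -
    have sub: "{u..v} \<subseteq> I" using mem_is_interval_1_I[OF I that(1,2)] by auto
    have "(\<Sum>(u, v)\<in>{(u, v)}. norm (f v - f u)) < e"
      by (rule D[THEN spec, THEN mp, THEN mp, THEN mp, THEN mp]) (use sub that in simp_all)
    then show ?thesis by simp
  qed
  have "dist (f y) (f x) < e" if "y \<in> I" "dist y x < d" for y
  proof (cases "x \<le> y")
    case True
    then show ?thesis using ord[OF x that(1)] that by (simp add: dist_norm)
  next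
    case False
    then show ?thesis using ord[OF that(1) x] that by (simp add: dist_norm norm_minus_commute)
  qed
  then show "\<exists>d>0. \<forall>x'\<in>I. dist x' x < d \<longrightarrow> dist (f x') (f x) < e" using d by blast
qed

lemma abs_continuous_on_cong:
  assumes ac: "abs_continuous_on I f" and sub: "J \<subseteq> I" and eq: "\<And>x. x \<in> J \<Longrightarrow> f x = g x"
  shows "abs_continuous_on J g"
  unfolding abs_continuous_on_def
proof (intro allI impI)
  fix e :: real assume e: "e > 0"
  from ac[unfolded abs_continuous_on_def, rule_format, OF e]
  obtain d where d: "d > 0" and D: "\<forall>D. finite D \<longrightarrow> (\<forall>(u, v)\<in>D. u \<le> v \<and> {u..v} \<subseteq> I) \<longrightarrow>
        disjoint_intervals D \<longrightarrow> (\<Sum>(u, v)\<in>D. v - u) < d \<longrightarrow> (\<Sum>(u, v)\<in>D. norm (f v - f u)) < e"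
    by (elim exE conjE)
  show "\<exists>\<delta>>0. \<forall>D. finite D \<longrightarrow> (\<forall>(a, b)\<in>D. a \<le> b \<and> {a..b} \<subseteq> J) \<longrightarrow>
      disjoint_intervals D \<longrightarrow> (\<Sum>(a, b)\<in>D. b - a) < \<delta> \<longrightarrow> (\<Sum>(a, b)\<in>D. norm (g b - g a)) < e"
  proof (intro exI[of _ d] conjI allI impI d)
    fix E assume E: "finite E" "\<forall>(a, b)\<in>E. a \<le> b \<and> {a..b} \<subseteq> J" "disjoint_intervals E" "(\<Sum>(a, b)\<in>E. b - a) < d"
    have "(\<Sum>(a, b)\<in>E. norm (g b - g a)) = (\<Sum>(a, b)\<in>E. norm (f b - f a))"
    proof (rule sum.cong[OF refl], clarify)
      fix u v assume "(u, v) \<in> E"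
      then have "u \<le> v" "{u..v} \<subseteq> J" using E(2) by blast+
      then have "u \<in> J" "v \<in> J" by auto
      then show "norm (g v - g u) = norm (f v - f u)" using eq by simp
    qed
    moreover have "\<forall>(a, b)\<in>E. a \<le> b \<and> {a..b} \<subseteq> I" using E(2) sub by blast
    ultimately show "(\<Sum>(a, b)\<in>E. norm (g b - g a)) < e"
      using D[THEN spec, THEN mp, THEN mp, THEN mp, THEN mp, OF E(1) _ E(3,4)] by simp
  qed
qed

lemma continuous_on_insert_limit:
  fixes f :: "real \<Rightarrow> complex"
  assumes f: "continuous_on (A - {c}) f" and lim: "(f \<longlongrightarrow> l) (at c within A)"
  shows "continuous_on A (f(c := l))"
  unfolding continuous_on
proof
  fix x assume x: "x \<in> A"
  show "(f(c := l) \<longlongrightarrow> (f(c := l)) x) (at x within A)"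
  proof (cases "x = c")
    case True
    have "(f(c := l) \<longlongrightarrow> l) (at c within A)"
      by (rule Lim_transform_eventually[OF lim]) (simp add: eventually_at_filter)
    then show ?thesis using True by simp
  next
    case False
    have "at x within A = at x within (A - {c})"
      by (rule at_within_nhd[of x "- {c}"]) (use False in auto)
    moreover have "(f \<longlongrightarrow> f x) (at x within (A - {c}))" using f x False by (simp add: continuous_on)
    moreover have "(f(c := l) \<longlongrightarrow> f x) (at x within (A - {c}))"
      by (rule Lim_transform_eventually[OF calculation(2)]) (simp add: eventually_at_filter)
    ultimately show ?thesis using False by simp
  qed
qed

text \<open>The components are treated differently: \<open>y\<close> has derivative \<open>p\<close>
  at every interior point, whereas \<open>p\<close> is differentiable only off a null set, so
  absolute continuity must exclude a singular part. It is given on the open interval, and continuity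
  carries the formula to the end points.\<close>

lemma sl_solutionI_interior:
  fixes w y p :: "real \<Rightarrow> complex"
  assumes ab: "a < b" and w: "w absolutely_integrable_on {a..b}"
    and cy: "continuous_on {a..b} y" and cp: "continuous_on {a..b} p"
    and y: "\<And>x. x \<in> {a<..<b} \<Longrightarrow> (y has_vector_derivative p x) (at x)"
    and ac: "abs_continuous_on {a<..<b} p" and N: "negligible N"
    and p: "\<And>x. x \<in> {a<..<b} - N \<Longrightarrow> (p has_vector_derivative w x * y x) (at x)"
  shows "sl_solution a b w (\<lambda>x. 0) y p"
proof -
  have Y: "primitive_on a b p y"
    unfolding primitive_on_def
  proof (intro allI impI)
    fix u v assume uv: "a \<le> u" "u \<le> v" "v \<le> b"
    show "(p has_integral y v - y u) {u..v}"
    proof (rule fundamental_theorem_of_calculus_interior[OF uv(2)])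
      show "continuous_on {u..v} y" by (rule continuous_on_subset[OF cy]) (use uv in auto)
      show "(y has_vector_derivative p x) (at x)" if "x \<in> {u<..<v}" for x
        by (rule y) (use that uv in auto)
    qed
  qed
  define r where "r x = w x * y x" for x
  have r: "r integrable_on {a..b}"
    unfolding r_def using absolutely_integrable_times_continuous[OF w cy] set_lebesgue_integral_eq_integral(1) by blast
  define F where "F x = integral {a..x} r" for x
  have F: "primitive_on a b r F" unfolding F_def by (rule primitive_on_integral_left[OF r])
  have inc: "p v - p u = F v - F u" if uv: "a < u" "u \<le> v" "v < b" for u v
  proof -
    have "(r has_integral p v - p u) {u..v}"
    proof (rule abs_continuous_has_integral[OF ac uv(2) _ N])
      show "{u..v} \<subseteq> {a<..<b}" using uv by auto
      show "(p has_vector_derivative r x) (at x within {u..v})" if "x \<in> {u..v} - N" for x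
        unfolding r_def by (rule has_vector_derivative_at_within[OF p]) (use that uv in auto)
    qed
    moreover have "(r has_integral F v - F u) {u..v}" by (rule primitive_onD[OF F]) (use uv in auto)
    ultimately show ?thesis by (rule has_integral_unique)
  qed
  define m where "m = (a + b) / 2"
  have m: "a < m" "m < b" using ab by (auto simp: m_def)
  have const: "p x - F x = p m - F m" if "x \<in> {a<..<b}" for x
  proof (cases "x \<le> m")
    case True
    then show ?thesis using inc[of x m] that m by (simp add: algebra_simps)
  next
    case False
    then show ?thesis using inc[of m x] that m by (simp add: algebra_simps)
  qed
  have "p x - F x = p m - F m" if x: "x \<in> {a..b}" for x
  proof (rule continuous_constant_on_closure[of "{a<..<b}" "\<lambda>x. p x - F x"])
    show "continuous_on (closure {a<..<b}) (\<lambda>x. p x - F x)"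
      using ab by (simp add: closure_greaterThanLessThan) (intro continuous_intros cp primitive_on_continuous[OF F])
    show "x \<in> closure {a<..<b}" using ab x by (simp add: closure_greaterThanLessThan)
  qed (rule const)
  then have pF: "p x = F x + (p m - F m)" if "x \<in> {a..b}" for x using that by (simp add: algebra_simps)
  have "primitive_on a b r p"
    unfolding primitive_on_def
  proof (intro allI impI)
    fix u v assume uv: "a \<le> u" "u \<le> v" "v \<le> b"
    have "p v - p u = F v - F u" using pF[of u] pF[of v] uv by simp
    then show "(r has_integral p v - p u) {u..v}" using primitive_onD[OF F uv] by simp
  qed
  then show ?thesis using Y by (simp add: sl_solution_def r_def[abs_def])
qed

lemma real_L2_on_integrable:
  assumes "real_L2_on {a..b} q"
  shows "(\<lambda>x. complex_of_real (q x)) absolutely_integrable_on {a..b}" "(\<lambda>x. (q x)\<^sup>2) integrable_on {a..b}"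
proof -
  have m: "set_borel_measurable lebesgue {a..b} q" and i: "set_integrable lebesgue {a..b} (\<lambda>x. (q x)\<^sup>2)"
    using assms by (auto simp: real_L2_on_def)
  show "(\<lambda>x. (q x)\<^sup>2) integrable_on {a..b}" using i set_lebesgue_integral_eq_integral(1) by blast
  have "set_integrable lebesgue {a..b} (\<lambda>x. 1 + (q x)\<^sup>2)"
    by (intro set_integral_add i absolutely_integrable_continuous_real continuous_intros)
  then have "set_integrable lebesgue {a..b} q"
  proof (rule set_integrable_bound[OF _ m])
    have "norm (q x) \<le> norm (1 + (q x)\<^sup>2)" for x
    proof -
      have "2 * \<bar>q x\<bar> \<le> 1 + \<bar>q x\<bar>\<^sup>2" using sum_squares_bound[of 1 "\<bar>q x\<bar>"] by simp
      moreover have "0 \<le> 1 + (q x)\<^sup>2" by (rule add_nonneg_nonneg) auto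
      ultimately show ?thesis by simp
    qed
    then show "AE x in lebesgue. x \<in> {a..b} \<longrightarrow> norm (q x) \<le> norm (1 + (q x)\<^sup>2)" by simp
  qed
  from absolutely_integrable_linear[OF this bounded_linear_of_real]
  show "(\<lambda>x. complex_of_real (q x)) absolutely_integrable_on {a..b}" by (simp add: o_def)
qed

section \<open>One-sided derivatives and the two pieces\<close>

lemma at_within_interval_nontrivial:
  fixes x :: real
  assumes "x \<in> I" "is_interval I" "y \<in> I" "x \<noteq> y"
  shows "at x within I \<noteq> bot"
proof -
  have "connected I" using assms is_interval_connected by blast
  then have "x islimpt I" using connected_imp_perfect assms by (metis singletonD)
  then show ?thesis using trivial_limit_within by blast
qed

definition piece :: "real \<Rightarrow> real \<Rightarrow> real set" where
  "piece S x = (if x < 0 then {-S..<0} else {0<..S})"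

lemma piece_deriv_has_vector_derivative:
  assumes "y differentiable (at x within piece S x)"
  shows "(y has_vector_derivative piece_deriv S y x) (at x within piece S x)"
  using assms unfolding piece_deriv_def piece_def by (simp add: vector_derivative_works)

text \<open>The point \<open>x / 2\<close> lies in the same interval, so \<open>x\<close> is not
  isolated in its piece and the chosen \<open>vector_derivative\<close> is the only one
  possible.\<close>

lemma piece_deriv_eq:
  assumes "S > 0" "x \<in> {-S..S} - {0}" and d: "(y has_vector_derivative d) (at x within piece S x)"
  shows "piece_deriv S y x = d"
proof -
  have "at x within piece S x \<noteq> bot"
  proof (cases "x < 0")
    case True
    have "x / 2 \<in> piece S x" "x \<in> piece S x" using True assms by (auto simp: piece_def)
    then show ?thesis using True
      by (intro at_within_interval_nontrivial[of x _ "x/2"]) (auto simp: piece_def is_interval_1)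
  next
    case False
    have "x / 2 \<in> piece S x" "x \<in> piece S x" using False assms by (auto simp: piece_def)
    then show ?thesis using False assms
      by (intro at_within_interval_nontrivial[of x _ "x/2"]) (auto simp: piece_def is_interval_1)
  qed
  from vector_derivative_within[OF this d] show ?thesis by (simp add: piece_deriv_def piece_def)
qed

text \<open>\<open>c\<close> stands for the end of the piece at the jump, so one proof covers both
  sides. The values there are overwritten by the one-sided limits, which makes both components
  continuous on the closed interval.\<close>

lemma piece_imp_sl_solution:
  fixes w y :: "real \<Rightarrow> complex"
  assumes ab: "a < b" and w: "w absolutely_integrable_on {a..b}"
    and c: "c = a \<or> c = b" and piece: "\<And>x. x \<in> {a..b} - {c} \<Longrightarrow> piece S x = {a..b} - {c}"
    and dif: "\<And>x. x \<in> {a..b} - {c} \<Longrightarrow> y differentiable (at x within ({a..b} - {c}))"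
    and ac: "abs_continuous_on ({a..b} - {c}) (piece_deriv S y)"
    and N: "negligible N" "\<And>x. x \<in> {a<..<b} - N \<Longrightarrow> (piece_deriv S y has_vector_derivative w x * y x) (at x)"
    and lim: "(y \<longlongrightarrow> l) (at c within {a..b})" "(piece_deriv S y \<longlongrightarrow> l') (at c within {a..b})"
  shows "sl_solution a b w (\<lambda>x. 0) (y(c := l)) ((piece_deriv S y)(c := l'))"
proof -
  have I: "is_interval ({a..b} - {c})" using c by (auto simp: is_interval_1)
  have sub: "{a<..<b} \<subseteq> {a..b} - {c}" using c by auto
  have ne: "x \<noteq> c" if "x \<in> {a<..<b}" for x using that c by auto
  have open': "open ({a<..<b} :: real set)" by simp
  have cy: "continuous_on ({a..b} - {c}) y"
    using dif by (meson differentiable_imp_continuous_within continuous_on_eq_continuous_within)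
  have cp: "continuous_on ({a..b} - {c}) (piece_deriv S y)"
    by (rule abs_continuous_on_imp_continuous_on[OF ac I])
  have dy: "(y has_vector_derivative piece_deriv S y x) (at x)" if x: "x \<in> {a<..<b}" for x
  proof -
    have x': "x \<in> {a..b} - {c}" using x sub by blast
    have "(y has_vector_derivative piece_deriv S y x) (at x within ({a..b} - {c}))"
      using piece_deriv_has_vector_derivative[of y x S] dif[OF x'] piece[OF x'] by simp
    then have "(y has_vector_derivative piece_deriv S y x) (at x within {a<..<b})"
      using sub by (rule has_vector_derivative_within_subset)
    then show ?thesis by (simp only: at_within_open[OF x open'])
  qed
  show ?thesis
  proof (rule sl_solutionI_interior[OF ab w continuous_on_insert_limit[OF cy lim(1)] continuous_on_insert_limit[OF cp lim(2)] _ _ N(1)])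
    show "abs_continuous_on {a<..<b} ((piece_deriv S y)(c := l'))"
      by (rule abs_continuous_on_cong[OF ac sub]) (use ne in auto)
    fix x assume x: "x \<in> {a<..<b}"
    have "((y(c := l)) has_vector_derivative piece_deriv S y x) (at x)"
      by (rule has_vector_derivative_transform_within_open[OF dy[OF x] open' x]) (use ne in auto)
    then show "((y(c := l)) has_vector_derivative ((piece_deriv S y)(c := l')) x) (at x)" using ne[OF x] by simp
  next
    fix x assume x: "x \<in> {a<..<b} - N"
    then have x': "x \<in> {a<..<b}" by simp
    have "(((piece_deriv S y)(c := l')) has_vector_derivative w x * y x) (at x)"
      by (rule has_vector_derivative_transform_within_open[OF N(2)[OF x] open' x']) (use ne in auto)
    then show "(((piece_deriv S y)(c := l')) has_vector_derivative w x * (y(c := l)) x) (at x)" using ne[OF x'] by simp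
  qed
qed

text \<open>Square integrability of \<open>q\<close> enters in the absolute continuity of the
  derivative: its own derivative \<open>(q - z) y\<close> must have an integrable square.\<close>

lemma sl_solution_imp_piece:
  fixes q :: "real \<Rightarrow> real" and y Y P :: "real \<Rightarrow> complex"
  assumes ab: "a < b" and q2: "(\<lambda>x. (q x)\<^sup>2) integrable_on {a..b}"
    and c: "c = a \<or> c = b" and S: "S > 0" "{a..b} - {c} \<subseteq> {-S..S} - {0}"
    and piece: "\<And>x. x \<in> {a..b} - {c} \<Longrightarrow> piece S x = {a..b} - {c}"
    and sol: "sl_solution a b (\<lambda>x. of_real (q x) - z) (\<lambda>x. 0) Y P"
    and eq: "\<And>x. x \<in> {a..b} - {c} \<Longrightarrow> y x = Y x"
  shows "\<forall>x\<in>{a..b} - {c}. y differentiable (at x within ({a..b} - {c}))"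
    and "\<forall>x\<in>{a..b} - {c}. piece_deriv S y x = P x"
    and "abs_continuous_on ({a..b} - {c}) y" "abs_continuous_on ({a..b} - {c}) (piece_deriv S y)"
    and "\<exists>N. negligible N \<and> (\<forall>x\<in>{a<..<b} - N. (piece_deriv S y has_vector_derivative (of_real (q x) - z) * y x) (at x))"
proof -
  have Y: "primitive_on a b P Y" and P: "primitive_on a b (\<lambda>x. (of_real (q x) - z) * Y x) P"
    using sol by (auto simp: sl_solution_def)
  have cY: "continuous_on {a..b} Y" and cP: "continuous_on {a..b} P" using primitive_on_continuous Y P by blast+
  have sub: "{a<..<b} \<subseteq> {a..b} - {c}" using c by auto
  have dy: "(y has_vector_derivative P x) (at x within ({a..b} - {c}))" if x: "x \<in> {a..b} - {c}" for x
  proof -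
    have "(Y has_vector_derivative P x) (at x within {a..b})"
      by (rule primitive_on_has_vector_derivative[OF Y cP]) (use x in auto)
    then have "(Y has_vector_derivative P x) (at x within ({a..b} - {c}))"
      by (rule has_vector_derivative_within_subset) auto
    then show ?thesis by (rule has_vector_derivative_transform[OF x, rotated]) (simp add: eq)
  qed
  then show "\<forall>x\<in>{a..b} - {c}. y differentiable (at x within ({a..b} - {c}))"
    using differentiableI_vector by blast
  have pd: "piece_deriv S y x = P x" if x: "x \<in> {a..b} - {c}" for x
  proof (rule piece_deriv_eq[OF S(1)])
    show "x \<in> {-S..S} - {0}" using x S(2) by blast
    show "(y has_vector_derivative P x) (at x within piece S x)" using dy[OF x] piece[OF x] by simp
  qed
  then show "\<forall>x\<in>{a..b} - {c}. piece_deriv S y x = P x" by blast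
  have "abs_continuous_on ({a..b} - {c}) Y"
    by (rule primitive_on_abs_continuous[OF Y, of _ "\<lambda>x. (norm (P x))\<^sup>2"])
      (auto intro!: integrable_continuous_real continuous_intros cP)
  then show "abs_continuous_on ({a..b} - {c}) y" by (rule abs_continuous_on_cong[OF _ order_refl]) (simp add: eq)
  obtain B where B: "\<And>x. x \<in> {a..b} \<Longrightarrow> norm (Y x) \<le> B"
    using compact_imp_bounded[OF compact_continuous_image[OF cY compact_Icc]] bounded_iff by (metis image_eqI)
  define g where "g x = 2 * B\<^sup>2 * (q x)\<^sup>2 + 2 * B\<^sup>2 * (norm z)\<^sup>2" for x
  have gi: "g integrable_on {a..b}"
    unfolding g_def by (intro integrable_add integrable_on_mult_right q2 integrable_continuous_real continuous_intros)
  have "abs_continuous_on ({a..b} - {c}) P"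
  proof (rule primitive_on_abs_continuous[OF P _ gi])
    fix x assume x: "x \<in> {a..b}"
    have B0: "norm (Y x) \<le> B" "0 \<le> norm (Y x)" using B[OF x] by auto
    have "norm (of_real (q x) - z) \<le> \<bar>q x\<bar> + norm z"
      using norm_triangle_ineq4[of "of_real (q x)" z] by simp
    then have "(norm (of_real (q x) - z))\<^sup>2 \<le> (\<bar>q x\<bar> + norm z)\<^sup>2" by (intro power_mono) auto
    also have "\<dots> \<le> 2 * (q x)\<^sup>2 + 2 * (norm z)\<^sup>2"
      using sum_squares_bound[of "\<bar>q x\<bar>" "norm z"] by (simp add: power2_sum)
    finally have 1: "(norm (of_real (q x) - z))\<^sup>2 \<le> 2 * (q x)\<^sup>2 + 2 * (norm z)\<^sup>2" .
    have 2: "(norm (Y x))\<^sup>2 \<le> B\<^sup>2" using B0 by (intro power_mono) auto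
    have "(norm ((of_real (q x) - z) * Y x))\<^sup>2 = (norm (of_real (q x) - z))\<^sup>2 * (norm (Y x))\<^sup>2"
      by (simp add: norm_mult power_mult_distrib)
    also have "\<dots> \<le> (2 * (q x)\<^sup>2 + 2 * (norm z)\<^sup>2) * B\<^sup>2" by (intro mult_mono 1 2) auto
    also have "\<dots> = g x" by (simp add: g_def algebra_simps)
    finally show "(norm ((of_real (q x) - z) * Y x))\<^sup>2 \<le> g x" .
  qed auto
  then show "abs_continuous_on ({a..b} - {c}) (piece_deriv S y)"
    by (rule abs_continuous_on_cong[OF _ order_refl]) (simp add: pd)
  obtain N where N: "negligible N" "\<And>x. x \<in> {a<..<b} - N \<Longrightarrow> (P has_vector_derivative (of_real (q x) - z) * Y x) (at x)"
    using primitive_on_ae_derivative[OF P less_imp_le[OF ab]] by blast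
  have "(piece_deriv S y has_vector_derivative (of_real (q x) - z) * y x) (at x)" if x: "x \<in> {a<..<b} - N" for x
  proof -
    have x': "x \<in> {a<..<b}" "x \<in> {a..b} - {c}" using x sub by auto
    have "(piece_deriv S y has_vector_derivative (of_real (q x) - z) * Y x) (at x)"
      by (rule has_vector_derivative_transform_within_open[OF N(2)[OF x] open_greaterThanLessThan x'(1)])
        (rule pd[symmetric], use sub in blast)
    then show ?thesis using eq[OF x'(2)] by simp
  qed
  then show "\<exists>N. negligible N \<and> (\<forall>x\<in>{a<..<b} - N. (piece_deriv S y has_vector_derivative (of_real (q x) - z) * y x) (at x))"
    using N(1) by blast
qed

definition entry :: "real^2^2 \<Rightarrow> 2 \<Rightarrow> 2 \<Rightarrow> real" where
  "entry M i j = vec_nth (vec_nth M i) j"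

text \<open>Separate functions on the two closed pieces turn the one-sided limits at 0 into ordinary
  values, and the transfer condition into two scalar equations.\<close>

definition transfer_solution ::
  "real \<Rightarrow> (real \<Rightarrow> real) \<Rightarrow> real^2^2 \<Rightarrow> complex \<Rightarrow> (real \<Rightarrow> complex) \<Rightarrow> (real \<Rightarrow> complex)
     \<Rightarrow> (real \<Rightarrow> complex) \<Rightarrow> (real \<Rightarrow> complex) \<Rightarrow> bool" where
  "transfer_solution S q M z y1 p1 y2 p2 \<longleftrightarrow>
     sl_solution (-S) 0 (\<lambda>x. of_real (q x) - z) (\<lambda>x. 0) y1 p1 \<and>
     sl_solution 0 S (\<lambda>x. of_real (q x) - z) (\<lambda>x. 0) y2 p2 \<and>
     y2 0 = of_real (entry M 1 1) * y1 0 + of_real (entry M 1 2) * p1 0 \<and>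
     p2 0 = of_real (entry M 2 1) * y1 0 + of_real (entry M 2 2) * p1 0"

lemma transfer_condition_iff:
  "(vector [a, b] :: complex^2) = map_matrix complex_of_real M *v (vector [c, d] :: complex^2) \<longleftrightarrow>
     a = of_real (entry M 1 1) * c + of_real (entry M 1 2) * d \<and> b = of_real (entry M 2 1) * c + of_real (entry M 2 2) * d"
  by (simp add: vec_eq_iff forall_2 matrix_vector_mult_def sum_2 map_matrix_def entry_def)

lemma absolutely_integrable_potential:
  assumes "real_L2_on {-S..S} q" "{a..b} \<subseteq> {-S..S}"
  shows "(\<lambda>x. complex_of_real (q x)) absolutely_integrable_on {a..b}"
    "(\<lambda>x. complex_of_real (q x) - z) absolutely_integrable_on {a..b}" "(\<lambda>x. (q x)\<^sup>2) integrable_on {a..b}"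
proof -
  show 1: "(\<lambda>x. complex_of_real (q x)) absolutely_integrable_on {a..b}"
    by (rule set_integrable_subset[OF real_L2_on_integrable(1)[OF assms(1)] _ assms(2)]) simp
  show "(\<lambda>x. complex_of_real (q x) - z) absolutely_integrable_on {a..b}"
    by (intro set_integral_diff 1 absolutely_integrable_continuous_real continuous_intros)
  show "(\<lambda>x. (q x)\<^sup>2) integrable_on {a..b}"
    using real_L2_on_integrable(2)[OF assms(1)] assms(2) by (rule integrable_on_subinterval)
qed

lemma is_solution_imp_transfer_solution:
  assumes S: "S > 0" and q: "real_L2_on {-S..S} q" and y: "is_solution S q M z y"
  obtains y1 p1 y2 p2 where "transfer_solution S q M z y1 p1 y2 p2"
    "\<And>x. x \<in> {-S..<0} \<Longrightarrow> y x = y1 x \<and> piece_deriv S y x = p1 x"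
    "\<And>x. x \<in> {0<..S} \<Longrightarrow> y x = y2 x \<and> piece_deriv S y x = p2 x"
proof -
  have sets: "{-S..0} - {0} = {-S..<0}" "{0..S} - {0} = {0<..S}" using S by auto
  obtain ym y'm yp y'p where lims: "(y \<longlongrightarrow> ym) (at_left 0)" "(piece_deriv S y \<longlongrightarrow> y'm) (at_left 0)"
      "(y \<longlongrightarrow> yp) (at_right 0)" "(piece_deriv S y \<longlongrightarrow> y'p) (at_right 0)"
    and tc: "vector [yp, y'p] = map_matrix complex_of_real M *v (vector [ym, y'm] :: complex^2)"
    using y unfolding is_solution_def by blast
  have atl: "at 0 within {-S..0} = at_left 0" using S by (intro at_within_Icc_at_left) simp
  have atr: "at 0 within {0..S} = at_right 0" using S by (intro at_within_Icc_at_right) simp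
  have "AE x in lebesgue. x \<in> {-S..S} - {0} \<longrightarrow>
        (\<exists>y2. (piece_deriv S y has_vector_derivative y2) (at x) \<and> - y2 + of_real (q x) * y x = z * y x)"
    using y unfolding is_solution_def by blast
  then obtain N where N: "N \<in> null_sets lebesgue"
    "{x. \<not> (x \<in> {-S..S} - {0} \<longrightarrow> (\<exists>y2. (piece_deriv S y has_vector_derivative y2) (at x) \<and> - y2 + of_real (q x) * y x = z * y x))} \<subseteq> N"
    unfolding eventually_ae_filter by auto
  have negN: "negligible N" using N(1) negligible_iff_null_sets by blast
  have ode: "(piece_deriv S y has_vector_derivative (of_real (q x) - z) * y x) (at x)" if x: "x \<in> {-S..S} - {0}" "x \<notin> N" for x
  proof -
    obtain y2 where y2: "(piece_deriv S y has_vector_derivative y2) (at x)" "- y2 + of_real (q x) * y x = z * y x"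
      using x N(2) by blast
    have "y2 = (of_real (q x) - z) * y x"
      using y2(2) by (simp add: algebra_simps)
    then show ?thesis using y2(1) by simp
  qed
  have L: "\<forall>x\<in>{-S..<0}. y differentiable (at x within {-S..<0})" "abs_continuous_on {-S..<0} (piece_deriv S y)"
    and R: "\<forall>x\<in>{0<..S}. y differentiable (at x within {0<..S})" "abs_continuous_on {0<..S} (piece_deriv S y)"
    using y unfolding is_solution_def by blast+
  have s1: "sl_solution (-S) 0 (\<lambda>x. of_real (q x) - z) (\<lambda>x. 0) (y(0 := ym)) ((piece_deriv S y)(0 := y'm))"
    by (rule piece_imp_sl_solution[where N = N])
      (use S L sets negN ode lims atl in \<open>auto simp: piece_def intro!: absolutely_integrable_potential[OF q]\<close>)
  have s2: "sl_solution 0 S (\<lambda>x. of_real (q x) - z) (\<lambda>x. 0) (y(0 := yp)) ((piece_deriv S y)(0 := y'p))"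
    by (rule piece_imp_sl_solution[where N = N])
      (use S R sets negN ode lims atr in \<open>auto simp: piece_def intro!: absolutely_integrable_potential[OF q]\<close>)
  have "transfer_solution S q M z (y(0 := ym)) ((piece_deriv S y)(0 := y'm)) (y(0 := yp)) ((piece_deriv S y)(0 := y'p))"
    using s1 s2 tc by (simp add: transfer_solution_def transfer_condition_iff)
  then show ?thesis by (rule that) auto
qed

lemma transfer_solution_imp_is_solution:
  assumes S: "S > 0" and q: "real_L2_on {-S..S} q" and sol: "transfer_solution S q M z y1 p1 y2 p2"
    and y: "\<And>x. y x = (if x < 0 then y1 x else y2 x)"
  shows "is_solution S q M z y"
    and "x \<in> {-S..<0} \<Longrightarrow> piece_deriv S y x = p1 x" and "x \<in> {0<..S} \<Longrightarrow> piece_deriv S y x = p2 x"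
proof -
  have sets: "{-S..0} - {0} = {-S..<0}" "{0..S} - {0} = {0<..S}" using S by auto
  have s1: "sl_solution (-S) 0 (\<lambda>x. of_real (q x) - z) (\<lambda>x. 0) y1 p1"
    and s2: "sl_solution 0 S (\<lambda>x. of_real (q x) - z) (\<lambda>x. 0) y2 p2"
    using sol by (auto simp: transfer_solution_def)
  have q1: "(\<lambda>x. (q x)\<^sup>2) integrable_on {-S..0}" and q2: "(\<lambda>x. (q x)\<^sup>2) integrable_on {0..S}"
    using absolutely_integrable_potential(3)[OF q] S by auto
  have L: "-S < 0" "0 = -S \<or> 0 = (0::real)" "{-S..0} - {0} \<subseteq> {-S..S} - {0}"
     "\<And>x. x \<in> {-S..0} - {0} \<Longrightarrow> piece S x = {-S..0} - {0}" "\<And>x. x \<in> {-S..0} - {0} \<Longrightarrow> y x = y1 x"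
    using S sets by (auto simp: piece_def y)
  have R: "0 < S" "0 = (0::real) \<or> 0 = S" "{0..S} - {0} \<subseteq> {-S..S} - {0}"
     "\<And>x. x \<in> {0..S} - {0} \<Longrightarrow> piece S x = {0..S} - {0}" "\<And>x. x \<in> {0..S} - {0} \<Longrightarrow> y x = y2 x"
    using S sets by (auto simp: piece_def y)
  note l = sl_solution_imp_piece[OF L(1) q1 L(2) S L(3,4) s1 L(5), unfolded sets]
  note r = sl_solution_imp_piece[OF R(1) q2 R(2) S R(3,4) s2 R(5), unfolded sets]
  show p1: "piece_deriv S y x = p1 x" if "x \<in> {-S..<0}" for x using l(2) that by blast
  show p2: "piece_deriv S y x = p2 x" if "x \<in> {0<..S}" for x using r(2) that by blast
  obtain N1 where N1: "negligible N1" "\<And>x. x \<in> {-S<..<0} - N1 \<Longrightarrow> (piece_deriv S y has_vector_derivative (of_real (q x) - z) * y x) (at x)"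
    using l(5) by blast
  obtain N2 where N2: "negligible N2" "\<And>x. x \<in> {0<..<S} - N2 \<Longrightarrow> (piece_deriv S y has_vector_derivative (of_real (q x) - z) * y x) (at x)"
    using r(5) by blast
  let ?ode = "\<lambda>x. x \<in> {-S..S} - {0} \<longrightarrow>
        (\<exists>y2. (piece_deriv S y has_vector_derivative y2) (at x) \<and> - y2 + of_real (q x) * y x = z * y x)"
  have ae: "AE x in lebesgue. ?ode x"
  proof (rule AE_I')
    \<comment> \<open>The end points are added because the equation asks for a two-sided derivative,
      while nothing is known beyond \<open>-S\<close> and \<open>S\<close>.\<close>
    show "N1 \<union> N2 \<union> {-S, S} \<in> null_sets lebesgue"
      by (rule negligible_iff_null_sets[THEN iffD1], rule negligible_Un[OF negligible_Un[OF N1(1) N2(1)] negligible_finite]) simp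
    show "{x \<in> space lebesgue. \<not> ?ode x} \<subseteq> N1 \<union> N2 \<union> {-S, S}"
    proof (rule subsetI, rule ccontr)
      fix x assume x: "x \<in> {x \<in> space lebesgue. \<not> ?ode x}"
        and n: "x \<notin> N1 \<union> N2 \<union> {-S, S}"
      then have "x \<in> {-S<..<0} - N1 \<or> x \<in> {0<..<S} - N2" by auto
      then have "(piece_deriv S y has_vector_derivative (of_real (q x) - z) * y x) (at x)" using N1(2) N2(2) by blast
      moreover have "- ((of_real (q x) - z) * y x) + of_real (q x) * y x = z * y x" by (simp add: algebra_simps)
      ultimately show False using x by blast
    qed
  qed
  have cont: "continuous_on {-S..0} y1" "continuous_on {-S..0} p1" "continuous_on {0..S} y2" "continuous_on {0..S} p2"
    using s1 s2 primitive_on_continuous unfolding sl_solution_def by blast+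
  have atl: "at 0 within {-S..0} = at_left 0" using S by (intro at_within_Icc_at_left) simp
  have atr: "at 0 within {0..S} = at_right 0" using S by (intro at_within_Icc_at_right) simp
  have evl: "\<forall>\<^sub>F x in at_left 0. x \<in> {-S..<0}"
    using S eventually_at_left_real[of "-S" 0] by (auto elim!: eventually_mono)
  have evr: "\<forall>\<^sub>F x in at_right 0. x \<in> {0<..S}"
    using S eventually_at_right_real[of 0 S] by (auto elim!: eventually_mono)
  have lim: "(f \<longlongrightarrow> g 0) (at 0 within A)"
    if "continuous_on A g" "0 \<in> A" "\<forall>\<^sub>F x in at 0 within A. g x = f x" for f g :: "real \<Rightarrow> complex" and A
    using that by (auto simp: continuous_on intro: Lim_transform_eventually)
  have l1: "(y \<longlongrightarrow> y1 0) (at_left 0)"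
    unfolding atl[symmetric]
    by (rule lim[OF cont(1)], use S in simp, unfold atl, use evl in eventually_elim, simp add: y)
  have l2: "(piece_deriv S y \<longlongrightarrow> p1 0) (at_left 0)"
    unfolding atl[symmetric]
    by (rule lim[OF cont(2)], use S in simp, unfold atl, use evl in eventually_elim, simp add: p1)
  have r1: "(y \<longlongrightarrow> y2 0) (at_right 0)"
    unfolding atr[symmetric]
    by (rule lim[OF cont(3)], use S in simp, unfold atr, use evr in eventually_elim, simp add: y)
  have r2: "(piece_deriv S y \<longlongrightarrow> p2 0) (at_right 0)"
    unfolding atr[symmetric]
    by (rule lim[OF cont(4)], use S in simp, unfold atr, use evr in eventually_elim, simp add: p2)
  have "vector [y2 0, p2 0] = map_matrix complex_of_real M *v (vector [y1 0, p1 0] :: complex^2)"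
    using sol by (simp add: transfer_solution_def transfer_condition_iff)
  then show "is_solution S q M z y"
    unfolding is_solution_def using ae l(1,3,4) r(1,3,4) l1 l2 r1 r2 by blast
qed

section \<open>Asymptotics along the imaginary axis\<close>

lemma primitive_onI_C1:
  assumes "\<And>x. (g has_vector_derivative g' x) (at x)"
  shows "primitive_on a b g' g"
  unfolding primitive_on_def
  by (intro allI impI, rule fundamental_theorem_of_calculus)
    (assumption, rule has_vector_derivative_at_within[OF assms])

text \<open>Green's identity against \<open>(x/S)\<^sup>2 exp (-\<kappa> (x + S))\<close>, where \<open>\<kappa>\<^sup>2 = -z\<close>: this test function and its
  derivative vanish at \<open>0\<close>, so that only the boundary values at \<open>-S\<close> remain.\<close>
lemma weyl_test_function_bound:
  fixes q :: "real \<Rightarrow> real" and y p :: "real \<Rightarrow> complex"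
  assumes S: "S > 0" and q: "(\<lambda>x. complex_of_real (q x)) absolutely_integrable_on {-S..0}"
    and sol: "sl_solution (-S) 0 (\<lambda>x. of_real (q x) - z) (\<lambda>x. 0) y p"
    and \<kappa>: "\<kappa>\<^sup>2 = - z" "Re \<kappa> \<ge> 0"
    and h: "(h has_integral I) {-S..0}"
      "\<And>x. x \<in> {-S..0} \<Longrightarrow> norm (y x) * (\<bar>q x\<bar> + 2 / S\<^sup>2 + 4 * norm \<kappa> / S) \<le> h x"
  shows "norm (p (-S) + y (-S) * (\<kappa> + 2 / of_real S)) \<le> I"
proof -
  define \<sigma> where "\<sigma> = complex_of_real S"
  have \<sigma>: "\<sigma> \<noteq> 0" using S by (simp add: \<sigma>_def)
  define E where "E x = exp (- \<kappa> * (of_real x + \<sigma>))" for x :: real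
  define a where "a = inverse (\<sigma>\<^sup>2)"
  have a: "a * \<sigma>\<^sup>2 = 1" using \<sigma> by (simp add: a_def)
  define g where "g x = a * (of_real x)\<^sup>2 * E x" for x :: real
  define g' where "g' x = (2 * a * of_real x - \<kappa> * a * (of_real x)\<^sup>2) * E x" for x :: real
  define g'' where "g'' x = (2 * a - 4 * \<kappa> * a * of_real x + \<kappa>\<^sup>2 * a * (of_real x)\<^sup>2) * E x" for x :: real
  have dg: "(g has_vector_derivative g' x) (at x)" for x
  proof -
    have "((\<lambda>x. a * x\<^sup>2 * exp (- \<kappa> * (x + \<sigma>))) has_field_derivative g' x) (at (of_real x))"
      unfolding g'_def E_def
      by (rule derivative_eq_intros refl)+ (simp add: algebra_simps power2_eq_square)
    from has_vector_derivative_real_field[OF this] show ?thesis unfolding g_def[abs_def] E_def .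
  qed
  have dg': "(g' has_vector_derivative g'' x) (at x)" for x
  proof -
    have "((\<lambda>x. (2 * a * x - \<kappa> * a * x\<^sup>2) * exp (- \<kappa> * (x + \<sigma>))) has_field_derivative g'' x) (at (of_real x))"
      unfolding g''_def E_def
      by (rule derivative_eq_intros refl)+ (simp add: algebra_simps power2_eq_square)
    from has_vector_derivative_real_field[OF this] show ?thesis unfolding g'_def[abs_def] E_def .
  qed
  have py: "primitive_on (-S) 0 p y" "primitive_on (-S) 0 (\<lambda>x. (of_real (q x) - z) * y x) p"
    using sol by (auto simp: sl_solution_def)
  have cy: "continuous_on {-S..0} y" by (rule primitive_on_continuous[OF py(1)])
  have w: "(\<lambda>x. complex_of_real (q x) - z) absolutely_integrable_on {-S..0}"
    by (intro set_integral_diff q absolutely_integrable_continuous_real continuous_intros)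
  have cg'': "g'' absolutely_integrable_on {-S..0}"
    unfolding g''_def E_def by (intro absolutely_integrable_continuous_real continuous_intros)
  have "((\<lambda>x. ((of_real (q x) - z) * y x) * g x - y x * g'' x) has_integral ((p 0 * g 0 - y 0 * g' 0) - (p (-S) * g (-S) - y (-S) * g' (-S)))) {-S..0}"
    by (rule green_identity[OF _ py absolutely_integrable_times_continuous[OF w cy] primitive_onI_C1[OF dg] primitive_onI_C1[OF dg'] cg''])
      (use S in simp)
  moreover have "g 0 = 0" "g' 0 = 0" by (simp_all add: g_def g'_def)
  moreover have "g (-S) = 1" using a by (simp add: g_def E_def flip: \<sigma>_def)
  moreover have "g' (-S) = - (\<kappa> + 2 / \<sigma>)"
  proof -
    have "g' (-S) = - (2 * (a * \<sigma>) + \<kappa> * (a * \<sigma>\<^sup>2))" by (simp add: g'_def E_def mult_ac flip: \<sigma>_def)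
    also have "a * \<sigma> = 1 / \<sigma>" using \<sigma> by (simp add: a_def power2_eq_square field_simps)
    finally show ?thesis using a by simp
  qed
  ultimately have I: "((\<lambda>x. ((of_real (q x) - z) * y x) * g x - y x * g'' x) has_integral (- (p (-S) + y (-S) * (\<kappa> + 2 / \<sigma>)))) {-S..0}"
    by (simp add: algebra_simps)
  have bound: "norm (((of_real (q x) - z) * y x) * g x - y x * g'' x) \<le> h x" if x: "x \<in> {-S..0}" for x
  proof -
    have "((of_real (q x) - z) * y x) * g x - y x * g'' x
        = y x * (E x * (of_real (q x) * (of_real x / \<sigma>)\<^sup>2 - 2 / \<sigma>\<^sup>2 + 4 * \<kappa> * (of_real x / \<sigma>) / \<sigma>))"
    proof -
      \<comment> \<open>Because the square of \<kappa> is -z, the terms with \<open>z\<close> and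
        with the square of \<kappa> cancel: the exponential solves the equation with zero potential,
        and only \<open>q\<close> and the derivatives of the cutoff contribute.\<close>
      have z: "z = - \<kappa>\<^sup>2" using \<kappa>(1) by simp
      have r: "(of_real x / \<sigma>)\<^sup>2 = a * (of_real x)\<^sup>2" "2 / \<sigma>\<^sup>2 = 2 * a"
        "4 * \<kappa> * (of_real x / \<sigma>) / \<sigma> = 4 * \<kappa> * a * of_real x"
        by (simp_all add: a_def divide_inverse power_mult_distrib power2_eq_square)
      show ?thesis unfolding g_def g''_def z r by (simp add: algebra_simps)
    qed
    also have "norm \<dots> \<le> norm (y x) * (1 * (\<bar>q x\<bar> + 2 / S\<^sup>2 + 4 * norm \<kappa> / S))"
      unfolding norm_mult[of "y x"] norm_mult[of "E x"]
    proof (intro mult_left_mono mult_mono)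
      show "norm (E x) \<le> 1" using x S \<kappa>(2) by (simp add: E_def \<sigma>_def)
      have "norm (of_real x / \<sigma>) = \<bar>x\<bar> / S" using S by (simp add: \<sigma>_def norm_divide)
      also have "\<dots> \<le> 1" using x S by (subst pos_divide_le_eq) auto
      finally have xs: "norm (of_real x / \<sigma>) \<le> 1" .
      then have xs2: "norm ((of_real x / \<sigma>)\<^sup>2) \<le> 1" by (simp add: norm_power power_le_one)
      have tri: "norm (u - v + w) \<le> norm u + norm v + norm w" for u v w :: complex
        using norm_triangle_ineq[of "u - v" w] norm_triangle_ineq4[of u v] by linarith
      have "norm (of_real (q x) * (of_real x / \<sigma>)\<^sup>2 - 2 / \<sigma>\<^sup>2 + 4 * \<kappa> * (of_real x / \<sigma>) / \<sigma>)
         \<le> norm (of_real (q x) * (of_real x / \<sigma>)\<^sup>2) + norm (2 / \<sigma>\<^sup>2) + norm (4 * \<kappa> * (of_real x / \<sigma>) / \<sigma>)"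
        by (rule tri)
      also have "norm (of_real (q x) * (of_real x / \<sigma>)\<^sup>2) \<le> \<bar>q x\<bar>"
        unfolding norm_mult using mult_left_mono[OF xs2, of "norm (of_real (q x) :: complex)"] by simp
      also have "norm (2 / \<sigma>\<^sup>2) = 2 / S\<^sup>2" by (simp add: \<sigma>_def norm_divide norm_power)
      also have "norm (4 * \<kappa> * (of_real x / \<sigma>) / \<sigma>) \<le> 4 * norm \<kappa> / S"
      proof -
        have "norm (4 * \<kappa> * (of_real x / \<sigma>) / \<sigma>) = 4 * norm \<kappa> * norm (of_real x / \<sigma>) / S"
          using S by (simp only: norm_divide[of _ \<sigma>] norm_mult) (simp add: \<sigma>_def)
        also have "\<dots> \<le> 4 * norm \<kappa> * 1 / S" using S by (intro divide_right_mono mult_left_mono xs) auto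
        finally show ?thesis by simp
      qed
      finally show "norm (of_real (q x) * (of_real x / \<sigma>)\<^sup>2 - 2 / \<sigma>\<^sup>2 + 4 * \<kappa> * (of_real x / \<sigma>) / \<sigma>)
         \<le> \<bar>q x\<bar> + 2 / S\<^sup>2 + 4 * norm \<kappa> / S" by simp
    qed auto
    also have "\<dots> \<le> h x" using h(2)[OF x] by simp
    finally show ?thesis .
  qed
  have "norm (integral {-S..0} (\<lambda>x. ((of_real (q x) - z) * y x) * g x - y x * g'' x)) \<le> integral {-S..0} h"
    by (rule integral_norm_bound_integral[OF has_integral_integrable[OF I] has_integral_integrable[OF h(1)] bound])
  then have "norm (- (p (-S) + y (-S) * (\<kappa> + 2 / \<sigma>))) \<le> I"
    using integral_unique[OF I] integral_unique[OF h(1)] by simp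
  then show ?thesis by (simp only: norm_minus_cancel \<sigma>_def)
qed

text \<open>Writing z = i s^4 makes the root of -z equal to s^2 \<open>cis (-(pi/4))\<close> and all
  errors polynomial in s. For \<open>y (-S) = 1\<close> and \<open>F = p (-S)\<close>, the identity
  for imaginary parts bounds the integral of |y|^2 by |F| / s^4. Inserted into the test function
  estimate, this leaves a multiple of |F| / s, which is absorbed for large s.\<close>

lemma weyl_asymptotics:
  fixes q :: "real \<Rightarrow> real"
  assumes S: "S > 0" and q: "(\<lambda>x. complex_of_real (q x)) absolutely_integrable_on {-S..0}" "(\<lambda>x. (q x)\<^sup>2) integrable_on {-S..0}"
  obtains C s0 where "s0 \<ge> 1"
    "\<And>s y p. s \<ge> s0 \<Longrightarrow> sl_solution (-S) 0 (\<lambda>x. of_real (q x) - \<i> * of_real (s^4)) (\<lambda>x. 0) y p \<Longrightarrow>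
       Im (p 0 * cnj (y 0)) \<ge> 0 \<Longrightarrow> y (-S) \<noteq> 0 \<Longrightarrow>
       norm (p (-S) / y (-S) + of_real (s\<^sup>2) * cis (-(pi/4))) \<le> C * s"
proof -
  define Q where "Q = integral {-S..0} (\<lambda>x. (q x)\<^sup>2)"
  have Q0: "Q \<ge> 0" unfolding Q_def by (intro integral_nonneg q) auto
  define C1 where "C1 = Q / 2 + 2 + 1 / S + 2 / S"
  define C2 where "C2 = 1 / 2 + 2 / S + 1 / S\<^sup>2"
  have C0: "C1 \<ge> 0" "C2 \<ge> 0" using S Q0 by (auto simp: C1_def C2_def)
  \<comment> \<open>For s beyond \<open>2 * C2\<close> the term C2 |F| / s is at most |F| / 2.
    Absorbing it gives |F| <= 2 (1 + C1) s^2, and reinserting this bound yields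
    \<open>C\<close>.\<close>
  define s0 where "s0 = max 1 (2 * C2)"
  define C where "C = C1 + 2 * C2 * (1 + C1)"
  have normalized: "norm (p (-S) + of_real (s\<^sup>2) * cis (-(pi/4))) \<le> C * s"
    if s: "s \<ge> s0" and sol: "sl_solution (-S) 0 (\<lambda>x. of_real (q x) - \<i> * of_real (s^4)) (\<lambda>x. 0) y p"
      and im: "Im (p 0 * cnj (y 0)) \<ge> 0" and y1: "y (-S) = 1" for s y p
  proof -
    define \<kappa> where "\<kappa> = of_real (s\<^sup>2) * cis (-(pi/4))"
    have s1: "s \<ge> 1" "s \<ge> 2 * C2" using s by (auto simp: s0_def)
    have k1: "\<kappa>\<^sup>2 = - (\<i> * of_real (s^4))"
    proof -
      have "(cis (-(pi/4)))\<^sup>2 = - \<i>" by (simp add: Complex.DeMoivre complex_eq_iff)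
      then show ?thesis by (simp add: \<kappa>_def power_mult_distrib flip: power_mult)
    qed
    have "cos (pi/4) \<ge> 0" by (intro cos_ge_zero) auto
    then have k2: "Re \<kappa> \<ge> 0" by (simp add: \<kappa>_def)
    have k3: "norm \<kappa> = s\<^sup>2" by (simp add: \<kappa>_def norm_mult norm_power)
    have cy: "continuous_on {-S..0} y" using sol primitive_on_continuous unfolding sl_solution_def by blast
    define J where "J = integral {-S..0} (\<lambda>x. (norm (y x))\<^sup>2)"
    have ni: "(\<lambda>x. (norm (y x))\<^sup>2) integrable_on {-S..0}" by (intro integrable_continuous_real continuous_intros cy)
    have J0: "J \<ge> 0" unfolding J_def by (intro integral_nonneg ni) auto
    define F where "F = p (-S)"
    have "Im (p (-S) * cnj (y (-S))) = Im (p 0 * cnj (y 0)) + Im (\<i> * of_real (s^4)) * integral {-S..0} (\<lambda>x. (norm (y x))\<^sup>2)"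
      by (rule sl_solution_Im[OF _ q(1) sol]) (use S in simp)
    then have "s^4 * J \<le> Im F" using im by (simp add: y1 F_def J_def)
    then have JF: "s^4 * J \<le> norm F" using abs_Im_le_cmod[of F] by linarith
    \<comment> \<open>AM-GM splits each product in the test function estimate into a part free of
      \<open>y\<close>, contributing O(s), and a multiple of |y|^2, contributing O(s^3) times
      \<open>J\<close>.\<close>
    define h where "h x = ((q x)\<^sup>2 / 2 + (norm (y x))\<^sup>2 / 2) + (1 / S\<^sup>2 + (norm (y x))\<^sup>2 / S\<^sup>2) + (2 * s / S + (norm (y x))\<^sup>2 * (2 * s^3 / S))" for x
    have hI: "(h has_integral ((Q / 2 + J / 2) + (1 / S + J / S\<^sup>2) + (2 * s + J * (2 * s^3 / S)))) {-S..0}"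
    proof -
      have c: "((\<lambda>x. c) has_integral S * c) {-S..0}" for c :: real
        using has_integral_const_real[of c "-S" 0] S by simp
      have Jh: "((\<lambda>x. (norm (y x))\<^sup>2) has_integral J) {-S..0}" unfolding J_def by (rule integrable_integral[OF ni])
      have Qh: "((\<lambda>x. (q x)\<^sup>2) has_integral Q) {-S..0}" unfolding Q_def by (rule integrable_integral[OF q(2)])
      have "(h has_integral ((Q / 2 + J / 2) + (S * (1 / S\<^sup>2) + J / S\<^sup>2) + (S * (2 * s / S) + J * (2 * s^3 / S)))) {-S..0}"
        unfolding h_def by (intro has_integral_add has_integral_divide has_integral_mult_left Jh Qh c)
      then show ?thesis using S by (simp add: power2_eq_square)
    qed
    have "norm (p (-S) + y (-S) * (\<kappa> + 2 / of_real S)) \<le> (Q / 2 + J / 2) + (1 / S + J / S\<^sup>2) + (2 * s + J * (2 * s^3 / S))"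
    proof (rule weyl_test_function_bound[OF S q(1) sol k1 k2 hI])
      fix x
      define Y where "Y = norm (y x)"
      have Y0: "Y \<ge> 0" by (simp add: Y_def)
      have a: "Y * \<bar>q x\<bar> \<le> (q x)\<^sup>2 / 2 + Y\<^sup>2 / 2" using sum_squares_bound[of "\<bar>q x\<bar>" Y] by (simp add: mult_ac)
      have "2 * Y \<le> 1 + Y\<^sup>2" using sum_squares_bound[of 1 Y] by simp
      then have b: "Y * (2 / S\<^sup>2) \<le> 1 / S\<^sup>2 + Y\<^sup>2 / S\<^sup>2" using S by (simp add: field_simps)
      \<comment> \<open>The splitting is weighted so that the part free of \<open>Y\<close> has
        order s, while the coefficient s^3 of Y^2 is still beaten by the factor s^4 in
        \<open>JF\<close>.\<close>
      have "2 * 1 * (s * Y) \<le> 1\<^sup>2 + (s * Y)\<^sup>2" by (rule sum_squares_bound)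
      then have "s * (2 * (s * Y)) \<le> s * (1 + (s * Y)\<^sup>2)" using s1 by (intro mult_left_mono) auto
      then have "2 * s\<^sup>2 * Y \<le> s + s^3 * Y\<^sup>2" by (simp add: power2_eq_square power3_eq_cube algebra_simps)
      then have "2 * (2 * s\<^sup>2 * Y) / S \<le> 2 * (s + s^3 * Y\<^sup>2) / S" using S by (intro divide_right_mono) auto
      then have c: "Y * (4 * norm \<kappa> / S) \<le> 2 * s / S + Y\<^sup>2 * (2 * s^3 / S)"
        by (simp add: k3 add_divide_distrib algebra_simps)
      have "Y * (\<bar>q x\<bar> + 2 / S\<^sup>2 + 4 * norm \<kappa> / S) = Y * \<bar>q x\<bar> + Y * (2 / S\<^sup>2) + Y * (4 * norm \<kappa> / S)"
        by (simp only: distrib_left)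
      then show "norm (y x) * (\<bar>q x\<bar> + 2 / S\<^sup>2 + 4 * norm \<kappa> / S) \<le> h x"
        using a b c by (simp add: h_def Y_def)
    qed
    then have A: "norm (F + \<kappa> + 2 / of_real S) \<le> (Q / 2 + J / 2) + (1 / S + J / S\<^sup>2) + (2 * s + J * (2 * s^3 / S))"
      by (simp add: y1 F_def add.assoc)
    have "norm (F + \<kappa>) \<le> norm (F + \<kappa> + 2 / of_real S) + norm (2 / of_real S :: complex)" by norm
    moreover have "norm (2 / of_real S :: complex) = 2 / S" using S by (simp add: norm_divide)
    ultimately have B: "norm (F + \<kappa>) \<le> (Q / 2 + 1 / S + 2 / S + 2 * s) + (J / 2 + J / S\<^sup>2 + J * (2 * s^3 / S))"
      using A by linarith
    have p1: "Q / 2 + 1 / S + 2 / S + 2 * s \<le> C1 * s"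
    proof -
      have "(Q / 2 + 1 / S + 2 / S) * 1 \<le> (Q / 2 + 1 / S + 2 / S) * s" using s1 Q0 S by (intro mult_left_mono) auto
      then show ?thesis by (simp add: C1_def algebra_simps)
    qed
    have s3: "s^3 \<ge> 1" using s1 by simp
    have p2: "J / 2 + J / S\<^sup>2 + J * (2 * s^3 / S) \<le> C2 * (s^3 * J)"
    proof -
      have "(J / 2 + J / S\<^sup>2) * 1 \<le> (J / 2 + J / S\<^sup>2) * s^3" using s3 J0 S by (intro mult_left_mono) auto
      then show ?thesis by (simp add: C2_def algebra_simps)
    qed
    have p3: "s^3 * J \<le> norm F / s"
      using JF s1 by (simp add: field_simps power4_eq_xxxx power3_eq_cube)
    have D: "norm (F + \<kappa>) \<le> C1 * s + C2 * (norm F / s)"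
      using B p1 p2 mult_left_mono[OF p3 C0(2)] by linarith
    have half: "C2 * (norm F / s) \<le> norm F / 2"
      using mult_right_mono[OF s1(2), of "norm F"] s1 by (simp add: field_simps)
    have "norm F \<le> norm (F + \<kappa>) + norm \<kappa>" by norm
    then have "norm F \<le> (C1 * s + norm F / 2) + s\<^sup>2" using order.trans[OF D add_left_mono[OF half]] k3 by linarith
    then have "norm F \<le> 2 * (s\<^sup>2 + C1 * s)" by (simp add: field_simps)
    also have "\<dots> \<le> 2 * (s\<^sup>2 + C1 * s\<^sup>2)"
      using s1 C0 by (simp add: mult_left_mono power2_eq_square)
    finally have "norm F / s \<le> 2 * (1 + C1) * s" using s1 by (simp add: field_simps power2_eq_square)
    then have "C2 * (norm F / s) \<le> C2 * (2 * (1 + C1) * s)" using C0 by (intro mult_left_mono)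
    then have "norm (F + \<kappa>) \<le> C * s" using D by (simp add: C_def algebra_simps)
    then show ?thesis by (simp add: F_def \<kappa>_def)
  qed
  have "norm (p (-S) / y (-S) + of_real (s\<^sup>2) * cis (-(pi/4))) \<le> C * s"
    if s: "s \<ge> s0" and sol: "sl_solution (-S) 0 (\<lambda>x. of_real (q x) - \<i> * of_real (s^4)) (\<lambda>x. 0) y p"
      and im: "Im (p 0 * cnj (y 0)) \<ge> 0" and y0: "y (-S) \<noteq> 0" for s y p
  proof -
    \<comment> \<open>Division by \<open>y (-S)\<close> normalizes the solution; the Hermitian
      quantity at 0 is multiplied by |c|^2 and keeps its sign.\<close>
    define c where "c = inverse (y (-S))"
    have sol': "sl_solution (-S) 0 (\<lambda>x. of_real (q x) - \<i> * of_real (s^4)) (\<lambda>x. 0) (\<lambda>x. c * y x) (\<lambda>x. c * p x)"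
      using sl_solution_cmult[OF sol, of c] by simp
    have "c * p 0 * cnj (c * y 0) = of_real ((norm c)\<^sup>2) * (p 0 * cnj (y 0))"
      by (simp add: complex_norm_square del: of_real_power)
    then have "Im (c * p 0 * cnj (c * y 0)) = (norm c)\<^sup>2 * Im (p 0 * cnj (y 0))"
      by (simp only: times_complex.simps Im_complex_of_real Re_complex_of_real)
    then have im': "Im (c * p 0 * cnj (c * y 0)) \<ge> 0" using im by simp
    have "norm (c * p (-S) + of_real (s\<^sup>2) * cis (-(pi/4))) \<le> C * s"
      by (rule normalized[OF s sol' im']) (use y0 in \<open>simp add: c_def\<close>)
    moreover have "p (-S) / y (-S) = c * p (-S)" unfolding c_def divide_inverse by (rule mult.commute)
    ultimately show ?thesis by (simp only:)
  qed
  moreover have "s0 \<ge> 1" by (simp add: s0_def)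
  ultimately show ?thesis using that by blast
qed

section \<open>Boundary values and uniqueness\<close>

locale transfer_problem =
  fixes S :: real and q :: "real \<Rightarrow> real" and M :: "real^2^2"
  assumes S: "S > 0" and q: "real_L2_on {-S..S} q" and detM: "det M = 1"
begin

abbreviation "solution z \<equiv> transfer_solution S q M z"

lemma det_entries: "entry M 1 1 * entry M 2 2 - entry M 1 2 * entry M 2 1 = 1"
  using detM by (simp add: det_2 entry_def)

lemma det_entries_complex:
  "complex_of_real (entry M 1 1) * of_real (entry M 2 2) - of_real (entry M 1 2) * of_real (entry M 2 1) = 1"
  using arg_cong[OF det_entries, of complex_of_real] by simp

lemma potential_integrable:
  "(\<lambda>x. complex_of_real (q x)) absolutely_integrable_on {-S..0}"
  "(\<lambda>x. complex_of_real (q x)) absolutely_integrable_on {0..S}"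
  "(\<lambda>x. complex_of_real (q x) - z) absolutely_integrable_on {-S..0}"
  "(\<lambda>x. complex_of_real (q x) - z) absolutely_integrable_on {0..S}"
  "(\<lambda>x. (q x)\<^sup>2) integrable_on {-S..0}"
  by (rule absolutely_integrable_potential[OF q], use S in simp)+

lemma solution_jump:
  assumes "solution z y1 p1 y2 p2"
  shows "y2 0 = of_real (entry M 1 1) * y1 0 + of_real (entry M 1 2) * p1 0"
    "p2 0 = of_real (entry M 2 1) * y1 0 + of_real (entry M 2 2) * p1 0"
  using assms by (auto simp: transfer_solution_def)

text \<open>With \<open>det M = 1\<close> the inverse of the transfer matrix is its adjugate. It is
  wanted because solutions start at \<open>S\<close> and cross the jump from right to left.\<close>

lemma solution_jump_inverse:
  assumes "solution z y1 p1 y2 p2"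
  shows "y1 0 = of_real (entry M 2 2) * y2 0 - of_real (entry M 1 2) * p2 0"
    "p1 0 = of_real (entry M 1 1) * p2 0 - of_real (entry M 2 1) * y2 0"
proof -
  have "of_real (entry M 2 2) * y2 0 - of_real (entry M 1 2) * p2 0
      = (of_real (entry M 1 1) * of_real (entry M 2 2) - of_real (entry M 1 2) * of_real (entry M 2 1)) * y1 0"
    unfolding solution_jump[OF assms] by (simp add: algebra_simps)
  then show "y1 0 = of_real (entry M 2 2) * y2 0 - of_real (entry M 1 2) * p2 0" by (simp only: det_entries_complex mult_1)
  have "of_real (entry M 1 1) * p2 0 - of_real (entry M 2 1) * y2 0
      = (of_real (entry M 1 1) * of_real (entry M 2 2) - of_real (entry M 1 2) * of_real (entry M 2 1)) * p1 0"
    unfolding solution_jump[OF assms] by (simp add: algebra_simps)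
  then show "p1 0 = of_real (entry M 1 1) * p2 0 - of_real (entry M 2 1) * y2 0" by (simp only: det_entries_complex mult_1)
qed

lemma solution_exists:
  obtains y1 p1 y2 p2 where "solution z y1 p1 y2 p2" "y2 S = a" "p2 S = b"
proof -
  obtain y2 p2 where 2: "sl_solution 0 S (\<lambda>x. of_real (q x) - z) (\<lambda>x. 0) y2 p2" "y2 S = a" "p2 S = b"
    by (rule sl_solution_exists[OF less_imp_le[OF S] potential_integrable(4) continuous_on_const])
  have S': "- S \<le> 0" using S by simp
  obtain y1 p1 where 1: "sl_solution (-S) 0 (\<lambda>x. of_real (q x) - z) (\<lambda>x. 0) y1 p1"
    "y1 0 = of_real (entry M 2 2) * y2 0 - of_real (entry M 1 2) * p2 0"
    "p1 0 = of_real (entry M 1 1) * p2 0 - of_real (entry M 2 1) * y2 0"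
    by (rule sl_solution_exists[OF S' potential_integrable(3) continuous_on_const])
  have "of_real (entry M 1 1) * y1 0 + of_real (entry M 1 2) * p1 0
     = (of_real (entry M 1 1) * of_real (entry M 2 2) - of_real (entry M 1 2) * of_real (entry M 2 1)) * y2 0"
    unfolding 1 by (simp add: algebra_simps)
  moreover have "of_real (entry M 2 1) * y1 0 + of_real (entry M 2 2) * p1 0
     = (of_real (entry M 1 1) * of_real (entry M 2 2) - of_real (entry M 1 2) * of_real (entry M 2 1)) * p2 0"
    unfolding 1 by (simp add: algebra_simps)
  ultimately have "solution z y1 p1 y2 p2"
    using 1(1) 2(1) unfolding transfer_solution_def by (simp only: det_entries_complex mult_1 simp_thms)
  then show ?thesis using that 2 by blast
qed

lemma solution_unique:
  assumes s: "solution z y1 p1 y2 p2" "solution z u1 v1 u2 v2" and eq: "y2 S = u2 S" "p2 S = v2 S"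
  shows "x \<in> {0..S} \<Longrightarrow> y2 x = u2 x \<and> p2 x = v2 x" "x \<in> {-S..0} \<Longrightarrow> y1 x = u1 x \<and> p1 x = v1 x"
proof -
  have 2: "sl_solution 0 S (\<lambda>x. of_real (q x) - z) (\<lambda>x. 0) y2 p2" "sl_solution 0 S (\<lambda>x. of_real (q x) - z) (\<lambda>x. 0) u2 v2"
    and 1: "sl_solution (-S) 0 (\<lambda>x. of_real (q x) - z) (\<lambda>x. 0) y1 p1" "sl_solution (-S) 0 (\<lambda>x. of_real (q x) - z) (\<lambda>x. 0) u1 v1"
    using s by (auto simp: transfer_solution_def)
  have r: "y2 x = u2 x \<and> p2 x = v2 x" if "x \<in> {0..S}" for x
    using sl_solution_unique[OF less_imp_le[OF S] potential_integrable(4) 2 eq that] by blast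
  then show "x \<in> {0..S} \<Longrightarrow> y2 x = u2 x \<and> p2 x = v2 x" .
  have "y2 0 = u2 0" "p2 0 = v2 0" using r[of 0] S by auto
  then have eq0: "y1 0 = u1 0" "p1 0 = v1 0" using solution_jump_inverse[OF s(1)] solution_jump_inverse[OF s(2)] by auto
  show "x \<in> {-S..0} \<Longrightarrow> y1 x = u1 x \<and> p1 x = v1 x"
    using sl_solution_unique[OF _ potential_integrable(3) 1 eq0] S by auto
qed

lemma solution_cmult:
  assumes "solution z y1 p1 y2 p2"
  shows "solution z (\<lambda>x. c * y1 x) (\<lambda>x. c * p1 x) (\<lambda>x. c * y2 x) (\<lambda>x. c * p2 x)"
  using assms sl_solution_cmult[of "-S" 0 _ "\<lambda>x. 0" y1 p1 c] sl_solution_cmult[of 0 S _ "\<lambda>x. 0" y2 p2 c]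
  unfolding transfer_solution_def by (simp add: algebra_simps)

text \<open>Lagrange's identity with equal parameters keeps the Wronskian constant on each piece,
  and the jump multiplies it by \<open>det M = 1\<close>.\<close>

lemma solution_wronskian:
  assumes s: "solution z y1 p1 y2 p2" "solution z u1 v1 u2 v2"
  shows "p1 (-S) * u1 (-S) - y1 (-S) * v1 (-S) = p2 S * u2 S - y2 S * v2 S"
proof -
  have 2: "sl_solution 0 S (\<lambda>x. of_real (q x) - z) (\<lambda>x. 0) y2 p2" "sl_solution 0 S (\<lambda>x. of_real (q x) - z) (\<lambda>x. 0) u2 v2"
    and 1: "sl_solution (-S) 0 (\<lambda>x. of_real (q x) - z) (\<lambda>x. 0) y1 p1" "sl_solution (-S) 0 (\<lambda>x. of_real (q x) - z) (\<lambda>x. 0) u1 v1"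
    using s by (auto simp: transfer_solution_def)
  have "((\<lambda>x. (z - z) * (y2 x * u2 x)) has_integral ((p2 S * u2 S - y2 S * v2 S) - (p2 0 * u2 0 - y2 0 * v2 0))) {0..S}"
    by (rule sl_solution_lagrange[OF less_imp_le[OF S] potential_integrable(2) 2])
  then have "p2 S * u2 S - y2 S * v2 S = p2 0 * u2 0 - y2 0 * v2 0" by (simp add: has_integral_0_eq)
  also have "\<dots> = (of_real (entry M 1 1) * of_real (entry M 2 2) - of_real (entry M 1 2) * of_real (entry M 2 1)) * (p1 0 * u1 0 - y1 0 * v1 0)"
    unfolding solution_jump[OF s(1)] solution_jump[OF s(2)] by (simp add: algebra_simps)
  also have "\<dots> = p1 0 * u1 0 - y1 0 * v1 0" by (simp only: det_entries_complex mult_1)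
  also have "((\<lambda>x. (z - z) * (y1 x * u1 x)) has_integral ((p1 0 * u1 0 - y1 0 * v1 0) - (p1 (-S) * u1 (-S) - y1 (-S) * v1 (-S)))) {-S..0}"
    by (rule sl_solution_lagrange[OF _ potential_integrable(1) 1]) (use S in simp)
  then have "p1 0 * u1 0 - y1 0 * v1 0 = p1 (-S) * u1 (-S) - y1 (-S) * v1 (-S)" by (simp add: has_integral_0_eq)
  finally show ?thesis by simp
qed

text \<open>Stated piece by piece: the asymptotics need the sign at 0, the half-plane property the
  sum of both contributions.\<close>

lemma solution_Im:
  assumes s: "solution z y1 p1 y2 p2"
  shows "Im (p1 0 * cnj (y1 0)) = Im (p2 S * cnj (y2 S)) + Im z * integral {0..S} (\<lambda>x. (norm (y2 x))\<^sup>2)"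
    and "Im (p1 (-S) * cnj (y1 (-S))) = Im (p1 0 * cnj (y1 0)) + Im z * integral {-S..0} (\<lambda>x. (norm (y1 x))\<^sup>2)"
proof -
  have 2: "sl_solution 0 S (\<lambda>x. of_real (q x) - z) (\<lambda>x. 0) y2 p2"
    and 1: "sl_solution (-S) 0 (\<lambda>x. of_real (q x) - z) (\<lambda>x. 0) y1 p1"
    using s by (auto simp: transfer_solution_def)
  have "Im (p2 0 * cnj (y2 0)) = (entry M 1 1 * entry M 2 2 - entry M 1 2 * entry M 2 1) * Im (p1 0 * cnj (y1 0))"
    unfolding solution_jump[OF s] by (simp add: algebra_simps)
  then have "Im (p2 0 * cnj (y2 0)) = Im (p1 0 * cnj (y1 0))" by (simp only: det_entries mult_1)
  then show "Im (p1 0 * cnj (y1 0)) = Im (p2 S * cnj (y2 S)) + Im z * integral {0..S} (\<lambda>x. (norm (y2 x))\<^sup>2)"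
    using sl_solution_Im[OF less_imp_le[OF S] potential_integrable(2) 2] by simp
  show "Im (p1 (-S) * cnj (y1 (-S))) = Im (p1 0 * cnj (y1 0)) + Im z * integral {-S..0} (\<lambda>x. (norm (y1 x))\<^sup>2)"
    by (rule sl_solution_Im[OF _ potential_integrable(1) 1]) (use S in simp)
qed

section \<open>Boundary values at \<open>-S\<close> of the solution with data at
  \<open>S\<close>\<close>

context
  fixes \<beta> :: real
begin

definition "u z = v_sol S q M \<beta> z (-S)"
definition "w z = piece_deriv S (v_sol S q M \<beta> z) (-S)"

text \<open>Since \<open>v_sol\<close> is a choice, a solution with the prescribed data has to be
  built before the chosen one is known to satisfy anything; the chosen one is then translated back
  into integral form.\<close>

lemma solution_data:
  obtains y1 p1 y2 p2 where "solution z y1 p1 y2 p2" "y2 S = sin \<beta>" "p2 S = cos \<beta>" "y1 (-S) = u z" "p1 (-S) = w z"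
proof -
  define v where "v = v_sol S q M \<beta> z"
  obtain a1 b1 a2 b2 where ab: "solution z a1 b1 a2 b2" "a2 S = sin \<beta>" "b2 S = cos \<beta>"
    using solution_exists[of z] by metis
  define y where "y x = (if x < 0 then a1 x else a2 x)" for x
  note ys = transfer_solution_imp_is_solution[where y = y, OF S q ab(1) y_def]
  define Q where "Q y \<longleftrightarrow> is_solution S q M z y \<and> y S = sin \<beta> \<and> piece_deriv S y S = cos \<beta>" for y
  have "Q y" using ys(1) ys(3)[of S] ab S by (simp add: y_def Q_def)
  moreover have "v = (SOME y. Q y)" by (simp add: v_def v_sol_def Q_def)
  ultimately have "Q v" by (simp add: someI)
  then have v: "is_solution S q M z v" "v S = sin \<beta>" "piece_deriv S v S = cos \<beta>" by (auto simp: Q_def)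
  obtain y1 p1 y2 p2 where s: "solution z y1 p1 y2 p2"
    "\<And>x. x \<in> {-S..<0} \<Longrightarrow> v x = y1 x \<and> piece_deriv S v x = p1 x"
    "\<And>x. x \<in> {0<..S} \<Longrightarrow> v x = y2 x \<and> piece_deriv S v x = p2 x"
  proof (rule is_solution_imp_transfer_solution[OF S q v(1)])
  qed (rule that)
  have m: "-S \<in> {-S..<0}" "S \<in> {0<..S}" using S by auto
  show ?thesis
  proof (rule that[OF s(1)])
    show "y2 S = sin \<beta>" "p2 S = cos \<beta>" using s(3)[OF m(2)] v by auto
    show "y1 (-S) = u z" "p1 (-S) = w z" using s(2)[OF m(1)] by (auto simp: u_def w_def v_def)
  qed
qed

lemma boundary_values_of_solution:
  assumes s: "solution z y1 p1 y2 p2" and e: "y2 S = sin \<beta>" "p2 S = cos \<beta>"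
  shows "u z = y1 (-S)" "w z = p1 (-S)"
proof -
  obtain a1 b1 a2 b2 where a: "solution z a1 b1 a2 b2" "a2 S = sin \<beta>" "b2 S = cos \<beta>" "a1 (-S) = u z" "b1 (-S) = w z"
    using solution_data[of z] by metis
  show "u z = y1 (-S)" "w z = p1 (-S)"
    using solution_unique(2)[OF a(1) s, of "-S"] a e S by auto
qed

text \<open>By uniqueness the chosen solutions may be replaced by any family with the same data.
  Holomorphy passes from \<open>S\<close> to 0, through the constant inverse transfer matrix, and on
  to \<open>-S\<close>.\<close>

lemma boundary_values_holomorphic: "u holomorphic_on UNIV" "w holomorphic_on UNIV"
proof -
  have "\<exists>Y1 P1 Y2 P2. solution z Y1 P1 Y2 P2 \<and> Y2 S = sin \<beta> \<and> P2 S = cos \<beta>" for z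
    using solution_exists[of z] by metis
  then obtain Y1 P1 Y2 P2 where Y: "\<And>z. solution z (Y1 z) (P1 z) (Y2 z) (P2 z)"
      "\<And>z. Y2 z S = sin \<beta>" "\<And>z. P2 z S = cos \<beta>"
    by metis
  have s2: "sl_solution 0 S (\<lambda>x. of_real (q x) - z) (\<lambda>x. 0) (Y2 z) (P2 z)"
    and s1: "sl_solution (-S) 0 (\<lambda>x. of_real (q x) - z) (\<lambda>x. 0) (Y1 z) (P1 z)" for z
    using Y(1)[of z] by (auto simp: transfer_solution_def)
  have h2: "(\<lambda>z. Y2 z 0) holomorphic_on UNIV" "(\<lambda>z. P2 z 0) holomorphic_on UNIV"
    by (rule sl_solution_holomorphic[OF less_imp_le[OF S] potential_integrable(2) s2]; use S Y in simp)+
  have h1: "(\<lambda>z. Y1 z 0) holomorphic_on UNIV" "(\<lambda>z. P1 z 0) holomorphic_on UNIV"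
    unfolding solution_jump_inverse[OF Y(1)] by (intro holomorphic_intros h2)+
  have uw: "u = (\<lambda>z. Y1 z (-S))" "w = (\<lambda>z. P1 z (-S))"
    using boundary_values_of_solution[OF Y] by auto
  show "u holomorphic_on UNIV" "w holomorphic_on UNIV"
    unfolding uw by (rule sl_solution_holomorphic[OF _ potential_integrable(1) s1 h1]; use S in simp)+
qed

text \<open>A second solution with data \<open>cos \<beta>\<close>, \<open>- sin \<beta>\<close> at
  \<open>S\<close> has Wronskian 1 with the first. The Wronskian is the same at \<open>-S\<close>,
  so \<open>u\<close> and \<open>w\<close> cannot both vanish.\<close>

lemma boundary_values_nonzero: "u z \<noteq> 0 \<or> w z \<noteq> 0"
proof -
  obtain a1 b1 a2 b2 where a: "solution z a1 b1 a2 b2" "a2 S = sin \<beta>" "b2 S = cos \<beta>" "a1 (-S) = u z" "b1 (-S) = w z"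
    using solution_data[of z] by metis
  obtain c1 d1 c2 d2 where c: "solution z c1 d1 c2 d2" "c2 S = cos \<beta>" "d2 S = - sin \<beta>"
    using solution_exists[of z] by metis
  have "w z * c1 (-S) - u z * d1 (-S) = complex_of_real (cos \<beta>) * cos \<beta> + of_real (sin \<beta>) * sin \<beta>"
    using solution_wronskian[OF a(1) c(1)] by (simp add: a c)
  also have "\<dots> = of_real ((sin \<beta>)\<^sup>2 + (cos \<beta>)\<^sup>2)" by (simp add: power2_eq_square)
  also have "\<dots> = 1" by (simp only: sin_cos_squared_add of_real_1)
  finally show ?thesis by auto
qed

text \<open>The data at \<open>S\<close> are real, so the boundary term there vanishes and only
  \<open>Im z\<close> times the integrals of |v|^2 remains.\<close>

lemma boundary_values_Im:
  assumes "Im z \<noteq> 0"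
  shows "Im z * Im (w z * cnj (u z)) > 0"
proof -
  obtain y1 p1 y2 p2 where s: "solution z y1 p1 y2 p2" "y2 S = sin \<beta>" "p2 S = cos \<beta>" "y1 (-S) = u z" "p1 (-S) = w z"
    using solution_data[of z] by metis
  have pr: "primitive_on 0 S p2 y2" "primitive_on 0 S (\<lambda>x. (of_real (q x) - z) * y2 x) p2" "primitive_on (-S) 0 p1 y1"
    using s(1) by (auto simp: transfer_solution_def sl_solution_def)
  have cy: "continuous_on {0..S} y2" "continuous_on {0..S} p2" "continuous_on {-S..0} y1"
    using pr primitive_on_continuous by blast+
  define J1 where "J1 = integral {-S..0} (\<lambda>x. (norm (y1 x))\<^sup>2)"
  define J2 where "J2 = integral {0..S} (\<lambda>x. (norm (y2 x))\<^sup>2)"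
  have c2: "continuous_on {0..S} (\<lambda>x. (norm (y2 x))\<^sup>2)" by (intro continuous_intros cy)
  have J1: "J1 \<ge> 0" unfolding J1_def
    by (intro integral_nonneg integrable_continuous_real continuous_intros cy) auto
  \<comment> \<open>A vanishing integral would make the solution zero on the right piece, and then
    \<open>sin \<beta>\<close> and \<open>cos \<beta>\<close> would both be 0.\<close>
  have J2: "J2 > 0"
  proof (rule ccontr)
    assume "\<not> J2 > 0"
    moreover have "J2 \<ge> 0" unfolding J2_def by (intro integral_nonneg integrable_continuous_real c2) auto
    ultimately have "((\<lambda>x. (norm (y2 x))\<^sup>2) has_integral 0) {0..S}"
      using integrable_integral[OF integrable_continuous_real[OF c2]] by (simp add: J2_def)
    then have "((\<lambda>x. (norm (y2 x))\<^sup>2) has_integral 0) (cbox 0 S)" by (simp add: cbox_interval)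
    then have "(norm (y2 x))\<^sup>2 = 0" if "x \<in> {0..S}" for x
      using has_integral_0_cbox_imp_0[of 0 S "\<lambda>x. (norm (y2 x))\<^sup>2" x] c2 S that by (simp add: cbox_interval box_real)
    then have z: "y2 x = 0" if "x \<in> {0..S}" for x using that by simp
    have "(y2 has_vector_derivative p2 S) (at S within {0..S})"
      by (rule primitive_on_has_vector_derivative[OF pr(1) cy(2)]) (use S in simp)
    moreover have "(y2 has_vector_derivative 0) (at S within {0..S})"
      by (rule has_vector_derivative_transform[of S "{0..S}" y2 "\<lambda>x. 0"]) (use S z in auto)
    ultimately have "p2 S = 0"
      using vector_derivative_unique_within_closed_interval[of 0 S S y2] S by (simp add: cbox_interval)
    then have "sin \<beta> = 0" "cos \<beta> = 0" using z[of S] s S by auto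
    then show False using sin_cos_squared_add[of \<beta>] by simp
  qed
  have r: "Im (p2 S * cnj (y2 S)) = 0" by (simp add: s)
  have "Im (w z * cnj (u z)) = Im z * (J1 + J2)"
    using solution_Im[OF s(1)] r by (simp add: s J1_def J2_def distrib_left)
  then have "Im z * Im (w z * cnj (u z)) = (Im z)\<^sup>2 * (J1 + J2)" by (simp add: power2_eq_square)
  then show ?thesis using assms J1 J2 by simp
qed

text \<open>The jump and the interval to the right of 0 are felt only through
  \<open>Im (p1 0 * cnj (y1 0)) \<ge> 0\<close>, which follows from the real data at
  \<open>S\<close>; hence the limit is common to all problems.\<close>

lemma boundary_values_asymptotics:
  "((\<lambda>s. w (\<i> * of_real (s^4)) / u (\<i> * of_real (s^4)) / (of_real (s\<^sup>2) * cis (-(pi/4)))) \<longlongrightarrow> -1) at_top"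
proof -
  obtain C s0 where s0: "s0 \<ge> 1"
    and C: "\<And>s y p. s \<ge> s0 \<Longrightarrow> sl_solution (-S) 0 (\<lambda>x. of_real (q x) - \<i> * of_real (s^4)) (\<lambda>x. 0) y p \<Longrightarrow>
       Im (p 0 * cnj (y 0)) \<ge> 0 \<Longrightarrow> y (-S) \<noteq> 0 \<Longrightarrow>
       norm (p (-S) / y (-S) + of_real (s\<^sup>2) * cis (-(pi/4))) \<le> C * s"
    using weyl_asymptotics[OF S potential_integrable(1,5)] by metis
  define F where "F s = w (\<i> * of_real (s^4)) / u (\<i> * of_real (s^4))" for s :: real
  define k where "k s = of_real (s\<^sup>2) * cis (-(pi/4))" for s :: real
  have est: "norm (F s / k s - (-1)) \<le> C * inverse s" if ss: "s \<ge> s0" for s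
  proof -
    define z where "z = \<i> * of_real (s^4)"
    have s1: "s \<ge> 1" using ss s0 by simp
    have zi: "Im z = s^4" "Im z > 0" using s1 by (auto simp: z_def)
    obtain y1 p1 y2 p2 where y: "solution z y1 p1 y2 p2" "y2 S = sin \<beta>" "p2 S = cos \<beta>" "y1 (-S) = u z" "p1 (-S) = w z"
      using solution_data[of z] by metis
    have "sl_solution (-S) 0 (\<lambda>x. of_real (q x) - \<i> * of_real (s^4)) (\<lambda>x. 0) y1 p1"
      using y(1) by (simp add: transfer_solution_def z_def)
    moreover have "Im (p1 0 * cnj (y1 0)) \<ge> 0"
    proof -
      have "continuous_on {0..S} y2"
        using y(1) primitive_on_continuous unfolding transfer_solution_def sl_solution_def by blast
      then have "integral {0..S} (\<lambda>x. (norm (y2 x))\<^sup>2) \<ge> 0"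
        by (intro integral_nonneg integrable_continuous_real continuous_intros) auto
      moreover have "Im (p2 S * cnj (y2 S)) = 0" by (simp add: y)
      ultimately show ?thesis unfolding solution_Im(1)[OF y(1)] using zi(2) by simp
    qed
    moreover have "y1 (-S) \<noteq> 0"
      using boundary_values_Im[of z] zi y(4) by auto
    ultimately have "norm (p1 (-S) / y1 (-S) + of_real (s\<^sup>2) * cis (-(pi/4))) \<le> C * s" by (rule C[OF ss])
    then have "norm (F s + k s) \<le> C * s" by (simp add: F_def k_def y z_def)
    moreover have nk: "norm (k s) = s\<^sup>2" by (simp add: k_def norm_mult norm_power)
    then have k0: "k s \<noteq> 0" using s1 by auto
    have "F s / k s - (-1) = (F s + k s) / k s" using k0 by (simp add: add_divide_distrib)
    then have "norm (F s / k s - (-1)) = norm (F s + k s) / s\<^sup>2" by (simp add: norm_divide nk)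
    ultimately have "norm (F s / k s - (-1)) \<le> C * s / s\<^sup>2" using s1 by (simp add: divide_right_mono)
    also have "\<dots> = C * inverse s" using s1 by (simp add: field_simps power2_eq_square)
    finally show ?thesis .
  qed
  have "((\<lambda>s. F s / k s - (-1)) \<longlongrightarrow> 0) at_top"
  proof (rule Lim_null_comparison)
    show "\<forall>\<^sub>F s in at_top. norm (F s / k s - (-1)) \<le> C * inverse s"
      using eventually_ge_at_top[of s0] by eventually_elim (rule est)
    have "((\<lambda>s. C * inverse s) \<longlongrightarrow> C * 0) at_top"
      by (intro tendsto_intros tendsto_inverse_0_at_top filterlim_ident)
    then show "((\<lambda>s. C * inverse s) \<longlongrightarrow> 0) at_top" by simp
  qed
  then have "((\<lambda>s. F s / k s) \<longlongrightarrow> -1) at_top" by (rule LIM_zero_cancel)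
  then show ?thesis by (simp add: F_def k_def)
qed

text \<open>The condition at \<open>S\<close> makes the data of an eigenfunction proportional to
  \<open>sin \<beta>\<close>, \<open>cos \<beta>\<close>. By uniqueness it is a multiple of
  \<open>v_sol\<close>, and the condition at \<open>-S\<close> becomes the equation for
  \<open>u\<close> and \<open>w\<close>.\<close>

lemma eigenvalue_iff_zero:
  "is_eigenvalue S q M \<alpha> \<beta> z \<longleftrightarrow> w z * sin \<alpha> - u z * cos \<alpha> = 0"
proof
  assume "is_eigenvalue S q M \<alpha> \<beta> z"
  then obtain y x0 where y: "is_solution S q M z y" "x0 \<in> {-S..S} - {0}" "y x0 \<noteq> 0"
     "y (-S) * cos \<alpha> - piece_deriv S y (-S) * sin \<alpha> = 0" "y S * cos \<beta> - piece_deriv S y S * sin \<beta> = 0"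
    unfolding is_eigenvalue_def by blast
  obtain y1 p1 y2 p2 where s: "solution z y1 p1 y2 p2"
    "\<And>x. x \<in> {-S..<0} \<Longrightarrow> y x = y1 x \<and> piece_deriv S y x = p1 x"
    "\<And>x. x \<in> {0<..S} \<Longrightarrow> y x = y2 x \<and> piece_deriv S y x = p2 x"
  proof (rule is_solution_imp_transfer_solution[OF S q y(1)])
  qed (rule that)
  obtain a1 b1 a2 b2 where a: "solution z a1 b1 a2 b2" "a2 S = sin \<beta>" "b2 S = cos \<beta>" "a1 (-S) = u z" "b1 (-S) = w z"
    using solution_data[of z] by metis
  have bc: "y2 S * cos \<beta> = p2 S * sin \<beta>" using y(5) s(3)[of S] S by simp
  \<comment> \<open>The factor is the projection of the data onto the unit vector (sin \<beta>, cos
    \<beta>); it is nonzero because the eigenfunction is.\<close>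
  define d where "d = y2 S * sin \<beta> + p2 S * cos \<beta>"
  have sc: "complex_of_real (sin \<beta>) * sin \<beta> + of_real (cos \<beta>) * cos \<beta> = 1"
  proof -
    have "complex_of_real (sin \<beta>) * sin \<beta> + of_real (cos \<beta>) * cos \<beta> = of_real ((sin \<beta>)\<^sup>2 + (cos \<beta>)\<^sup>2)"
      by (simp add: power2_eq_square)
    then show ?thesis by (simp only: sin_cos_squared_add of_real_1)
  qed
  have "d * sin \<beta> = y2 S * (complex_of_real (sin \<beta>) * sin \<beta>) + (p2 S * sin \<beta>) * cos \<beta>"
    by (simp add: d_def algebra_simps)
  also have "\<dots> = y2 S * (complex_of_real (sin \<beta>) * sin \<beta> + of_real (cos \<beta>) * cos \<beta>)"
    unfolding bc[symmetric] by (simp add: algebra_simps)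
  finally have e1: "y2 S = d * a2 S" by (simp only: sc a mult_1_right)
  have "d * cos \<beta> = (y2 S * cos \<beta>) * sin \<beta> + p2 S * (complex_of_real (cos \<beta>) * cos \<beta>)"
    by (simp add: d_def algebra_simps)
  also have "\<dots> = p2 S * (complex_of_real (sin \<beta>) * sin \<beta> + of_real (cos \<beta>) * cos \<beta>)"
    unfolding bc by (simp add: algebra_simps)
  finally have e2: "p2 S = d * b2 S" by (simp only: sc a mult_1_right)
  note un = solution_unique[OF s(1) solution_cmult[OF a(1)] e1 e2]
  have d0: "d \<noteq> 0"
  proof
    assume "d = 0"
    then have "y2 x = 0" if "x \<in> {0..S}" for x using un(1)[OF that] by simp
    moreover have "y1 x = 0" if "x \<in> {-S..0}" for x using un(2)[OF that] \<open>d = 0\<close> by simp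
    ultimately show False using y(2,3) s(2,3)[of x0] by (cases "x0 < 0") auto
  qed
  have "y1 (-S) = d * u z \<and> p1 (-S) = d * w z" using un(2)[of "-S"] a S by simp
  moreover have "y (-S) = y1 (-S) \<and> piece_deriv S y (-S) = p1 (-S)" using s(2)[of "-S"] S by simp
  ultimately have "d * u z * cos \<alpha> - d * w z * sin \<alpha> = 0" using y(4) by simp
  moreover have "d * (w z * sin \<alpha> - u z * cos \<alpha>) = - (d * u z * cos \<alpha> - d * w z * sin \<alpha>)"
    by (simp add: right_diff_distrib)
  ultimately have "d * (w z * sin \<alpha> - u z * cos \<alpha>) = 0" by (simp only: minus_zero)
  then show "w z * sin \<alpha> - u z * cos \<alpha> = 0" using d0 by simp
next
  assume z: "w z * sin \<alpha> - u z * cos \<alpha> = 0"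
  obtain y1 p1 y2 p2 where s: "solution z y1 p1 y2 p2" "y2 S = sin \<beta>" "p2 S = cos \<beta>" "y1 (-S) = u z" "p1 (-S) = w z"
    using solution_data[of z] by metis
  define y where "y x = (if x < 0 then y1 x else y2 x)" for x
  note ys = transfer_solution_imp_is_solution[where y = y, OF S q s(1) y_def]
  have pr: "primitive_on 0 S p2 y2" using s(1) by (auto simp: transfer_solution_def sl_solution_def)
  have y1: "y (-S) = u z" "piece_deriv S y (-S) = w z" using ys(2)[of "-S"] s S by (auto simp: y_def)
  have y2: "y S = sin \<beta>" "piece_deriv S y S = cos \<beta>" using ys(3)[of S] s S by (auto simp: y_def)
  \<comment> \<open>A solution vanishing on the left piece would have both boundary values at
    \<open>-S\<close> equal to 0.\<close>
  have "\<exists>x\<in>{-S..S} - {0}. y x \<noteq> 0"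
  proof (rule ccontr)
    assume "\<not> ?thesis"
    then have z: "y1 x = 0" if "x \<in> {-S..<0}" for x
      using that S unfolding y_def by (metis DiffI atLeastAtMost_iff atLeastLessThan_iff less_imp_le less_irrefl order_trans singletonD)
    have "u z = 0" using z[of "-S"] s S by simp
    have pr: "primitive_on (-S) 0 p1 y1" "continuous_on {-S..0} p1"
      using s(1) primitive_on_continuous by (auto simp: transfer_solution_def sl_solution_def)
    have "(y1 has_vector_derivative p1 (-S)) (at (-S) within {-S..0})"
      by (rule primitive_on_has_vector_derivative[OF pr]) (use S in simp)
    then have d: "(y1 has_vector_derivative p1 (-S)) (at (-S) within {-S..<0})"
      by (rule has_vector_derivative_within_subset) auto
    have d0: "(y1 has_vector_derivative 0) (at (-S) within {-S..<0})"
      by (rule has_vector_derivative_transform[of _ _ y1 "\<lambda>x. 0"]) (use S z in auto)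
    have m: "-S \<in> {-S..S} - {0}" and pc: "piece S (-S) = {-S..<0}" using S by (auto simp: piece_def)
    note pd = piece_deriv_eq[OF S m, unfolded pc]
    have "p1 (-S) = 0" using pd[OF d] pd[OF d0] by simp
    then have "w z = 0" using s by simp
    then show False using boundary_values_nonzero[of z] \<open>u z = 0\<close> by simp
  qed
  moreover have "y (-S) * cos \<alpha> - piece_deriv S y (-S) * sin \<alpha> = 0" using z by (simp add: y1 algebra_simps)
  moreover have "y S * cos \<beta> - piece_deriv S y S * sin \<beta> = 0" by (simp add: y2 mult.commute)
  ultimately show "is_eigenvalue S q M \<alpha> \<beta> z" unfolding is_eigenvalue_def using ys(1) by blast
qed

end

end

text \<open>For \<open>a \<noteq> 0\<close> the growth of \<open>k\<close> makes the constant
  \<open>b\<close> negligible. The case \<open>a = 0\<close>, which is the Dirichlet condition in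
  the application, is separate: there the quotient is identically 1.\<close>

lemma affine_ratio_tendsto_1:
  fixes F G k :: "real \<Rightarrow> complex"
  assumes F: "((\<lambda>s. F s / k s) \<longlongrightarrow> -1) at_top" and G: "((\<lambda>s. G s / k s) \<longlongrightarrow> -1) at_top"
    and k: "((\<lambda>s. inverse (k s)) \<longlongrightarrow> 0) at_top" "\<forall>\<^sub>F s in at_top. k s \<noteq> 0" and ab: "a \<noteq> 0 \<or> b \<noteq> 0"
  shows "((\<lambda>s. (F s * a - b) / (G s * a - b)) \<longlongrightarrow> 1) at_top"
proof (cases "a = 0")
  case True
  then show ?thesis using ab by simp
next
  case False
  have "((\<lambda>s. (F s / k s * a - b * inverse (k s)) / (G s / k s * a - b * inverse (k s))) \<longlongrightarrow> (-1 * a - b * 0) / (-1 * a - b * 0)) at_top"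
    by (intro tendsto_intros F G k) (use False in simp)
  then have lim: "((\<lambda>s. (F s / k s * a - b * inverse (k s)) / (G s / k s * a - b * inverse (k s))) \<longlongrightarrow> 1) at_top"
    using False by simp
  have "\<forall>\<^sub>F s in at_top. (F s / k s * a - b * inverse (k s)) / (G s / k s * a - b * inverse (k s)) = (F s * a - b) / (G s * a - b)"
    using k(2)
  proof eventually_elim
    case (elim s)
    have "F s / k s * a - b * inverse (k s) = inverse (k s) * (F s * a - b)"
      "G s / k s * a - b * inverse (k s) = inverse (k s) * (G s * a - b)"
      by (simp_all add: divide_inverse algebra_simps)
    then show ?case using elim by simp
  qed
  with lim show ?thesis by (rule Lim_transform_eventually)
qed

section \<open>Characteristic functions for two boundary angles at \<open>-S\<close>\<close>

context transfer_problem
begin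

definition char_value :: "real \<Rightarrow> real \<Rightarrow> complex \<Rightarrow> complex" where
  "char_value \<alpha> \<beta> z = w \<beta> z * sin \<alpha> - u \<beta> z * cos \<alpha>"

lemma char_value_holomorphic: "char_value \<alpha> \<beta> holomorphic_on UNIV"
  unfolding char_value_def[abs_def] by (intro holomorphic_intros boundary_values_holomorphic)

text \<open>The products of \<open>w\<close> and of \<open>u\<close> with their own conjugates are
  real, and the mixed terms combine by the addition formula to
  \<open>sin (\<alpha> - \<alpha>')\<close> times \<open>Im (w cnj u)\<close>. Multiplying by the
  same sine once more removes its sign.\<close>

lemma char_value_Im:
  assumes z: "Im z \<noteq> 0" and s: "sin (\<alpha> - \<alpha>') \<noteq> 0"
  shows "sin (\<alpha> - \<alpha>') * Im z * Im (char_value \<alpha>' \<beta> z * cnj (char_value \<alpha> \<beta> z)) > 0"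
proof -
  have "Im (char_value \<alpha>' \<beta> z * cnj (char_value \<alpha> \<beta> z)) = Im (w \<beta> z * cnj (u \<beta> z)) * sin (\<alpha> - \<alpha>')"
    by (simp add: char_value_def sin_diff algebra_simps)
  then have "sin (\<alpha> - \<alpha>') * Im z * Im (char_value \<alpha>' \<beta> z * cnj (char_value \<alpha> \<beta> z))
      = (sin (\<alpha> - \<alpha>'))\<^sup>2 * (Im z * Im (w \<beta> z * cnj (u \<beta> z)))"
    by (simp only: power2_eq_square mult_ac)
  moreover have "0 < (sin (\<alpha> - \<alpha>'))\<^sup>2 * (Im z * Im (w \<beta> z * cnj (u \<beta> z)))"
    by (rule mult_pos_pos[OF _ boundary_values_Im[OF z]]) (use s in simp)
  ultimately show ?thesis by (simp only:)
qed

lemma char_value_no_common_zero: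
  assumes s: "sin (\<alpha> - \<alpha>') \<noteq> 0"
  shows "char_value \<alpha> \<beta> z \<noteq> 0 \<or> char_value \<alpha>' \<beta> z \<noteq> 0"
proof (rule ccontr)
  assume "\<not> ?thesis"
  then have 1: "w \<beta> z * sin \<alpha> - u \<beta> z * cos \<alpha> = 0" and 2: "w \<beta> z * sin \<alpha>' - u \<beta> z * cos \<alpha>' = 0"
    by (auto simp: char_value_def)
  have "w \<beta> z * sin (\<alpha> - \<alpha>') = (w \<beta> z * sin \<alpha> - u \<beta> z * cos \<alpha>) * cos \<alpha>' - (w \<beta> z * sin \<alpha>' - u \<beta> z * cos \<alpha>') * cos \<alpha>"
    by (simp add: sin_diff algebra_simps)
  moreover have "u \<beta> z * sin (\<alpha> - \<alpha>') = (w \<beta> z * sin \<alpha> - u \<beta> z * cos \<alpha>) * sin \<alpha>' - (w \<beta> z * sin \<alpha>' - u \<beta> z * cos \<alpha>') * sin \<alpha>"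
    by (simp add: sin_diff algebra_simps)
  ultimately have "w \<beta> z * sin (\<alpha> - \<alpha>') = 0" "u \<beta> z * sin (\<alpha> - \<alpha>') = 0" unfolding 1 2 by simp_all
  then show False using s boundary_values_nonzero[of \<beta> z] by simp
qed

lemma eigenvalue_iff_char_value: "is_eigenvalue S q M \<alpha> \<beta> z \<longleftrightarrow> char_value \<alpha> \<beta> z = 0"
  by (simp add: eigenvalue_iff_zero char_value_def)

lemma char_fun_eq: "char_fun S q M \<alpha> \<beta> z = char_value \<alpha> \<beta> z"
  by (simp add: char_fun_def char_value_def u_def w_def)

text \<open>Numerator and denominator of \<open>m_fun\<close> are the boundary values rotated by
  \<alpha>. A further rotation by \<open>\<alpha>' - \<alpha>\<close> gives the characteristic
  function for \<alpha>' as the cosine times the denominator plus the sine times the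
  numerator.\<close>

lemma m_fun_eq:
  assumes s: "sin (\<alpha>' - \<alpha>) \<noteq> 0" and nz: "char_value \<alpha> \<beta> z \<noteq> 0"
  shows "m_fun S q M \<alpha> \<beta> z = (char_value \<alpha>' \<beta> z / char_value \<alpha> \<beta> z - cos (\<alpha>' - \<alpha>)) / sin (\<alpha>' - \<alpha>)"
proof -
  define n where "n = u \<beta> z * sin \<alpha> + w \<beta> z * cos \<alpha>"
  have sc: "complex_of_real (sin \<alpha>) * sin \<alpha> = 1 - complex_of_real (cos \<alpha>) * cos \<alpha>"
  proof -
    have "sin \<alpha> * sin \<alpha> = 1 - cos \<alpha> * cos \<alpha>" using sin_cos_squared_add[of \<alpha>] by (simp add: power2_eq_square)
    from arg_cong[OF this, of complex_of_real] show ?thesis by simp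
  qed
  have "n * sin (\<alpha>' - \<alpha>) = char_value \<alpha>' \<beta> z - cos (\<alpha>' - \<alpha>) * char_value \<alpha> \<beta> z"
  proof -
    have "char_value \<alpha>' \<beta> z - cos (\<alpha>' - \<alpha>) * char_value \<alpha> \<beta> z
      = w \<beta> z * (sin \<alpha>' - sin \<alpha>' * (complex_of_real (sin \<alpha>) * sin \<alpha>) - cos \<alpha>' * (complex_of_real (cos \<alpha>) * sin \<alpha>))
        - u \<beta> z * (cos \<alpha>' - cos \<alpha>' * (complex_of_real (cos \<alpha>) * cos \<alpha>) - sin \<alpha>' * (complex_of_real (cos \<alpha>) * sin \<alpha>))"
      by (simp add: char_value_def cos_diff algebra_simps)
    also have "complex_of_real (cos \<alpha>) * cos \<alpha> = 1 - complex_of_real (sin \<alpha>) * sin \<alpha>" using sc by simp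
    also have "w \<beta> z * (sin \<alpha>' - sin \<alpha>' * (complex_of_real (sin \<alpha>) * sin \<alpha>) - cos \<alpha>' * (complex_of_real (cos \<alpha>) * sin \<alpha>))
       = w \<beta> z * (sin \<alpha>' - sin \<alpha>' * (1 - complex_of_real (cos \<alpha>) * cos \<alpha>) - cos \<alpha>' * (complex_of_real (cos \<alpha>) * sin \<alpha>))"
      by (simp only: sc)
    finally show ?thesis by (simp add: n_def sin_diff algebra_simps)
  qed
  then have "n = (char_value \<alpha>' \<beta> z - cos (\<alpha>' - \<alpha>) * char_value \<alpha> \<beta> z) / sin (\<alpha>' - \<alpha>)"
    using s by (simp add: nonzero_eq_divide_eq)
  moreover have "m_fun S q M \<alpha> \<beta> z = n / char_value \<alpha> \<beta> z"
    by (simp add: m_fun_def n_def char_fun_eq u_def w_def)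
  ultimately show ?thesis using nz by (simp add: diff_divide_distrib)
qed

end

theorem theorem3p1:
  fixes S \<alpha> \<alpha>' \<beta> \<beta>t :: real
    and q qt :: "real \<Rightarrow> real"
    and M Mt :: "real^2^2"
    and ev evt mu mut :: "nat \<Rightarrow> real"
  assumes "S > 0"
    and "\<alpha> \<in> {0..<pi}" and "\<alpha>' \<in> {0..<pi}" and "\<alpha>' \<noteq> \<alpha>"
    and "real_L2_on {-S..S} q" and "det M = 1" and "\<beta> \<in> {0<..pi}"
    and "real_L2_on {-S..S} qt" and "det Mt = 1" and "\<beta>t \<in> {0<..pi}"
    and "is_eigenvalue_sequence S q M \<alpha> \<beta> ev"
    and "is_eigenvalue_sequence S q M \<alpha>' \<beta> mu"
    and "is_eigenvalue_sequence S qt Mt \<alpha> \<beta>t evt"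
    and "is_eigenvalue_sequence S qt Mt \<alpha>' \<beta>t mut"
    and "\<forall>n. ev n = evt n" and "\<forall>n. mu n = mut n"
  shows "m_fun S q M \<alpha> \<beta> = m_fun S qt Mt \<alpha> \<beta>t"
proof -
  interpret A: transfer_problem S q M using assms by unfold_locales
  interpret B: transfer_problem S qt Mt using assms by unfold_locales
  have neg: "sin (\<alpha> - \<alpha>') = - sin (\<alpha>' - \<alpha>)" using sin_minus[of "\<alpha>' - \<alpha>"] by simp
  \<comment> \<open>Distinct angles in [0, pi) differ by less than pi, so the sine of their
    difference is not 0.\<close>
  have s1: "sin (\<alpha> - \<alpha>') \<noteq> 0"
  proof (cases "\<alpha> < \<alpha>'")
    case True
    then have "sin (\<alpha>' - \<alpha>) > 0" using assms(2,3) by (intro sin_gt_zero) auto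
    then show ?thesis using neg by linarith
  next
    case False
    then have "sin (\<alpha> - \<alpha>') > 0" using assms(2,3,4) by (intro sin_gt_zero) auto
    then show ?thesis by simp
  qed
  have s2: "sin (\<alpha>' - \<alpha>) \<noteq> 0" using s1 neg by linarith
  have "ev = evt" "mu = mut" using assms(15,16) by auto
  then have zeros: "A.char_value \<alpha> \<beta> z = 0 \<longleftrightarrow> B.char_value \<alpha> \<beta>t z = 0"
    "A.char_value \<alpha>' \<beta> z = 0 \<longleftrightarrow> B.char_value \<alpha>' \<beta>t z = 0" for z
    using assms(11-14) unfolding is_eigenvalue_sequence_def A.eigenvalue_iff_char_value B.eigenvalue_iff_char_value
    by (metis (mono_tags, lifting) mem_Collect_eq)+
  obtain c where c: "c \<noteq> 0"
    "\<And>z. A.char_value \<alpha>' \<beta> z * B.char_value \<alpha> \<beta>t z = c * (A.char_value \<alpha> \<beta> z * B.char_value \<alpha>' \<beta>t z)"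
    using herglotz_pair_ratio[OF A.char_value_holomorphic A.char_value_holomorphic B.char_value_holomorphic B.char_value_holomorphic
        A.char_value_Im[OF _ s1] B.char_value_Im[OF _ s1] A.char_value_no_common_zero[OF s1] B.char_value_no_common_zero[OF s1] zeros]
    by metis
  define \<zeta> where "\<zeta> s = \<i> * complex_of_real (s^4)" for s :: real
  define k where "k s = complex_of_real (s\<^sup>2) * cis (-(pi/4))" for s :: real
  define F where "F s = A.w \<beta> (\<zeta> s) / A.u \<beta> (\<zeta> s)" for s
  define G where "G s = B.w \<beta>t (\<zeta> s) / B.u \<beta>t (\<zeta> s)" for s
  have limF: "((\<lambda>s. F s / k s) \<longlongrightarrow> -1) at_top"
    unfolding F_def \<zeta>_def k_def by (rule A.boundary_values_asymptotics)
  have limG: "((\<lambda>s. G s / k s) \<longlongrightarrow> -1) at_top"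
    unfolding G_def \<zeta>_def k_def by (rule B.boundary_values_asymptotics)
  have k0: "\<forall>\<^sub>F s in at_top. k s \<noteq> 0"
    using eventually_gt_at_top[of 0] by eventually_elim (simp add: k_def)
  have kinv: "((\<lambda>s. inverse (k s)) \<longlongrightarrow> 0) at_top"
  proof (rule Lim_null_comparison)
    show "\<forall>\<^sub>F s in at_top. norm (inverse (k s)) \<le> inverse s * inverse s"
      using eventually_gt_at_top[of 0]
      by eventually_elim (simp add: k_def norm_inverse norm_mult norm_power power2_eq_square)
    have "((\<lambda>s::real. inverse s * inverse s) \<longlongrightarrow> 0 * 0) at_top"
      by (intro tendsto_intros tendsto_inverse_0_at_top filterlim_ident)
    then show "((\<lambda>s::real. inverse s * inverse s) \<longlongrightarrow> 0) at_top" by simp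
  qed
  \<comment> \<open>This is the quotient of the two characteristic functions for the angle
    \<open>a\<close>, each divided by its own \<open>u\<close>; written in terms of \<open>F\<close>
    and \<open>G\<close>, it has a visible limit.\<close>
  define r where "r a s = (F s * of_real (sin a) - of_real (cos a)) / (G s * of_real (sin a) - of_real (cos a))" for a s :: real
  have lim: "(r a \<longlongrightarrow> 1) at_top" for a :: real
  proof -
    have "complex_of_real (sin a) \<noteq> 0 \<or> complex_of_real (cos a) \<noteq> 0"
      using sin_zero_abs_cos_one[of a] by auto
    then show ?thesis unfolding r_def[abs_def] by (rule affine_ratio_tendsto_1[OF limF limG kinv k0])
  qed
  \<comment> \<open>The factors \<open>u\<close> are the same for both angles, so the identity for
    \<open>c\<close> survives the division by them. As both quotients tend to 1, it forces
    \<open>c = 1\<close>.\<close>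
  have "\<forall>\<^sub>F s in at_top. c * r \<alpha> s = r \<alpha>' s"
    using eventually_gt_at_top[of "0::real"]
  proof eventually_elim
    case (elim s)
    have z: "Im (\<zeta> s) \<noteq> 0" using elim by (simp add: \<zeta>_def)
    have u: "A.u \<beta> (\<zeta> s) \<noteq> 0" "B.u \<beta>t (\<zeta> s) \<noteq> 0"
      using A.boundary_values_Im[OF z, of \<beta>] B.boundary_values_Im[OF z, of \<beta>t] by auto
    have nz: "B.char_value \<alpha> \<beta>t (\<zeta> s) \<noteq> 0" "B.char_value \<alpha>' \<beta>t (\<zeta> s) \<noteq> 0"
      using B.char_value_Im[OF z s1, of \<beta>t] by auto
    have e: "F s * of_real (sin a) - of_real (cos a) = A.char_value a \<beta> (\<zeta> s) / A.u \<beta> (\<zeta> s)"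
      "G s * of_real (sin a) - of_real (cos a) = B.char_value a \<beta>t (\<zeta> s) / B.u \<beta>t (\<zeta> s)" for a :: real
      using u by (simp_all add: F_def G_def A.char_value_def B.char_value_def diff_divide_distrib)
    show ?case unfolding r_def e using c(2)[of "\<zeta> s"] u nz by (simp add: field_simps)
  qed
  then have "(r \<alpha>' \<longlongrightarrow> c * 1) at_top"
    by (rule Lim_transform_eventually[rotated]) (intro tendsto_intros lim)
  then have c1: "c = 1" using tendsto_unique[OF _ lim[of \<alpha>']] by fastforce
  show ?thesis
  proof
    fix z
    show "m_fun S q M \<alpha> \<beta> z = m_fun S qt Mt \<alpha> \<beta>t z"
    proof (cases "A.char_value \<alpha> \<beta> z = 0")
      \<comment> \<open>At a common pole both denominators are 0, and both sides take the value 0 by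
        the convention for division.\<close>
      case True
      then show ?thesis using zeros(1)[of z] by (simp add: m_fun_def A.char_fun_eq B.char_fun_eq)
    next
      case False
      then have nz: "B.char_value \<alpha> \<beta>t z \<noteq> 0" using zeros(1) by simp
      have "A.char_value \<alpha>' \<beta> z / A.char_value \<alpha> \<beta> z = B.char_value \<alpha>' \<beta>t z / B.char_value \<alpha> \<beta>t z"
        using c(2)[of z] c1 False nz by (simp add: field_simps)
      then show ?thesis by (simp add: A.m_fun_eq[OF s2 False] B.m_fun_eq[OF s2 nz])
    qed
  qed
qed

end
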